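(* Let $t_n(123)$ be the number of shallow $123$-avoiding permutations in $S_n$ (with $t_0(123)=1$), and $T_{123}(x)=\sum_{n\ge 0}t_n(123)x^n$. Then $$T_{123}(x)=\frac{1-3x+11x^3-13x^4+7x^5+6x^6+3x^7}{(1-x)^4(1-4x^2+x^4)}.$$
   Context: For $\pi\in S_n$: $D(\pi)=\sum_{i}|\pi_i-i|$, $I(\pi)$ is the number of inversions, $T(\pi)=n-\mathrm{cyc}(\pi)$ with $\mathrm{cyc}$ the number of cycles in the disjoint cycle decomposition; $\pi$ is shallow if $I(\pi)+T(\pi)=D(\pi)$. A permutation avoids a pattern $\sigma$ if it has no subsequence order-isomorphic to $\sigma$. *)

theory Defs
  imports "HOL-Combinatorics.Permutations" "HOL-Computational_Algebra.Formal_Power_Series"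
begin

text \<open>Permutations of S_n are represented as functions p :: nat => nat with
  p permutes {1..n}; the word is p 1, ..., p n.\<close>

definition total_disp :: "nat \<Rightarrow> (nat \<Rightarrow> nat) \<Rightarrow> int" where
  "total_disp n p = (\<Sum>i\<in>{1..n}. \<bar>int (p i) - int i\<bar>)"

definition inversions :: "nat \<Rightarrow> (nat \<Rightarrow> nat) \<Rightarrow> nat" where
  "inversions n p = card {(i, j). i \<in> {1..n} \<and> j \<in> {1..n} \<and> i < j \<and> p j < p i}"

text \<open>Number of cycles of the disjoint cycle decomposition (fixed points count as
  1-cycles): the number of distinct orbits of elements of {1..n}.\<close>
definition num_cycles :: "nat \<Rightarrow> (nat \<Rightarrow> nat) \<Rightarrow> nat" where
  "num_cycles n p = card ((\<lambda>i. {(p ^^ k) i | k. True}) ` {1..n})"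

definition reflection_len :: "nat \<Rightarrow> (nat \<Rightarrow> nat) \<Rightarrow> nat" where
  "reflection_len n p = n - num_cycles n p"

definition shallow :: "nat \<Rightarrow> (nat \<Rightarrow> nat) \<Rightarrow> bool" where
  "shallow n p \<longleftrightarrow> int (inversions n p) + int (reflection_len n p) = total_disp n p"

definition avoids_123 :: "nat \<Rightarrow> (nat \<Rightarrow> nat) \<Rightarrow> bool" where
  "avoids_123 n p \<longleftrightarrow>
     \<not> (\<exists>i j k. 1 \<le> i \<and> i < j \<and> j < k \<and> k \<le> n \<and> p i < p j \<and> p j < p k)"

definition t123 :: "nat \<Rightarrow> nat" where
  "t123 n = card {p. p permutes {1..n} \<and> avoids_123 n p \<and> shallow n p}"

end

theory Submission
  imports Defs "HOL-Combinatorics.Orbits"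
begin

text \<open>
  Call \<open>D - I - T\<close> the defect. Removing an inversion \<open>(i, j)\<close> by a transposition lowers \<open>I\<close> by \<open>1 + 2 R\<close>, where
  \<open>R\<close> counts the points inside the rectangle spanned by the two entries, lowers \<open>D\<close> by twice the
  overlap \<open>L\<close> of \<open>[i, j]\<close> and \<open>[p j, p i]\<close>, and changes \<open>T\<close> by one. Moving \<open>n\<close> to the end in this way proves
  that the defect is nonnegative (Diaconis and Graham). Hence \<open>L \<le> R + 1\<close> for every inversion of a
  shallow permutation, and if the transposition splits a cycle, then \<open>L = R + 1\<close> says exactly that the
  defect is preserved.

  For a 123-avoiding \<open>p\<close>, stripping \<open>n\<close> and \<open>1\<close> when \<open>p 1 = n\<close> relates the count for \<open>n\<close> to that for
  \<open>n - 2\<close>, up to explicit families in which the two conditions above leave only a few decreasing blocks and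
  which are counted by binomial coefficients. The result is
  \<open>t\<^sub>m\<^sub>+\<^sub>4 = 4 t\<^sub>m\<^sub>+\<^sub>2 - t\<^sub>m + 2 m\<^sup>3 + m\<^sup>2 + 7 m + 6\<close>.
\<close>

text \<open>The obstacle is the case \<open>p 1 = n\<close>, \<open>p n \<noteq> 1\<close>: what
  remains after stripping need not avoid 123, so the numbers t_m admit no direct recurrence among
  themselves. A second sequence is carried along: s_m, the number of shallow permutations of size m
  with a marked position subject to order conditions (\<open>slots m\<close>). If the marked entry
  is 1 or stands last, these conditions amount to plain avoidance; all other marked permutations lie
  in four families with three parameters each. Up to polynomials this gives the system t_{m+2} = t_m
  + 2 s_m and s_{m+2} = 2 t_{m+2} - t_m - s_m, where the factor 2 in the first equation comes from
  passing to the inverse permutation. Eliminating s produces the coefficients 4 and -1, hence the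
  factor 1 - 4x^2 + x^4; the cubic remainder accounts for (1 - x)^4. The defect is defined over an
  arbitrary set of positions because the inductions strip both ends and cut the ground set into
  blocks.\<close>

definition disp :: "nat set \<Rightarrow> (nat \<Rightarrow> nat) \<Rightarrow> int" where
  "disp S p = (\<Sum>i\<in>S. \<bar>int (p i) - int i\<bar>)"

definition invs :: "nat set \<Rightarrow> (nat \<Rightarrow> nat) \<Rightarrow> nat" where
  "invs S p = card {(i, j). i \<in> S \<and> j \<in> S \<and> i < j \<and> p j < p i}"

definition cycs :: "nat set \<Rightarrow> (nat \<Rightarrow> nat) \<Rightarrow> nat" where
  "cycs S p = card (orbit p ` S)"

definition defect :: "nat set \<Rightarrow> (nat \<Rightarrow> nat) \<Rightarrow> int" where
  "defect S p = disp S p - int (invs S p) - int (card S) + int (cycs S p)"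

text \<open>\<open>orbit\<close> collects positive powers only. A permutation of a finite set
  returns to its starting point, so admitting \<open>k = 0\<close> as in \<open>num_cycles\<close>
  changes nothing.\<close>

lemma orbit_funpow:
  assumes "finite S" "p permutes S"
  shows "orbit p x = {(p ^^ k) x | k. True}"
  using orbit_altdef_permutation permutation_permutes assms by (metis (mono_tags, lifting))

lemma shallow_iff_defect:
  assumes "p permutes {1..n}"
  shows "shallow n p \<longleftrightarrow> defect {1..n} p = 0"
proof -
  have "num_cycles n p = cycs {1..n} p"
    unfolding num_cycles_def cycs_def using orbit_funpow[OF _ assms] by simp
  \<comment> \<open>This bound makes the truncated subtraction in \<open>reflection_len\<close> a
    true one.\<close>
  moreover have "cycs {1..n} p \<le> n"
    unfolding cycs_def using card_image_le[of "{1..n}" "orbit p"] by simp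
  ultimately show ?thesis
    by (auto simp: shallow_def defect_def disp_def total_disp_def reflection_len_def inversions_def
        invs_def of_nat_diff)
qed

subsection \<open>Multiplication by a transposition\<close>

lemma orbit_self:
  assumes "finite S" "p permutes S" shows "x \<in> orbit p x"
proof -
  have "permutation p" unfolding permutation_permutes using assms by auto
  then show ?thesis by (rule permutation_self_in_orbit)
qed

lemma orbit_eq:
  assumes "finite S" "p permutes S" "y \<in> orbit p x"
  shows "orbit p y = orbit p x"
proof -
  have x: "x \<in> orbit p y" using orbit_swap[OF orbit_self[OF assms(1,2)] assms(3)] .
  show ?thesis using orbit_trans[OF _ x] orbit_trans[OF _ assms(3)] by (intro equalityI subsetI)
qed

lemma orbit_comp_transpose:
  assumes "finite S" "p permutes S" "i \<in> S" "j \<in> S" "i \<notin> orbit p x" "j \<notin> orbit p x"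
  shows "orbit (p \<circ> transpose i j) x = orbit p x"
proof -
  have p': "(p \<circ> transpose i j) permutes S"
    using assms by (simp add: permutes_compose permutes_swap_id)
  have "((p \<circ> transpose i j) ^^ k) x = (p ^^ k) x" for k
  proof (induction k)
    case (Suc k)
    have "(p ^^ k) x \<in> orbit p x" using orbit_funpow[OF assms(1,2)] by auto
    then have "(p ^^ k) x \<noteq> i" "(p ^^ k) x \<noteq> j" using assms by auto
    then show ?case using Suc by (simp add: transpose_def)
  qed simp
  then show ?thesis using orbit_funpow[OF assms(1,2)] orbit_funpow[OF assms(1) p'] by auto
qed

text \<open>The product sends \<open>j\<close> to \<open>p i\<close> and from there follows the
  cycle of \<open>i\<close> under \<open>p\<close>. That cycle avoids \<open>j\<close> and meets
  \<open>i\<close> only at its end, so after \<open>N\<close> steps, the length of the cycle, the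
  path from \<open>j\<close> arrives at \<open>i\<close>.\<close>

lemma orbit_merge:
  assumes "finite S" "p permutes S" "i \<in> S" "j \<in> S" "orbit p i \<noteq> orbit p j"
  shows "orbit (p \<circ> transpose i j) i = orbit (p \<circ> transpose i j) j"
proof -
  let ?q = "p \<circ> transpose i j"
  have q: "?q permutes S"
    using assms by (simp add: permutes_compose permutes_swap_id)
  have ji: "j \<notin> orbit p i" using orbit_eq[OF assms(1,2)] assms(5) by metis
  define N where "N = (LEAST k. 0 < k \<and> (p ^^ k) i = i)"
  have "i \<in> orbit p i" using orbit_self[OF assms(1,2)] .
  then have "\<exists>k. 0 < k \<and> (p ^^ k) i = i" unfolding orbit_altdef by auto
  then have N: "0 < N" "(p ^^ N) i = i" and least: "\<And>k. 0 < k \<Longrightarrow> k < N \<Longrightarrow> (p ^^ k) i \<noteq> i"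
    unfolding N_def using LeastI_ex[of "\<lambda>k. 0 < k \<and> (p ^^ k) i = i"] not_less_Least by blast+
  have "k < N \<Longrightarrow> (?q ^^ Suc k) j = (p ^^ Suc k) i" for k
  proof (induction k)
    case (Suc k)
    have "(p ^^ Suc k) i \<in> orbit p i" unfolding orbit_funpow[OF assms(1,2)] by blast
    then have "(p ^^ Suc k) i \<noteq> j" using ji by auto
    moreover have "(p ^^ Suc k) i \<noteq> i" using least[of "Suc k"] Suc.prems by simp
    ultimately have "transpose i j ((p ^^ Suc k) i) = (p ^^ Suc k) i" by (simp add: transpose_def)
    moreover have IH: "(?q ^^ Suc k) j = (p ^^ Suc k) i" using Suc.IH Suc.prems Suc_lessD by blast
    ultimately have e: "?q ((?q ^^ Suc k) j) = p ((p ^^ Suc k) i)"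
      unfolding IH by (subst comp_apply) (erule arg_cong)
    have "(?q ^^ Suc (Suc k)) j = ?q ((?q ^^ Suc k) j)"
      by (subst funpow.simps(2)) (rule comp_apply)
    also note e
    also have "p ((p ^^ Suc k) i) = (p ^^ Suc (Suc k)) i" by simp
    finally show ?case .
  qed simp
  from this[of "N - 1"] N have "(?q ^^ N) j = i" by simp
  then have "i \<in> orbit ?q j" unfolding orbit_funpow[OF assms(1) q] by (metis (mono_tags, lifting) mem_Collect_eq)
  then show ?thesis using orbit_eq[OF assms(1) q] by auto
qed

lemma cycs_decomp:
  assumes "finite S" "i \<in> S" "j \<in> S"
  shows "cycs S p = card (orbit p ` S - {orbit p i, orbit p j}) + card {orbit p i, orbit p j}"
proof -
  have "orbit p ` S = (orbit p ` S - {orbit p i, orbit p j}) \<union> {orbit p i, orbit p j}"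
    using assms by auto
  then show ?thesis unfolding cycs_def using assms(1)
    by (metis (no_types, lifting) Diff_disjoint Int_commute card_Un_disjoint finite.emptyI finite.insertI finite_Diff finite_imageI)
qed

lemma other_orbits_subset:
  assumes "finite S" "p permutes S" "i \<in> S" "j \<in> S"
  shows "orbit p ` S - {orbit p i, orbit p j}
    \<subseteq> orbit (p \<circ> transpose i j) ` S - {orbit (p \<circ> transpose i j) i, orbit (p \<circ> transpose i j) j}"
proof
  let ?q = "p \<circ> transpose i j"
  have q: "?q permutes S"
    using assms by (simp add: permutes_compose permutes_swap_id)
  fix O' assume "O' \<in> orbit p ` S - {orbit p i, orbit p j}"
  then obtain x where x: "x \<in> S" "O' = orbit p x" "orbit p x \<noteq> orbit p i" "orbit p x \<noteq> orbit p j" by auto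
  have ij: "i \<notin> orbit p x" "j \<notin> orbit p x" using x orbit_eq[OF assms(1,2)] by metis+
  have e: "orbit ?q x = O'" using orbit_comp_transpose[OF assms(1-4) ij] x by simp
  have "O' \<noteq> orbit ?q i" "O' \<noteq> orbit ?q j" using ij x orbit_self[OF assms(1) q] by auto
  then show "O' \<in> orbit ?q ` S - {orbit ?q i, orbit ?q j}" using e x by auto
qed

text \<open>The same transposition turns the product back into \<open>p\<close>, so the inclusion
  just proved also holds in the other direction.\<close>

lemma other_orbits_eq:
  assumes "finite S" "p permutes S" "i \<in> S" "j \<in> S"
  shows "orbit (p \<circ> transpose i j) ` S - {orbit (p \<circ> transpose i j) i, orbit (p \<circ> transpose i j) j}
    = orbit p ` S - {orbit p i, orbit p j}"
proof -
  have q: "(p \<circ> transpose i j) permutes S"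
    using assms by (simp add: permutes_compose permutes_swap_id)
  have "p \<circ> transpose i j \<circ> transpose i j = p" by (simp add: comp_assoc)
  then show ?thesis
    using other_orbits_subset[OF assms] other_orbits_subset[OF assms(1) q assms(3,4)] by auto
qed

text \<open>The orbits other than those of \<open>i\<close> and \<open>j\<close> are common to both
  permutations. The counts can differ only in the orbits of \<open>i\<close> and \<open>j\<close>,
  which are one or two on either side.\<close>

lemma cycs_comp_transpose:
  assumes "finite S" "p permutes S" "i \<in> S" "j \<in> S"
  shows "cycs S p \<le> cycs S (p \<circ> transpose i j) + 1"
    and "orbit p i \<noteq> orbit p j \<Longrightarrow> cycs S p = cycs S (p \<circ> transpose i j) + 1"
proof -
  show "cycs S p \<le> cycs S (p \<circ> transpose i j) + 1"
    unfolding cycs_decomp[OF assms(1,3,4), of p] cycs_decomp[OF assms(1,3,4), of "p \<circ> transpose i j"]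
      other_orbits_eq[OF assms]
    by (auto simp: card_insert_if)
  assume *: "orbit p i \<noteq> orbit p j"
  show "cycs S p = cycs S (p \<circ> transpose i j) + 1"
    unfolding cycs_decomp[OF assms(1,3,4), of p] cycs_decomp[OF assms(1,3,4), of "p \<circ> transpose i j"]
      other_orbits_eq[OF assms]
    using * orbit_merge[OF assms *] by (auto simp: card_insert_if)
qed

section \<open>Effect of a transposition on displacement, inversions and defect\<close>

lemma disp_comp_transpose:
  assumes "finite S" "i \<in> S" "j \<in> S" "i < j" "p i < p j"
  shows "disp S (p \<circ> transpose i j) = disp S p + 2 * max 0 (min (int j) (int (p j)) - max (int i) (int (p i)))"
proof -
  let ?f = "\<lambda>p k. \<bar>int (p k) - int k\<bar> :: int"
  have S: "S = insert i (insert j (S - {i, j}))" using assms by auto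
  have sum: "disp S q = ?f q i + (?f q j + sum (?f q) (S - {i, j}))" for q
    unfolding disp_def using assms by (subst S) (simp add: sum.insert_if)
  have eq: "sum (?f (p \<circ> transpose i j)) (S - {i, j}) = sum (?f p) (S - {i, j})"
    by (rule sum.cong) (auto simp: transpose_def)
  show ?thesis unfolding sum[of p] sum[of "p \<circ> transpose i j"] eq using assms(4,5) by (simp add: max_def min_def)
qed

lemma invs_sum:
  assumes "finite S"
  shows "int (invs S p) = (\<Sum>x\<in>S. \<Sum>y\<in>S. of_bool (x < y \<and> p y < p x))"
proof -
  have "{(i, j). i \<in> S \<and> j \<in> S \<and> i < j \<and> p j < p i} = Sigma S (\<lambda>x. {y \<in> S. x < y \<and> p y < p x})"
    by auto
  then have "invs S p = (\<Sum>x\<in>S. card {y \<in> S. x < y \<and> p y < p x})"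
    unfolding invs_def using assms by simp
  then show ?thesis using assms by (simp add: Collect_conj_eq)
qed

lemma double_sum_split:
  fixes f :: "nat \<Rightarrow> nat \<Rightarrow> int"
  assumes "finite S" "i \<in> S" "j \<in> S" "i \<noteq> j"
  shows "(\<Sum>x\<in>S. \<Sum>y\<in>S. f x y) = (\<Sum>x\<in>S-{i,j}. \<Sum>y\<in>S-{i,j}. f x y)
    + (\<Sum>k\<in>S-{i,j}. f k i + f i k + f k j + f j k) + f i i + f j j + f i j + f j i"
proof -
  have S: "S = insert i (insert j (S - {i, j}))" using assms by auto
  have s: "sum g S = g i + g j + sum g (S - {i, j})" for g :: "nat \<Rightarrow> int"
    using assms by (subst S) (simp add: sum.insert_if)
  show ?thesis unfolding s by (simp add: sum.distrib)
qed

text \<open>The pair (i, j) itself becomes an inversion. For a third index k the pairs formed with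
  \<open>i\<close> and \<open>j\<close> together gain two inversions if k lies in the rectangle, and
  none otherwise.\<close>

lemma invs_comp_transpose:
  assumes "finite S" "inj_on p S" "i \<in> S" "j \<in> S" "i < j" "p i < p j"
  shows "int (invs S (p \<circ> transpose i j)) = int (invs S p) + 1
    + 2 * int (card {k \<in> S. i < k \<and> k < j \<and> p i < p k \<and> p k < p j})"
proof -
  let ?q = "p \<circ> transpose i j"
  let ?R = "{k \<in> S. i < k \<and> k < j \<and> p i < p k \<and> p k < p j}"
  let ?f = "\<lambda>p x y. of_bool (x < y \<and> p y < p x) :: int"
  have qi: "?q i = p j" "?q j = p i" by auto
  have qk: "k \<notin> {i, j} \<Longrightarrow> ?q k = p k" for k by (auto simp: transpose_def)
  have 1: "(\<Sum>x\<in>S-{i,j}. \<Sum>y\<in>S-{i,j}. ?f ?q x y) = (\<Sum>x\<in>S-{i,j}. \<Sum>y\<in>S-{i,j}. ?f p x y)"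
    by (intro sum.cong refl) (simp add: transpose_def)
  have "(\<Sum>k\<in>S-{i,j}. ?f ?q k i + ?f ?q i k + ?f ?q k j + ?f ?q j k)
      = (\<Sum>k\<in>S-{i,j}. (?f p k i + ?f p i k + ?f p k j + ?f p j k) + 2 * of_bool (k \<in> ?R))"
  proof (rule sum.cong)
    fix k assume k: "k \<in> S - {i, j}"
    then have "p k \<noteq> p i" "p k \<noteq> p j" using assms unfolding inj_on_def by blast+
    then show "?f ?q k i + ?f ?q i k + ?f ?q k j + ?f ?q j k
      = (?f p k i + ?f p i k + ?f p k j + ?f p j k) + 2 * of_bool (k \<in> ?R)"
      unfolding qi using k qk[of k] assms by (auto simp: of_bool_def)
  qed simp
  also have "\<dots> = (\<Sum>k\<in>S-{i,j}. ?f p k i + ?f p i k + ?f p k j + ?f p j k) + 2 * (\<Sum>k\<in>S-{i,j}. of_bool (k \<in> ?R))"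
    by (simp add: sum.distrib sum_distrib_left)
  also have "(\<Sum>k\<in>S-{i,j}. of_bool (k \<in> ?R)) = int (card ?R)"
  proof -
    have "(S - {i, j}) \<inter> ?R = ?R" by auto
    moreover have "(\<Sum>k\<in>S-{i,j}. of_bool (k \<in> ?R)) = int (card ((S - {i, j}) \<inter> ?R))"
      using assms(1) by (subst sum_of_bool_eq) (auto simp del: mem_Collect_eq)
    ultimately show ?thesis by presburger
  qed
  finally have 2: "(\<Sum>k\<in>S-{i,j}. ?f ?q k i + ?f ?q i k + ?f ?q k j + ?f ?q j k)
      = (\<Sum>k\<in>S-{i,j}. ?f p k i + ?f p i k + ?f p k j + ?f p j k) + 2 * int (card ?R)" .
  have 3: "?f ?q i i + ?f ?q j j + ?f ?q i j + ?f ?q j i = 1"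
       "?f p i i + ?f p j j + ?f p i j + ?f p j i = 0"
    unfolding qi using assms by auto
  have ne: "i \<noteq> j" using assms by auto
  show ?thesis
    unfolding invs_sum[OF assms(1)] double_sum_split[OF assms(1,3,4) ne, of "?f ?q"]
      double_sum_split[OF assms(1,3,4) ne, of "?f p"] 1 2 using 3 by linarith
qed

text \<open>For a non-inversion \<open>(i, j)\<close>: the length of the intersection of \<open>[i, j]\<close> and \<open>[p i, p j]\<close>, which is
  half the growth of the total displacement when the two entries are exchanged.\<close>

definition overlap :: "(nat \<Rightarrow> nat) \<Rightarrow> nat \<Rightarrow> nat \<Rightarrow> int" where
  "overlap p i j = max 0 (min (int j) (int (p j)) - max (int i) (int (p i)))"

definition ascent_box :: "nat set \<Rightarrow> (nat \<Rightarrow> nat) \<Rightarrow> nat \<Rightarrow> nat \<Rightarrow> nat set" where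
  "ascent_box S p i j = {k \<in> S. i < k \<and> k < j \<and> p i < p k \<and> p k < p j}"

text \<open>Merging two cycles gives equality; splitting a cycle would leave the defect larger by
  two, which the inequality absorbs.\<close>

lemma defect_comp_transpose:
  assumes "finite S" "p permutes S" "i \<in> S" "j \<in> S" "i < j" "p i < p j"
  shows "defect S (p \<circ> transpose i j) \<ge> defect S p + 2 * (overlap p i j - int (card (ascent_box S p i j)) - 1)"
    and "orbit p i \<noteq> orbit p j \<Longrightarrow>
      defect S (p \<circ> transpose i j) = defect S p + 2 * (overlap p i j - int (card (ascent_box S p i j)) - 1)"
proof -
  note d = disp_comp_transpose[OF assms(1,3-6)]
  note i = invs_comp_transpose[OF assms(1) permutes_inj_on[OF assms(2)] assms(3-6)]
  note c = cycs_comp_transpose[OF assms(1-4)]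
  show "defect S (p \<circ> transpose i j) \<ge> defect S p + 2 * (overlap p i j - int (card (ascent_box S p i j)) - 1)"
    unfolding defect_def overlap_def ascent_box_def d i using c(1) by (simp add: algebra_simps)
  assume "orbit p i \<noteq> orbit p j"
  from c(2)[OF this]
  show "defect S (p \<circ> transpose i j) = defect S p + 2 * (overlap p i j - int (card (ascent_box S p i j)) - 1)"
    unfolding defect_def overlap_def ascent_box_def d i by (simp add: algebra_simps)
qed

lemma orbit_fixed: "p x = x \<Longrightarrow> orbit p x = {x}"
  by (simp add: orbit_eq_singleton_iff)

text \<open>A fixed point is a cycle of its own, so the exchange merges two cycles.\<close>

lemma defect_comp_transpose_fixed:
  assumes "finite S" "p permutes S" "i \<in> S" "j \<in> S" "i < j" "p i < p j" "p i = i \<or> p j = j"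
  shows "defect S (p \<circ> transpose i j) = defect S p + 2 * (overlap p i j - int (card (ascent_box S p i j)) - 1)"
proof -
  have "i \<in> orbit p i" "j \<in> orbit p j" using orbit_self[OF assms(1,2)] by auto
  then have "orbit p i \<noteq> orbit p j" using assms(5,7) orbit_fixed[of p i] orbit_fixed[of p j] by auto
  then show ?thesis using defect_comp_transpose(2)[OF assms(1-6)] by simp
qed

subsection \<open>Decompositions of the ground set\<close>

lemma orbit_subset_block:
  assumes "p ` A \<subseteq> A" "x \<in> A" shows "orbit p x \<subseteq> A"
proof
  fix y assume "y \<in> orbit p x"
  then show "y \<in> A" by induction (use assms in auto)
qed

lemma disp_cong: "(\<And>x. x \<in> S \<Longrightarrow> p x = q x) \<Longrightarrow> disp S p = disp S q"
  unfolding disp_def by (rule sum.cong) auto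

lemma invs_cong: "(\<And>x. x \<in> S \<Longrightarrow> p x = q x) \<Longrightarrow> invs S p = invs S q"
  unfolding invs_def by (rule arg_cong[where f = card]) auto

lemma orbit_cong_block:
  assumes "\<And>x. x \<in> S \<Longrightarrow> p x = q x" "p ` S \<subseteq> S" "x \<in> S"
  shows "orbit p x = orbit q x"
proof -
  have s: "orbit p x \<subseteq> S" by (rule orbit_subset_block[OF assms(2,3)])
  have "q ` S \<subseteq> S" using assms by force
  then have s': "orbit q x \<subseteq> S" using orbit_subset_block[OF _ assms(3)] by blast
  have "y \<in> orbit p x \<Longrightarrow> y \<in> orbit q x" for y
  proof (induction rule: orbit.induct)
    case base
    then show ?case using assms by (simp add: orbit.base)
  next
    case (step y)
    then show ?case using s assms(1)[of y] by (metis orbit.step subsetD)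
  qed
  moreover have "y \<in> orbit q x \<Longrightarrow> y \<in> orbit p x" for y
  proof (induction rule: orbit.induct)
    case base
    then show ?case using assms(1,3) by (metis orbit.base)
  next
    case (step y)
    then show ?case using s' assms(1)[of y] by (metis orbit.step subsetD)
  qed
  ultimately show ?thesis by blast
qed

lemma defect_cong:
  assumes "\<And>x. x \<in> S \<Longrightarrow> p x = q x" "p ` S \<subseteq> S"
  shows "defect S p = defect S q"
proof -
  have "orbit p ` S = orbit q ` S" using orbit_cong_block[OF assms] by (intro image_cong) auto
  then show ?thesis
    unfolding defect_def cycs_def using disp_cong[OF assms(1)] invs_cong[OF assms(1)] by simp
qed

text \<open>Neither an inversion nor a cycle can connect two invariant blocks of which one lies
  entirely below the other, so every ingredient of the defect is additive.\<close>

lemma defect_Un: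
  assumes "finite A" "finite B" "\<And>x y. x \<in> A \<Longrightarrow> y \<in> B \<Longrightarrow> x < y" "p ` A \<subseteq> A" "p ` B \<subseteq> B"
  shows "defect (A \<union> B) p = defect A p + defect B p"
proof -
  have dis: "A \<inter> B = {}" using assms(3) by blast
  have "disp (A \<union> B) p = disp A p + disp B p"
    unfolding disp_def using assms dis by (simp add: sum.union_disjoint)
  moreover have "card (A \<union> B) = card A + card B" using assms dis by (simp add: card_Un_disjoint)
  moreover have "invs (A \<union> B) p = invs A p + invs B p"
  proof -
    have "{(i, j). i \<in> A \<union> B \<and> j \<in> A \<union> B \<and> i < j \<and> p j < p i}
      = {(i, j). i \<in> A \<and> j \<in> A \<and> i < j \<and> p j < p i} \<union> {(i, j). i \<in> B \<and> j \<in> B \<and> i < j \<and> p j < p i}"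
    proof -
      have "p i < p j" if "i \<in> A" "j \<in> B" for i j using assms(3)[of "p i" "p j"] assms(4,5) that by blast
      moreover have "\<not> i < j" if "j \<in> A" "i \<in> B" for i j using assms(3)[of j i] that by simp
      ultimately show ?thesis using less_asym by blast
    qed
    moreover have "finite {(i, j). i \<in> A \<and> j \<in> A \<and> i < j \<and> p j < p i}"
      by (rule finite_subset[of _ "A \<times> A"]) (use assms in auto)
    moreover have "finite {(i, j). i \<in> B \<and> j \<in> B \<and> i < j \<and> p j < p i}"
      by (rule finite_subset[of _ "B \<times> B"]) (use assms in auto)
    ultimately show ?thesis unfolding invs_def using dis
      by (simp, subst card_Un_disjoint) auto
  qed
  moreover have "cycs (A \<union> B) p = cycs A p + cycs B p"
  proof -
    have "orbit p ` A \<inter> orbit p ` B = {}"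
    proof (rule ccontr)
      assume "orbit p ` A \<inter> orbit p ` B \<noteq> {}"
      then obtain x y where "x \<in> A" "y \<in> B" "orbit p x = orbit p y" by auto
      moreover have "p x \<in> orbit p x" by (rule orbit.base)
      ultimately show False
        using orbit_subset_block[OF assms(4)] orbit_subset_block[OF assms(5)] dis by blast
    qed
    then show ?thesis unfolding cycs_def image_Un using assms by (simp add: card_Un_disjoint)
  qed
  ultimately show ?thesis by (simp add: defect_def)
qed

lemma defect_singleton: "p a = a \<Longrightarrow> defect {a} p = 0"
proof -
  assume "p a = a"
  moreover have "{(i, j). i \<in> {a} \<and> j \<in> {a} \<and> i < j \<and> p j < p i} = {}" by auto
  then have "invs {a} p = 0" unfolding invs_def by (metis card.empty)
  ultimately show ?thesis by (simp add: defect_def disp_def cycs_def)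
qed

lemma defect_empty [simp]: "defect {} p = 0"
  by (simp add: defect_def disp_def invs_def cycs_def)

text \<open>Reflecting the permutation matrix in the diagonal keeps displacements and orbits, and
  turns inversions into inversions with positions and values interchanged.\<close>

lemma defect_inv:
  assumes "finite S" "p permutes S"
  shows "defect S (inv p) = defect S p"
proof -
  have bij: "bij p" using assms permutes_bij by blast
  have pinv: "p (inv p x) = x" "inv p (p x) = x" for x using permutes_inverses[OF assms(2)] by auto
  have m: "p x \<in> S \<longleftrightarrow> x \<in> S" "inv p x \<in> S \<longleftrightarrow> x \<in> S" for x
    using permutes_in_image[OF assms(2)] permutes_in_image[OF permutes_inv[OF assms(2)]] by auto
  have "disp S (inv p) = disp S p"
    unfolding disp_def
    by (rule sum.reindex_bij_witness[of _ p "inv p"]) (auto simp: pinv m)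
  moreover have "invs S (inv p) = invs S p"
    unfolding invs_def
    by (rule bij_betw_same_card[of "\<lambda>(i, j). (inv p j, inv p i)"],
        rule bij_betw_byWitness[where f' = "\<lambda>(i, j). (p j, p i)"]) (auto simp: pinv m)
  moreover have "orbit (inv p) x = orbit p x" for x
  proof -
    have "permutation p" unfolding permutation_permutes using assms by auto
    then show ?thesis by (rule orbit_inv_eq)
  qed
  ultimately show ?thesis by (simp add: defect_def cycs_def)
qed

subsection \<open>The Diaconis-Graham inequality\<close>

lemma permutes_comp_transpose:
  "p permutes S \<Longrightarrow> i \<in> S \<Longrightarrow> j \<in> S \<Longrightarrow> p \<circ> transpose i j permutes S"
  by (simp add: permutes_compose permutes_swap_id)

lemma comp_transpose_apply [simp]:
  "(p \<circ> transpose i j) i = p j" "(p \<circ> transpose i j) j = p i"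
  "k \<noteq> i \<Longrightarrow> k \<noteq> j \<Longrightarrow> (p \<circ> transpose i j) k = p k"
  by (auto simp: transpose_def)

lemma comp_transpose_twice: "p \<circ> transpose i j \<circ> transpose i j = p"
  by (simp add: comp_assoc)

section \<open>Removing an inversion\<close>

definition inversion_box :: "nat set \<Rightarrow> (nat \<Rightarrow> nat) \<Rightarrow> nat \<Rightarrow> nat \<Rightarrow> nat set" where
  "inversion_box S p i j = {k \<in> S. i < k \<and> k < j \<and> p j < p k \<and> p k < p i}"

lemma inversion_box_swap: "i < j \<Longrightarrow> inversion_box S p i j = ascent_box S (p \<circ> transpose i j) i j"
  unfolding inversion_box_def ascent_box_def by (auto simp: transpose_def)

text \<open>The difference of \<open>min j (p i)\<close> and \<open>max i (p j)\<close> is the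
  overlap L. The bound is written additively to avoid truncated subtraction; \<open>g\<close> is a
  guaranteed surplus of L over R + 1, and each unit of it costs two units of defect.\<close>

lemma defect_inversion_ge:
  assumes "finite S" "p permutes S" "i \<in> S" "j \<in> S" "i < j" "p j < p i"
    and "max i (p j) + Suc (card (inversion_box S p i j)) + g \<le> min j (p i)"
  shows "defect S (p \<circ> transpose i j) + 2 * int g \<le> defect S p"
proof -
  let ?q = "p \<circ> transpose i j"
  have q: "?q permutes S" using permutes_comp_transpose[OF assms(2-4)] .
  have lt: "?q i < ?q j" using assms(6) by simp
  have "int g \<le> overlap ?q i j - int (card (ascent_box S ?q i j)) - 1"
    using assms(7) unfolding inversion_box_swap[OF assms(5)] overlap_def comp_transpose_apply by auto
  then have "2 * int g \<le> 2 * (overlap ?q i j - int (card (ascent_box S ?q i j)) - 1)"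
    by (rule mult_left_mono) simp
  moreover have "x \<le> y \<Longrightarrow> z + y \<le> w \<Longrightarrow> z + x \<le> w" for x y z w :: int by linarith
  ultimately show ?thesis
    using defect_comp_transpose(1)[OF assms(1) q assms(3-5) lt] unfolding comp_transpose_twice by blast
qed

text \<open>After the exchange \<open>i\<close> or \<open>j\<close> is a fixed point, so a cycle has
  been split off, and L = R + 1 leaves nothing to lose.\<close>

lemma defect_inversion_eq:
  assumes "finite S" "p permutes S" "i \<in> S" "j \<in> S" "i < j" "p j < p i" "p j = i \<or> p i = j"
    and "max i (p j) + Suc (card (inversion_box S p i j)) = min j (p i)"
  shows "defect S p = defect S (p \<circ> transpose i j)"
proof -
  let ?q = "p \<circ> transpose i j"
  have q: "?q permutes S" using permutes_comp_transpose[OF assms(2-4)] .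
  have lt: "?q i < ?q j" using assms(6) by simp
  have "?q i = i \<or> ?q j = j" using assms(7) by simp
  note f = defect_comp_transpose_fixed[OF assms(1) q assms(3-5) lt this]
  have "overlap ?q i j - int (card (ascent_box S ?q i j)) - 1 = 0"
    using assms(8) unfolding inversion_box_swap[OF assms(5)] overlap_def comp_transpose_apply by auto
  then show ?thesis using f unfolding comp_transpose_twice by (simp only: mult_zero_right add_0_right)
qed

lemma card_inversion_box_positions: "i < j \<Longrightarrow> i + Suc (card (inversion_box S p i j)) \<le> j"
proof -
  assume "i < j"
  have "card (inversion_box S p i j) \<le> card {i<..<j}" unfolding inversion_box_def by (rule card_mono) auto
  then show ?thesis using \<open>i < j\<close> by simp
qed

lemma card_inversion_box_values:
  assumes "p permutes S" "p j < p i"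
  shows "p j + Suc (card (inversion_box S p i j)) \<le> p i"
proof -
  have "card (inversion_box S p i j) \<le> card {p j<..<p i}" unfolding inversion_box_def
    by (rule card_inj_on_le[of p]) (use permutes_inj_on[OF assms(1)] in auto)
  then show ?thesis using assms(2) by simp
qed

lemma permutes_drop_top:
  assumes "p permutes {a..Suc n}" "p (Suc n) = Suc n"
  shows "p permutes {a..n}"
proof (rule permutes_superset[OF assms(1)])
  fix x assume "x \<in> {a..Suc n} - {a..n}"
  then have "x = Suc n" by auto
  then show "p x = x" using assms(2) by simp
qed

lemma permutes_drop_bot:
  assumes "p permutes {a..n}" "p a = a"
  shows "p permutes {Suc a..n}"
proof (rule permutes_superset[OF assms(1)])
  fix x assume "x \<in> {a..n} - {Suc a..n}"
  then have "x = a" by auto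
  then show "p x = x" using assms(2) by simp
qed

lemma defect_drop_top:
  assumes "p permutes {a..Suc n}" "p (Suc n) = Suc n"
  shows "defect {a..Suc n} p = defect {a..n} p"
proof (cases "a \<le> Suc n")
  case True
  have p: "p permutes {a..n}" using permutes_drop_top[OF assms] .
  have "{a..Suc n} = {a..n} \<union> {Suc n}" using True by auto
  then show ?thesis
    using defect_Un[of "{a..n}" "{Suc n}" p] permutes_image[OF p] assms(2) defect_singleton[of p "Suc n"] by auto
qed auto

lemma defect_drop_bot:
  assumes "p permutes {a..n}" "p a = a"
  shows "defect {a..n} p = defect {Suc a..n} p"
proof (cases "a \<le> n")
  case True
  have p: "p permutes {Suc a..n}" using permutes_drop_bot[OF assms] .
  have "{a..n} = {a} \<union> {Suc a..n}" using True by auto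
  then show ?thesis
    using defect_Un[of "{a}" "{Suc a..n}" p] permutes_image[OF p] assms(2) defect_singleton[of p a] by auto
qed auto

theorem Diaconis_Graham: "p permutes {1..n} \<Longrightarrow> 0 \<le> defect {1..n} p"
proof (induction n arbitrary: p)
  case (Suc n)
  show ?case
  proof (cases "p (Suc n) = Suc n")
    case True
    then show ?thesis using Suc defect_drop_top[of p 1 n] permutes_drop_top[of p 1 n] by simp
  next
    case False
    obtain i where i: "p i = Suc n" using Suc.prems by (metis permutes_surj surjD)
    then have iS: "i \<in> {1..Suc n}" using permutes_in_image[OF Suc.prems, of i] by simp
    then have lt: "i < Suc n" using False i by (metis atLeastAtMost_iff le_neq_implies_less)
    let ?q = "p \<circ> transpose i (Suc n)"
    have q: "?q permutes {1..Suc n}" using permutes_comp_transpose[OF Suc.prems iS] by simp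
    have lt2: "p (Suc n) < p i" using False i permutes_in_image[OF Suc.prems, of "Suc n"] by simp
    have "0 \<le> defect {1..Suc n} ?q"
      using Suc.IH defect_drop_top[OF q] permutes_drop_top[OF q] i by simp
    \<comment> \<open>As \<open>p i\<close> and the right position are both \<open>Suc n\<close>,
      the overlap is the smaller of the width and the height of the rectangle. Each of them bounds R
      + 1.\<close>
    moreover have "max i (p (Suc n)) + Suc (card (inversion_box {1..Suc n} p i (Suc n))) + 0 \<le> min (Suc n) (p i)"
      using card_inversion_box_positions[OF lt, of "{1..Suc n}" p] card_inversion_box_values[OF Suc.prems lt2] i by simp
    from defect_inversion_ge[OF finite_atLeastAtMost Suc.prems iS _ lt lt2 this]
    have "defect {1..Suc n} ?q \<le> defect {1..Suc n} p" by simp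
    ultimately show ?thesis by simp
  qed
qed simp

text \<open>Otherwise removing the inversion would take the defect from 0 to at most -2, against
  \<open>Diaconis_Graham\<close>.\<close>

lemma shallow_inversion:
  assumes "p permutes {1..n}" "shallow n p" "i \<in> {1..n}" "j \<in> {1..n}" "i < j" "p j < p i"
  shows "min j (p i) \<le> max i (p j) + Suc (card (inversion_box {1..n} p i j))"
proof (rule ccontr)
  assume "\<not> ?thesis"
  then have "max i (p j) + Suc (card (inversion_box {1..n} p i j)) + 1 \<le> min j (p i)" by linarith
  from defect_inversion_ge[OF finite_atLeastAtMost assms(1,3-6) this]
  have "0 < defect {1..n} p"
    using Diaconis_Graham[OF permutes_comp_transpose[OF assms(1,3,4)]] by simp
  then show False using assms(1,2) shallow_iff_defect by simp
qed

text \<open>Two transpositions, exchanging \<open>n\<close> with \<open>2\<close> and then \<open>n - 1\<close> with \<open>1\<close>, lower \<open>D - I\<close> by four.\<close>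

lemma defect_pos_of_outer_4321:
  assumes p: "p permutes {1..n}" and ord: "k1 < k2" "k2 < k3" "k3 < k4"
    and vals: "p k1 = n" "p k2 = n - 1" "p k3 = 2" "p k4 = 1" and ends: "p 1 \<noteq> n" "p n \<noteq> 1"
    and n: "4 \<le> n"
  shows "0 < defect {1..n} p"
proof -
  have S: "k1 \<in> {1..n}" "k2 \<in> {1..n}" "k3 \<in> {1..n}" "k4 \<in> {1..n}"
    using vals n permutes_in_image[OF p, of k1] permutes_in_image[OF p, of k2]
      permutes_in_image[OF p, of k3] permutes_in_image[OF p, of k4] by auto
  have k1: "2 \<le> k1" using S(1) vals(1) ends(1) by (cases "k1 = 1") auto
  have k4: "k4 \<le> n - 1" using S(4) vals(4) ends(2) by (cases "k4 = n") auto
  let ?q = "p \<circ> transpose k1 k3"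
  have q: "?q permutes {1..n}" using permutes_comp_transpose[OF p S(1,3)] .
  have ord': "k1 < k3" "k2 < k4" using ord by auto
  have "p k3 < p k1" using vals n by simp
  have "max k1 (p k3) + Suc (card (inversion_box {1..n} p k1 k3)) + 0 \<le> min k3 (p k1)"
    using card_inversion_box_positions[OF ord'(1), of "{1..n}" p] vals k1 S by simp
  from defect_inversion_ge[OF finite_atLeastAtMost p S(1,3) ord'(1) \<open>p k3 < p k1\<close> this]
  have 1: "defect {1..n} ?q \<le> defect {1..n} p" by simp
  have qv: "?q k2 = n - 1" "?q k4 = 1" "?q k3 = n" using ord vals by (auto simp: transpose_def)
  have lt: "?q k4 < ?q k2" using qv n by simp
  \<comment> \<open>Position \<open>k3\<close> lies between \<open>k2\<close> and \<open>k4\<close>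
    but now carries \<open>n\<close>, so it is missing from the rectangle. Since
    \<open>k4 \<le> n - 1\<close>, the overlap is governed by positions, and the missing point is
    the surplus 1.\<close>
  have "inversion_box {1..n} ?q k2 k4 \<subseteq> {k2<..<k4} - {k3}" unfolding inversion_box_def using qv by auto
  then have "card (inversion_box {1..n} ?q k2 k4) \<le> card ({k2<..<k4} - {k3})" by (intro card_mono) auto
  then have "max k2 (?q k4) + Suc (card (inversion_box {1..n} ?q k2 k4)) + 1 \<le> min k4 (?q k2)"
    unfolding qv using ord k4 S by simp
  from defect_inversion_ge[OF finite_atLeastAtMost q S(2,4) ord'(2) lt this]
  have "0 < defect {1..n} ?q"
    using Diaconis_Graham[OF permutes_comp_transpose[OF q S(2,4)]] unfolding of_nat_1 by linarith
  then show ?thesis using 1 by simp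
qed

subsection \<open>Shallow permutations from direct sums\<close>

lemma card_values:
  fixes p :: "nat \<Rightarrow> nat"
  assumes "inj_on p S" "V \<subseteq> p ` S"
  shows "card {k \<in> S. p k \<in> V} = card V"
proof -
  have "p ` {k \<in> S. p k \<in> V} = V" using assms(2) by auto
  then show ?thesis using assms(1) by (metis (no_types, lifting) card_image inj_on_subset mem_Collect_eq subsetI)
qed

text \<open>The points to the upper right of a border point: from the left border all larger values,
  from the bottom border all later positions, from the right or top border none.\<close>

lemma card_above_border:
  assumes inj: "inj_on p {a..N}" and im: "p ` {a..N} = {a..N}" and i: "i \<in> {a..N}"
    and border: "i = a \<or> i = N \<or> p i = a \<or> p i = N"
  shows "card {k \<in> {a..N}. i < k \<and> p i < p k} = N - max i (p i)"
proof -
  let ?A = "{k \<in> {a..N}. i < k \<and> p i < p k}"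
  have pi: "p i \<in> {a..N}" using i im by blast
  have pk: "p k \<in> {a..N}" if "k \<in> {a..N}" for k using that im by blast
  consider "i = a" | "i = N" | "p i = a" | "p i = N" using border by blast
  then show ?thesis
  proof cases
    case 1
    have "i < k" if "k \<in> {a..N}" "p i < p k" for k using that 1 by (cases "k = a") auto
    then have "?A = {k \<in> {a..N}. p k \<in> {p i<..N}}" using pk by auto
    moreover have "{p i<..N} \<subseteq> p ` {a..N}" using im pi by auto
    ultimately have "card ?A = N - p i" using card_values[OF inj, of "{p i<..N}"] by (metis card_greaterThanAtMost)
    moreover have "max i (p i) = p i" using 1 pi by simp
    ultimately show ?thesis by (simp only:)
  next
    case 2
    have "?A = {}" using 2 by auto
    then have "card ?A = 0" by (simp only: card.empty)
    moreover have "max i (p i) = N" using 2 pi by simp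
    ultimately show ?thesis by (simp only: diff_self_eq_0)
  next
    case 3
    have ne: "p k \<noteq> a" if "k \<in> {a..N}" "i < k" for k
      using that 3 i inj_onD[OF inj, of k i] by auto
    have "a < p k" if "k \<in> {a..N}" "i < k" for k
      using pk[OF that(1)] ne[OF that] by simp
    then have "?A = {i<..N}" using 3 i by auto
    then have "card ?A = N - i" by (simp only: card_greaterThanAtMost)
    moreover have "max i (p i) = i" using 3 i by simp
    ultimately show ?thesis by (simp only:)
  next
    case 4
    have "\<not> p i < p k" if "k \<in> {a..N}" for k using 4 pk[OF that] by simp
    then have "?A = {}" by blast
    then have "card ?A = 0" by (simp only: card.empty)
    moreover have "max i (p i) = N" using 4 i by simp
    ultimately show ?thesis by (simp only: diff_self_eq_0)
  qed
qed

lemma card_below_border: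
  assumes inj: "inj_on p {a..N}" and im: "p ` {a..N} = {a..N}" and j: "j \<in> {a..N}"
    and border: "j = a \<or> j = N \<or> p j = a \<or> p j = N"
  shows "card {k \<in> {a..N}. k < j \<and> p k < p j} = min j (p j) - a"
proof -
  let ?A = "{k \<in> {a..N}. k < j \<and> p k < p j}"
  have pj: "p j \<in> {a..N}" using j im by blast
  have pk: "p k \<in> {a..N}" if "k \<in> {a..N}" for k using that im by blast
  consider "j = N" | "j = a" | "p j = N" | "p j = a" using border by blast
  then show ?thesis
  proof cases
    case 1
    have "k < j" if "k \<in> {a..N}" "p k < p j" for k using that 1 by (cases "k = N") auto
    then have "?A = {k \<in> {a..N}. p k \<in> {a..<p j}}" using pk by auto
    moreover have "{a..<p j} \<subseteq> p ` {a..N}" using im pj by auto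
    ultimately have "card ?A = p j - a" using card_values[OF inj, of "{a..<p j}"] by (metis card_atLeastLessThan)
    moreover have "min j (p j) = p j" using 1 pj by simp
    ultimately show ?thesis by (simp only:)
  next
    case 2
    have "?A = {}" using 2 by auto
    then have "card ?A = 0" by (simp only: card.empty)
    moreover have "min j (p j) = a" using 2 pj by simp
    ultimately show ?thesis by (simp only: diff_self_eq_0)
  next
    case 3
    have ne: "p k \<noteq> N" if "k \<in> {a..N}" "k < j" for k
      using that 3 j inj_onD[OF inj, of k j] by auto
    have "p k < N" if "k \<in> {a..N}" "k < j" for k
      using pk[OF that(1)] ne[OF that] by simp
    then have "?A = {a..<j}" using 3 j by auto
    then have "card ?A = j - a" by (simp only: card_atLeastLessThan)
    moreover have "min j (p j) = j" using 3 j by simp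
    ultimately show ?thesis by (simp only:)
  next
    case 4
    have "\<not> p k < p j" if "k \<in> {a..N}" for k using 4 pk[OF that] by simp
    then have "?A = {}" by blast
    then have "card ?A = 0" by (simp only: card.empty)
    moreover have "min j (p j) = a" using 4 j by simp
    ultimately show ?thesis by (simp only: diff_self_eq_0)
  qed
qed

text \<open>Of the lower block the rectangle contains what lies to the upper right of
  \<open>i\<close>, of the upper block what lies to the lower left of \<open>j\<close>. For border
  entries these counts add up to exactly L - 1, and the exchange merges cycles of different blocks,
  so the defect remains 0.\<close>

lemma defect_join:
  assumes p: "p permutes {a..b}" and N: "a \<le> N" "N < b" and im: "p ` {a..N} \<subseteq> {a..N}"
    and d: "defect {a..N} p = 0" "defect {Suc N..b} p = 0"
    and i: "i \<in> {a..N}" "i = a \<or> i = N \<or> p i = a \<or> p i = N"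
    and j: "j \<in> {Suc N..b}" "j = Suc N \<or> j = b \<or> p j = Suc N \<or> p j = b"
  shows "defect {a..b} (p \<circ> transpose i j) = 0"
proof -
  have inj: "inj_on p X" for X using permutes_inj_on[OF p] .
  have im1: "p ` {a..N} = {a..N}" by (rule endo_inj_surj) (use im inj in auto)
  have un: "{a..b} = {a..N} \<union> {Suc N..b}" using N by auto
  have im2: "p ` {Suc N..b} = {Suc N..b}"
  proof -
    have "p ` {a..b} = {a..b}" using permutes_image[OF p] .
    moreover have "{Suc N..b} = {a..b} - {a..N}" using N by auto
    ultimately show ?thesis using im1 by (simp add: image_set_diff permutes_inj[OF p])
  qed
  have 0: "defect {a..b} p = 0"
    unfolding un using defect_Un[of "{a..N}" "{Suc N..b}" p] im1 im2 d by auto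
  have pi: "p i \<in> {a..N}" and pj: "p j \<in> {Suc N..b}" using i j im1 im2 by blast+
  have ij: "i < j" "p i < p j" using i j pi pj by auto
  have orb: "orbit p i \<noteq> orbit p j"
  proof -
    have "orbit p i \<subseteq> {a..N}" "orbit p j \<subseteq> {Suc N..b}"
      by (rule orbit_subset_block[OF im i(1)], rule orbit_subset_block[OF equalityD1[OF im2] j(1)])
    moreover have "p i \<in> orbit p i" by (rule orbit.base)
    moreover have "p i \<notin> {Suc N..b}" using pi by auto
    ultimately show ?thesis by blast
  qed
  have "ascent_box {a..b} p i j = {k \<in> {a..N}. i < k \<and> p i < p k} \<union> {k \<in> {Suc N..b}. k < j \<and> p k < p j}" (is "_ = ?A \<union> ?B")
  proof -
    have bl1: "p k \<in> {a..N}" if "k \<in> {a..N}" for k using that im1 by blast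
    have bl2: "p k \<in> {Suc N..b}" if "k \<in> {Suc N..b}" for k using that im2 by blast
    have "k \<in> ascent_box {a..b} p i j \<longleftrightarrow> k \<in> ?A \<union> ?B" for k
    proof (cases "k \<in> {a..N}")
      case True
      then have "p k < p j" "k < j" "k \<in> {a..b}" "k \<notin> {Suc N..b}" using bl1[OF True] j(1) pj N by auto
      then show ?thesis using True unfolding ascent_box_def by blast
    next
      case F: False
      show ?thesis
      proof (cases "k \<in> {Suc N..b}")
        case True
        then have "p i < p k" "i < k" "k \<in> {a..b}" using bl2[OF True] i(1) pi N by auto
        then show ?thesis using True F unfolding ascent_box_def by blast
      next
        case False
        then have "k \<notin> {a..b}" using F N by auto
        then show ?thesis using False F unfolding ascent_box_def by blast
      qed
    qed
    then show ?thesis by blast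
  qed
  moreover have "card (?A \<union> ?B) = card ?A + card ?B" by (rule card_Un_disjoint) auto
  ultimately have "card (ascent_box {a..b} p i j) = (N - max i (p i)) + (min j (p j) - Suc N)"
    using card_above_border[OF inj im1 i] card_below_border[OF inj im2 j] by simp
  moreover have "overlap p i j = int (min j (p j)) - int (max i (p i))"
    unfolding overlap_def using i j pi pj by auto
  moreover have "max i (p i) \<le> N" "Suc N \<le> min j (p j)" using i j pi pj by auto
  ultimately have "overlap p i j = int (min j (p j)) - int (max i (p i))"
      "card (ascent_box {a..b} p i j) + Suc (max i (p i)) = min j (p j)" by linarith+
  then have "overlap p i j - int (card (ascent_box {a..b} p i j)) - 1 = 0" by linarith
  then show ?thesis
    using defect_comp_transpose(2)[OF _ p _ _ ij orb] i j N 0 by auto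
qed

text \<open>Every value strictly between \<open>p b\<close> and \<open>p a\<close> stands at an
  inner position, so the rectangle holds all of them, and the exchange creates a fixed point at an
  end.\<close>

lemma defect_swap_ends:
  assumes p: "p permutes {a..b}" and ab: "a < b" and "p a = b \<or> p b = a"
  shows "defect {a..b} p = defect {a..b} (p \<circ> transpose a b)"
proof (rule defect_inversion_eq[OF finite_atLeastAtMost p])
  have m: "p a \<in> {a..b}" "p b \<in> {a..b}" using permutes_in_image[OF p] ab by auto
  have ne: "p a \<noteq> p b" using permutes_inj[OF p] ab by (metis inj_eq less_irrefl)
  show lt: "p b < p a" using assms(3) m ne by auto
  have inj: "inj_on p {a..b}" using permutes_inj_on[OF p] .
  have sub: "{p b<..<p a} \<subseteq> p ` {a..b}" unfolding permutes_image[OF p] using m by auto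
  have "inversion_box {a..b} p a b = {k \<in> {a..b}. p k \<in> {p b<..<p a}}"
  proof -
    have "a < k \<and> k < b" if "k \<in> {a..b}" "p b < p k" "p k < p a" for k
      using that by (metis atLeastAtMost_iff le_neq_implies_less less_irrefl)
    then show ?thesis unfolding inversion_box_def by auto
  qed
  then have "card (inversion_box {a..b} p a b) = p a - Suc (p b)"
    using card_values[OF inj sub] by simp
  then show "max a (p b) + Suc (card (inversion_box {a..b} p a b)) = min b (p a)"
    using assms(3) m lt by auto
qed (use assms in auto)

text \<open>The word decreases except for one misplaced entry at \<open>i\<close>; if
  \<open>i\<close> lies outside the interval it simply decreases. A defect-preserving exchange makes
  an end of the interval a fixed point, and after stripping it the word is of the same kind,
  possibly with another exceptional position.\<close>

lemma defect_almost_decreasing: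
  "p permutes {a..b} \<Longrightarrow> (\<And>x y. a \<le> x \<Longrightarrow> x < y \<Longrightarrow> y \<le> b \<Longrightarrow> x \<noteq> i \<Longrightarrow> y \<noteq> i \<Longrightarrow> p y < p x)
    \<Longrightarrow> defect {a..b} p = 0"
proof (induction "Suc b - a" arbitrary: a b p i rule: less_induct)
  case less
  note p = less.prems(1) and dec = less.prems(2)
  have inj: "p x = p y \<longleftrightarrow> x = y" for x y using permutes_inj[OF p] by (simp add: inj_eq)
  have m: "p x \<in> {a..b} \<longleftrightarrow> x \<in> {a..b}" for x using permutes_in_image[OF p] .
  have top: "defect {a..b} q = 0" if q: "q permutes {a..b}" "q b = b" "a \<le> b"
      and qd: "\<And>x y. a \<le> x \<Longrightarrow> x < y \<Longrightarrow> y < b \<Longrightarrow> x \<noteq> i' \<Longrightarrow> y \<noteq> i' \<Longrightarrow> q y < q x" for q i'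
  proof (cases b)
    case 0
    then show ?thesis using q defect_singleton[of q 0] by simp
  next
    case (Suc b')
    have "defect {a..b'} q = 0"
      by (rule less.hyps[of b' a q i']) (use Suc q qd permutes_drop_top[of q a b'] in auto)
    then show ?thesis using defect_drop_top[of q a b'] q Suc by simp
  qed
  have bot: "defect {a..b} q = 0" if q: "q permutes {a..b}" "q a = a" "a \<le> b"
      and qd: "\<And>x y. a < x \<Longrightarrow> x < y \<Longrightarrow> y \<le> b \<Longrightarrow> x \<noteq> i' \<Longrightarrow> y \<noteq> i' \<Longrightarrow> q y < q x" for q i'
  proof -
    have "defect {Suc a..b} q = 0"
      by (rule less.hyps[of b "Suc a" q i']) (use q qd permutes_drop_bot[of q a b] in auto)
    then show ?thesis using defect_drop_bot[of q a b] q by simp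
  qed
  consider "b < a" | "a \<le> b" "p a = a" | "a \<le> b" "p b = b" | "a < b" "p a \<noteq> a" "p b \<noteq> b"
    by (metis linorder_cases order.order_iff_strict m atLeastAtMost_iff order_antisym)
  then show ?case
  proof cases
    case 1
    then show ?thesis by simp
  next
    case 2
    show ?thesis by (rule bot[OF p 2(2,1), of i]) (use dec in auto)
  next
    case 3
    show ?thesis by (rule top[OF p 3(2,1), of i]) (use dec in auto)
  next
    case 4
    obtain ka where ka: "p ka = a" using permutes_surj[OF p] by (metis surjD)
    obtain kb where kb: "p kb = b" using permutes_surj[OF p] by (metis surjD)
    have ka': "a < ka" "ka \<le> b" and kb': "a \<le> kb" "kb < b"
      using m[of ka] m[of kb] ka kb 4 by (auto simp: order.order_iff_strict)
    \<comment> \<open>Without the exceptional entry the word decreases, so its smallest value can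
      only be last and its largest only first.\<close>
    have low: "ka = i \<or> ka = b" if "b \<noteq> i"
      using dec[of ka b] that ka ka' m[of b] 4 by fastforce
    have high: "kb = i \<or> kb = a" if "a \<noteq> i"
      using dec[of a kb] that kb kb' m[of a] 4 by fastforce
    let ?q = "p \<circ> transpose a b"
    have q: "?q permutes {a..b}" by (rule permutes_comp_transpose[OF p]) (use 4 in auto)
    have sw: "defect {a..b} p = defect {a..b} ?q" if "p a = b \<or> p b = a"
      by (rule defect_swap_ends[OF p 4(1) that])
    consider (pb) "p b = a" "i = a" | (pa) "p a = b" "i = b" | (both) "p a = b" "p b = a"
      | (hi) "p i = b" "i < b" "p b = a" | (lo) "p i = a" "a < i" "p a = b"
    proof -
      have "(p b = a \<and> i = a) \<or> (p a = b \<and> i = b) \<or> (p a = b \<and> p b = a) \<or>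
          (p i = b \<and> i < b \<and> p b = a) \<or> (p i = a \<and> a < i \<and> p a = b)"
      proof (cases "i = a \<or> i = b")
        case True
        then show ?thesis using low high ka kb ka' kb' 4(1) by auto
      next
        case False
        then have "ka = i \<or> ka = b" "kb = i \<or> kb = a" using low high by auto
        then show ?thesis using ka kb ka' kb' 4(1) by auto
      qed
      then show thesis using that by blast
    qed
    then show ?thesis
    proof cases
      case pb
      \<comment> \<open>The exchange carries the exceptional entry from \<open>a\<close> to
        \<open>b\<close>, which becomes the new exceptional position; in case \<open>pa\<close> it
        moves the other way.\<close>
      have "defect {a..b} ?q = 0"
        by (rule bot[OF q, of b]) (use pb 4 dec in \<open>auto simp: transpose_def\<close>)
      then show ?thesis using sw pb by simp
    next
      case pa
      have "defect {a..b} ?q = 0"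
        by (rule top[OF q, of a]) (use pa 4 dec in \<open>auto simp: transpose_def\<close>)
      then show ?thesis using sw pa by simp
    next
      case both
      obtain b' where b': "b = Suc b'" using 4 by (cases b) auto
      have q': "?q permutes {Suc a..b}" by (rule permutes_drop_bot[OF q]) (use both in simp)
      then have q'': "?q permutes {Suc a..b'}" unfolding b'
        by (rule permutes_drop_top) (use both b' in simp)
      have "defect {Suc a..b'} ?q = 0"
        by (rule less.hyps[of b' "Suc a" ?q i]) (use b' 4 q'' dec in \<open>auto simp: transpose_def\<close>)
      then have "defect {Suc a..b} ?q = 0"
        using defect_drop_top[of ?q "Suc a" b'] q' both b' by simp
      then have "defect {a..b} ?q = 0" using defect_drop_bot[OF q] both by simp
      then show ?thesis using sw both by simp
    next
      case hi
      have ia: "a \<le> i" using m[of i] hi 4 by simp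
      let ?r = "p \<circ> transpose i b"
      have r: "?r permutes {a..b}" by (rule permutes_comp_transpose[OF p]) (use 4 ia hi in auto)
      have "inversion_box {a..b} p i b = {i<..<b}"
      proof -
        have "a < p k \<and> p k < b" if "i < k" "k < b" for k
          using that m[of k] inj[of k i] inj[of k b] hi ia by (auto simp: order.order_iff_strict)
        then show ?thesis unfolding inversion_box_def using hi ia by auto
      qed
      then have "max i (p b) + Suc (card (inversion_box {a..b} p i b)) = min b (p i)" using hi ia by simp
      then have "defect {a..b} p = defect {a..b} ?r"
        by (intro defect_inversion_eq[OF finite_atLeastAtMost p]) (use hi ia 4 in auto)
      moreover have "defect {a..b} ?r = 0"
        by (rule top[OF r, of i]) (use hi 4 dec in \<open>auto simp: transpose_def\<close>)
      ultimately show ?thesis by simp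
    next
      case lo
      have ib: "i \<le> b" using m[of i] lo 4 by simp
      let ?r = "p \<circ> transpose a i"
      have r: "?r permutes {a..b}" by (rule permutes_comp_transpose[OF p]) (use 4 ib lo in auto)
      have "inversion_box {a..b} p a i = {a<..<i}"
      proof -
        have "a < p k \<and> p k < b" if "a < k" "k < i" for k
          using that m[of k] inj[of k i] inj[of k a] lo ib by (auto simp: order.order_iff_strict)
        then show ?thesis unfolding inversion_box_def using lo ib by auto
      qed
      then have "max a (p i) + Suc (card (inversion_box {a..b} p a i)) = min i (p a)" using lo ib by simp
      then have "defect {a..b} p = defect {a..b} ?r"
        by (intro defect_inversion_eq[OF finite_atLeastAtMost p]) (use lo ib 4 in auto)
      moreover have "defect {a..b} ?r = 0"
        by (rule bot[OF r, of i]) (use lo 4 dec in \<open>auto simp: transpose_def\<close>)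
      ultimately show ?thesis by simp
    qed
  qed
qed

lemma defect_almost_decreasing_block:
  assumes "p ` {a..b} \<subseteq> {a..b}" "inj_on p {a..b}"
    and "\<And>x y. a \<le> x \<Longrightarrow> x < y \<Longrightarrow> y \<le> b \<Longrightarrow> x \<noteq> i \<Longrightarrow> y \<noteq> i \<Longrightarrow> p y < p x"
  shows "defect {a..b} p = 0"
proof -
  let ?q = "\<lambda>x. if x \<in> {a..b} then p x else x"
  have "bij_betw ?q {a..b} {a..b}"
    unfolding bij_betw_def using assms(1,2) endo_inj_surj[of "{a..b}" p]
    by (auto simp: inj_on_def image_def)
  then have "?q permutes {a..b}" by (rule bij_imp_permutes) auto
  from defect_almost_decreasing[OF this, of i] assms(3) have "defect {a..b} ?q = 0" by simp
  then show ?thesis using defect_cong[of "{a..b}" p ?q] assms(1) by simp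
qed

subsection \<open>Shifting\<close>

text \<open>For \<open>p\<close> with \<open>p 0 = 0\<close> this is the direct sum of a one-point
  permutation and \<open>p\<close>; the first equation keeps 0 outside the ground set.\<close>

fun up :: "(nat \<Rightarrow> nat) \<Rightarrow> nat \<Rightarrow> nat" where
  "up p 0 = 0"
| "up p (Suc i) = Suc (p i)"

lemma permutes_up_iff: "up p permutes Suc ` S \<longleftrightarrow> p permutes S"
proof
  assume u: "up p permutes Suc ` S"
  show "p permutes S"
    unfolding permutes_def
  proof (intro conjI allI impI)
    fix x assume "x \<notin> S"
    then have "up p (Suc x) = Suc x" using permutes_not_in[OF u, of "Suc x"] by auto
    then show "p x = x" by simp
  next
    fix y
    obtain x where x: "up p x = Suc y" using permutes_surj[OF u] by (metis surjD)
    then obtain z where z: "x = Suc z" by (cases x) auto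
    show "\<exists>!x. p x = y"
    proof
      show "p z = y" using x z by simp
      show "w = z" if "p w = y" for w
        using permutes_inj[OF u] x z that by (metis inj_eq nat.inject up.simps(2))
    qed
  qed
next
  assume p: "p permutes S"
  show "up p permutes Suc ` S"
    unfolding permutes_def
  proof (intro conjI allI impI)
    fix x assume x: "x \<notin> Suc ` S"
    show "up p x = x"
    proof (cases x)
      case (Suc y)
      then show ?thesis using x permutes_not_in[OF p, of y] by auto
    qed simp
  next
    fix y
    show "\<exists>!x. up p x = y"
    proof (cases y)
      case 0
      show ?thesis
      proof
        show "up p 0 = y" using 0 by simp
        show "x = 0" if "up p x = y" for x using that 0 by (cases x) auto
      qed
    next
      case (Suc z)
      obtain x where x: "p x = z" using permutes_surj[OF p] by (metis surjD)
      show ?thesis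
      proof
        show "up p (Suc x) = y" using x Suc by simp
        show "w = Suc x" if "up p w = y" for w
          using that Suc x permutes_inj[OF p] by (cases w) (auto simp: inj_eq)
      qed
    qed
  qed
qed

lemma orbit_up: "orbit (up p) (Suc x) = Suc ` orbit p x"
proof -
  have "(up p ^^ k) (Suc x) = Suc ((p ^^ k) x)" for k by (induction k) auto
  then show ?thesis unfolding orbit_altdef by auto
qed

lemma defect_up: "defect (Suc ` S) (up p) = defect S p"
proof -
  have "disp (Suc ` S) (up p) = disp S p" unfolding disp_def by (simp add: sum.reindex)
  moreover have "invs (Suc ` S) (up p) = invs S p"
    unfolding invs_def
    by (rule bij_betw_same_card[of "map_prod (\<lambda>x. x - 1) (\<lambda>x. x - 1)"],
        rule bij_betw_byWitness[where f' = "map_prod Suc Suc"]) auto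
  moreover have "card (Suc ` S) = card S" by (simp add: card_image)
  moreover have "cycs (Suc ` S) (up p) = cycs S p"
  proof -
    have "orbit (up p) ` Suc ` S = (image Suc) ` (orbit p ` S)" by (auto simp: orbit_up image_image)
    moreover have "inj_on (image Suc) X" for X by (rule inj_onI) (simp add: inj_image_eq_iff)
    ultimately show ?thesis unfolding cycs_def by (simp add: card_image)
  qed
  ultimately show ?thesis by (simp add: defect_def)
qed

subsection \<open>Families of shallow permutations\<close>

lemma permutes_atLeastAtMostI:
  fixes f :: "nat \<Rightarrow> nat"
  assumes "\<And>x. 1 \<le> x \<Longrightarrow> x \<le> n \<Longrightarrow> 1 \<le> f x \<and> f x \<le> n"
    and "\<And>x y. 1 \<le> x \<Longrightarrow> x < y \<Longrightarrow> y \<le> n \<Longrightarrow> f x \<noteq> f y"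
    and "\<And>x. x < 1 \<or> n < x \<Longrightarrow> f x = x"
  shows "f permutes {1..n}"
proof (rule bij_imp_permutes)
  have inj: "inj_on f {1..n}"
    by (rule linorder_inj_onI) (use assms(2) in auto)
  moreover have "f ` {1..n} = {1..n}" by (rule endo_inj_surj) (use inj assms(1) in auto)
  ultimately show "bij_betw f {1..n} {1..n}" by (simp add: bij_betw_def)
  show "f x = x" if "x \<notin> {1..n}" for x using that assms(3)[of x] by auto
qed

lemma permutes_card_less:
  fixes p :: "nat \<Rightarrow> nat"
  assumes "p permutes {1..n}" "i \<in> {1..n}"
  shows "p i = Suc (card {j \<in> {1..n}. p j < p i})"
proof -
  have m: "p k \<in> {1..n} \<longleftrightarrow> k \<in> {1..n}" for k using permutes_in_image[OF assms(1)] .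
  have "{j \<in> {1..n}. p j < p i} = {j \<in> {1..n}. p j \<in> {1..<p i}}" using m by auto
  moreover have "{1..<p i} \<subseteq> p ` {1..n}" unfolding permutes_image[OF assms(1)] using m[of i] assms(2) by auto
  ultimately have "card {j \<in> {1..n}. p j < p i} = p i - 1"
    using card_values[OF permutes_inj_on[OF assms(1)], of "{1..<p i}" "{1..n}"] by simp
  then show ?thesis using m[of i] assms(2) by simp
qed

text \<open>A value is one more than the number of smaller entries, so the ascents determine the
  permutation. The classifications below therefore only compare entries and never compute
  them.\<close>

lemma permutes_eqI_order:
  fixes p q :: "nat \<Rightarrow> nat"
  assumes "p permutes {1..n}" "q permutes {1..n}"
    and ord: "\<And>i j. 1 \<le> i \<Longrightarrow> i < j \<Longrightarrow> j \<le> n \<Longrightarrow> p i < p j \<longleftrightarrow> q i < q j"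
  shows "p = q"
proof
  fix i
  show "p i = q i"
  proof (cases "i \<in> {1..n}")
    case True
    have "p j < p i \<longleftrightarrow> q j < q i" if j: "j \<in> {1..n}" for j
    proof (cases j i rule: linorder_cases)
      case less
      then show ?thesis using ord[of j i] j True by auto
    next
      case greater
      have "p i \<noteq> p j" "q i \<noteq> q j" using permutes_inj[OF assms(1)] permutes_inj[OF assms(2)] greater
        by (metis inj_eq less_irrefl)+
      then show ?thesis using ord[of i j] j True greater by auto
    qed auto
    then have "{j \<in> {1..n}. p j < p i} = {j \<in> {1..n}. q j < q i}" by auto
    then show ?thesis
      using permutes_card_less[OF assms(1) True] permutes_card_less[OF assms(2) True] by simp
  next
    case False
    then show ?thesis using assms permutes_not_in by metis
  qed
qed

lemma shallow_sumI:
  assumes p: "p permutes {1..n}" and N: "N \<le> n"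
    and im: "\<And>x. 1 \<le> x \<Longrightarrow> x \<le> N \<Longrightarrow> p x \<le> N"
    and d1: "\<And>x y. 1 \<le> x \<Longrightarrow> x < y \<Longrightarrow> y \<le> N \<Longrightarrow> x \<noteq> i \<Longrightarrow> y \<noteq> i \<Longrightarrow> p y < p x"
    and d2: "\<And>x y. N < x \<Longrightarrow> x < y \<Longrightarrow> y \<le> n \<Longrightarrow> x \<noteq> j \<Longrightarrow> y \<noteq> j \<Longrightarrow> p y < p x"
  shows "defect {1..N} p = 0" "defect {Suc N..n} p = 0" "shallow n p"
proof -
  have inj: "inj_on p X" for X using permutes_inj_on[OF p] .
  have m: "p k \<in> {1..n} \<longleftrightarrow> k \<in> {1..n}" for k using permutes_in_image[OF p] .
  have im1: "p ` {1..N} \<subseteq> {1..N}" using im m N by fastforce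
  then have im1': "p ` {1..N} = {1..N}" using endo_inj_surj inj by blast
  have "{Suc N..n} = {1..n} - {1..N}" using N by auto
  then have im2: "p ` {Suc N..n} = {Suc N..n}"
    using im1' permutes_image[OF p] by (simp add: image_set_diff permutes_inj[OF p])
  show 1: "defect {1..N} p = 0"
    by (rule defect_almost_decreasing_block[OF im1 inj, of i]) (use d1 in auto)
  show 2: "defect {Suc N..n} p = 0"
    by (rule defect_almost_decreasing_block[OF equalityD1[OF im2] inj, of j]) (use d2 in auto)
  have "{1..n} = {1..N} \<union> {Suc N..n}" using N by auto
  then have "defect {1..n} p = 0"
    using defect_Un[of "{1..N}" "{Suc N..n}" p] im1 im2 1 2 by auto
  then show "shallow n p" using shallow_iff_defect[OF p] by simp
qed

text \<open>Exchanging the entries at \<open>i\<close> and \<open>j\<close> back yields a direct sum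
  of two almost decreasing blocks. The conditions \<open>b\<close> ask for border entries in that
  sum, where \<open>i\<close> carries \<open>p j\<close> and \<open>j\<close> carries
  \<open>p i\<close>.\<close>

lemma shallow_joinI:
  assumes p: "p permutes {1..n}" and ij: "1 \<le> i" "i \<le> N" "N < j" "j \<le> n"
    and im: "\<And>x. 1 \<le> x \<Longrightarrow> x \<le> N \<Longrightarrow> x \<noteq> i \<Longrightarrow> p x \<le> N" "p j \<le> N"
    and d1: "\<And>x y. 1 \<le> x \<Longrightarrow> x < y \<Longrightarrow> y \<le> N \<Longrightarrow> x \<noteq> i \<Longrightarrow> y \<noteq> i \<Longrightarrow> p y < p x"
    and d2: "\<And>x y. N < x \<Longrightarrow> x < y \<Longrightarrow> y \<le> n \<Longrightarrow> x \<noteq> j \<Longrightarrow> y \<noteq> j \<Longrightarrow> p y < p x"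
    and b: "i = 1 \<or> i = N \<or> p j = 1 \<or> p j = N" "j = Suc N \<or> j = n \<or> p i = Suc N \<or> p i = n"
  shows "shallow n p"
proof -
  let ?q = "p \<circ> transpose i j"
  have q: "?q permutes {1..n}" by (rule permutes_comp_transpose[OF p]) (use ij in auto)
  have qx: "?q x = p x" if "x \<noteq> i" "x \<noteq> j" for x using that by simp
  have im': "?q x \<le> N" if "1 \<le> x" "x \<le> N" for x
    using im that ij qx[of x] by (cases "x = i") auto
  have d1': "?q y < ?q x" if "1 \<le> x" "x < y" "y \<le> N" "x \<noteq> i" "y \<noteq> i" for x y
    using d1[OF that] qx[of x] qx[of y] that ij by simp
  have d2': "?q y < ?q x" if "N < x" "x < y" "y \<le> n" "x \<noteq> j" "y \<noteq> j" for x y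
    using d2[OF that] qx[of x] qx[of y] that ij by simp
  have Nn: "N \<le> n" using ij by simp
  have sub: "?q ` {1..N} \<subseteq> {1..N}"
  proof
    fix y assume "y \<in> ?q ` {1..N}"
    then obtain x where x: "x \<in> {1..N}" "y = ?q x" by blast
    then have "?q x \<in> {1..n}" using permutes_in_image[OF q, of x] Nn by auto
    then show "y \<in> {1..N}" using x im'[of x] by auto
  qed
  have "defect {1..n} (?q \<circ> transpose i j) = 0"
  proof (rule defect_join[OF q _ _ sub])
    show "defect {1..N} ?q = 0" by (rule shallow_sumI(1)[OF q Nn im' d1' d2'])
    show "defect {Suc N..n} ?q = 0" by (rule shallow_sumI(2)[OF q Nn im' d1' d2'])
  qed (use ij b in auto)
  then show ?thesis using shallow_iff_defect[OF p] unfolding comp_transpose_twice by blast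
qed

text \<open>
  All families below are words of decreasing blocks, written left to right. With \<open>S < T\<close> meaning that
  all entries of \<open>S\<close> are below those of \<open>T\<close>:
  \<^item> \<open>dec_sum n r\<close>: two blocks \<open>S < T\<close>, where \<open>|S| = r\<close>;
  \<^item> \<open>dec_cross n P N Q\<close>: \<open>A n L H 1 C\<close> with \<open>L < A < C < H\<close>, \<open>n\<close> at position \<open>P\<close>, \<open>1\<close> at \<open>Q\<close>,
    and \<open>L\<close> ending at \<open>N\<close>;
  \<^item> \<open>slot_perm2 m e x k\<close>: \<open>G S H v C\<close> with \<open>S < v < G < C < H\<close>, \<open>G\<close> ending at \<open>e\<close>, \<open>S\<close> at \<open>x\<close>, and
    \<open>v\<close> at \<open>k\<close>;
  \<^item> \<open>slot_perm3 m r q k\<close>: \<open>S m S' H v C\<close> with \<open>S' < S < v < C < H\<close>, \<open>m\<close> at \<open>r\<close>, \<open>S'\<close> ending at \<open>q\<close>, and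
    \<open>v\<close> at \<open>k\<close>;
  \<^item> \<open>slot_perm1 m e k y\<close>: \<open>u G S v L C\<close> with \<open>S < v < G < C < u < L\<close>, \<open>G\<close> ending at \<open>e\<close>, \<open>v\<close> at \<open>k\<close>, and
    \<open>L\<close> ending at \<open>y\<close>.
  Outside \<open>{1..n}\<close> (resp. \<open>{1..m}\<close>) they are the identity. Except for \<open>dec_sum\<close>, they arise from a direct
  sum of two decreasing words with one misplaced border entry each by exchanging these two entries
  (\<open>slot_perm2\<close> only if \<open>G\<close> is nonempty; it is a direct sum otherwise).
\<close>

definition dec_sum :: "nat \<Rightarrow> nat \<Rightarrow> nat \<Rightarrow> nat" where
  "dec_sum n r i = (if i = 0 \<or> n < i then i else if i \<le> r then r + 1 - i else n + 1 + r - i)"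

definition dec_cross :: "nat \<Rightarrow> nat \<Rightarrow> nat \<Rightarrow> nat \<Rightarrow> nat \<Rightarrow> nat" where
  "dec_cross n P N Q i = (if i = 0 \<or> n < i then i else if i < P then N + 1 - i else if i = P then n
    else if i \<le> N then N + 2 - i else if i < Q then n + N - i else if i = Q then 1 else N + 1 + n - i)"

definition slot_perm2 :: "nat \<Rightarrow> nat \<Rightarrow> nat \<Rightarrow> nat \<Rightarrow> nat \<Rightarrow> nat" where
  "slot_perm2 m e x k i = (if i = 0 \<or> m < i then i else if i \<le> e then x + 2 - i else if i \<le> x then x + 1 - i
    else if i < k then m + 1 + x - i else if i = k then x - e + 1 else x + 2 + m - i)"

definition slot_perm3 :: "nat \<Rightarrow> nat \<Rightarrow> nat \<Rightarrow> nat \<Rightarrow> nat \<Rightarrow> nat" where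
  "slot_perm3 m r q k i = (if i = 0 \<or> m < i then i else if i < r then q - i else if i = r then m
    else if i \<le> q then q + 1 - i else if i < k then m + q - i else if i = k then q else q + 1 + m - i)"

definition slot_perm1 :: "nat \<Rightarrow> nat \<Rightarrow> nat \<Rightarrow> nat \<Rightarrow> nat \<Rightarrow> nat" where
  "slot_perm1 m e k y i = (if i = 0 \<or> m < i then i else if i = 1 then k + m - y else if i \<le> e then k + 1 - i
    else if i < k then k - i else if i = k then k - e else if i \<le> y then m + k + 1 - i else k + m - i)"

text \<open>The ascents of each family as an explicit relation, used both to recognise a member
  through \<open>permutes_eqI_order\<close> and to verify avoidance or the slot conditions.\<close>

lemma dec_sum_less_iff:
  assumes "1 \<le> r" "r < n" "1 \<le> i" "i < j" "j \<le> n"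
  shows "dec_sum n r i < dec_sum n r j \<longleftrightarrow> i \<le> r \<and> r < j"
  using assms by (auto simp: dec_sum_def)

lemma dec_cross_less_iff:
  assumes "2 \<le> P" "P \<le> N" "N < Q" "Q < n" "1 \<le> i" "i < j" "j \<le> n"
  shows "dec_cross n P N Q i < dec_cross n P N Q j \<longleftrightarrow> (i \<le> N \<and> N < j \<and> i \<noteq> P \<and> j \<noteq> Q) \<or> j = P \<or> i = Q"
  using assms by (auto simp: dec_cross_def)

lemma slot_perm2_less_iff:
  assumes "e < x" "x < k" "k \<le> m" "1 \<le> i" "i < j" "j \<le> m"
  shows "slot_perm2 m e x k i < slot_perm2 m e x k j \<longleftrightarrow> (i \<le> x \<and> x < j \<and> \<not> (i \<le> e \<and> j = k)) \<or> i = k"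
  using assms by (auto simp: slot_perm2_def)

lemma slot_perm3_less_iff:
  assumes "2 \<le> r" "r < q" "q < k" "k < m" "1 \<le> i" "i < j" "j \<le> m"
  shows "slot_perm3 m r q k i < slot_perm3 m r q k j \<longleftrightarrow> (i \<le> q \<and> q < j \<and> i \<noteq> r) \<or> j = r \<or> i = k"
  using assms by (auto simp: slot_perm3_def)

lemma slot_perm1_less_iff:
  assumes "1 \<le> e" "Suc e < k" "k < y" "y < m" "1 \<le> i" "i < j" "j \<le> m"
  shows "slot_perm1 m e k y i < slot_perm1 m e k y j \<longleftrightarrow>
    (if i = 1 then k < j \<and> j \<le> y else if i \<le> e then k < j else if i \<le> k then k \<le> j else False)"
  using assms by (auto simp: slot_perm1_def)

lemma permutes_dec_sum: "1 \<le> r \<Longrightarrow> r < n \<Longrightarrow> dec_sum n r permutes {1..n}"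
  by (rule permutes_atLeastAtMostI) (auto simp: dec_sum_def)

lemma permutes_dec_cross:
  assumes "2 \<le> P" "P \<le> N" "N < Q" "Q < n"
  shows "dec_cross n P N Q permutes {1..n}"
  by (rule permutes_atLeastAtMostI) (use assms in \<open>auto simp: dec_cross_def\<close>)

lemma permutes_slot_perm2:
  assumes "e < x" "x < k" "k \<le> m"
  shows "slot_perm2 m e x k permutes {1..m}"
  by (rule permutes_atLeastAtMostI) (use assms in \<open>auto simp: slot_perm2_def\<close>)

lemma permutes_slot_perm3:
  assumes "2 \<le> r" "r < q" "q < k" "k < m"
  shows "slot_perm3 m r q k permutes {1..m}"
  by (rule permutes_atLeastAtMostI) (use assms in \<open>auto simp: slot_perm3_def\<close>)

lemma permutes_slot_perm1:
  assumes "1 \<le> e" "Suc e < k" "k < y" "y < m"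
  shows "slot_perm1 m e k y permutes {1..m}"
  by (rule permutes_atLeastAtMostI) (use assms in \<open>auto simp: slot_perm1_def\<close>)

lemma shallow_dec_sum:
  assumes "1 \<le> r" "r < n" shows "shallow n (dec_sum n r)"
  by (rule shallow_sumI(3)[OF permutes_dec_sum[OF assms], of r 0 0]) (use assms in \<open>auto simp: dec_sum_def\<close>)

text \<open>The exchanged entries are \<open>n\<close> and \<open>1\<close>: in the direct sum, 1
  stands at \<open>P\<close> in the lower block and n at \<open>Q\<close> in the upper one, both on
  the border as extreme values.\<close>

lemma shallow_dec_cross:
  assumes "2 \<le> P" "P \<le> N" "N < Q" "Q < n"
  shows "shallow n (dec_cross n P N Q)"
  by (rule shallow_joinI[OF permutes_dec_cross[OF assms], of P N Q]) (use assms in \<open>auto simp: dec_cross_def\<close>)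

lemma shallow_slot_perm2:
  assumes "e < x" "x < k" "k \<le> m"
  shows "shallow m (slot_perm2 m e x k)"
proof (cases "e = 0")
  case True
  show ?thesis
    by (rule shallow_sumI(3)[OF permutes_slot_perm2[OF assms], of x 0 k]) (use assms True in \<open>auto simp: slot_perm2_def\<close>)
next
  case False
  show ?thesis
    by (rule shallow_joinI[OF permutes_slot_perm2[OF assms], of 1 x k]) (use assms False in \<open>auto simp: slot_perm2_def\<close>)
qed

lemma shallow_slot_perm3:
  assumes "2 \<le> r" "r < q" "q < k" "k < m"
  shows "shallow m (slot_perm3 m r q k)"
  by (rule shallow_joinI[OF permutes_slot_perm3[OF assms], of r q k]) (use assms in \<open>auto simp: slot_perm3_def\<close>)

lemma shallow_slot_perm1:
  assumes "1 \<le> e" "Suc e < k" "k < y" "y < m"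
  shows "shallow m (slot_perm1 m e k y)"
  by (rule shallow_joinI[OF permutes_slot_perm1[OF assms], of 1 "k - 1" k]) (use assms in \<open>auto simp: slot_perm1_def\<close>)

subsection \<open>Consequences of avoiding 123\<close>

lemma avoids_123D:
  assumes "p permutes {1..n}" "avoids_123 n p" "1 \<le> i" "i < j" "j < k" "k \<le> n" "p i < p j"
  shows "p k < p j"
proof -
  have "p k \<noteq> p j" using permutes_inj[OF assms(1)] assms(5) by (metis inj_eq less_irrefl)
  moreover have "\<not> p j < p k" using assms(2-7) unfolding avoids_123_def by blast
  ultimately show ?thesis by simp
qed

lemma permutes_obtain:
  assumes "p permutes {1..n}" "1 \<le> y" "y \<le> n"
  obtains x where "1 \<le> x" "x \<le> n" "p x = y"
proof -
  obtain x where x: "p x = y" using permutes_surj[OF assms(1)] by (metis surjD)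
  then have "x \<in> {1..n}" using permutes_in_image[OF assms(1), of x] assms by simp
  then show thesis using that[of x] x by auto
qed

text \<open>Consider the inversion formed by the maximum and the last entry. The position
  \<open>y\<close> and the value \<open>p x\<close> are both missing from its rectangle, so width
  and height each exceed R + 1 and hence L does, which \<open>shallow_inversion\<close>
  forbids.\<close>

lemma shallow_around_max:
  assumes p: "p permutes {1..n}" and sh: "shallow n p" and k: "p k = n"
    and ord: "1 \<le> x" "x < k" "k < y" "y < n" and vals: "p y < p n" "p n < p x"
  shows False
proof -
  have lt: "p n < p k" using vals k permutes_in_image[OF p, of x] ord by auto
  have kn: "k < n" using ord by simp
  have "min n (p k) \<le> max k (p n) + Suc (card (inversion_box {1..n} p k n))"
    by (rule shallow_inversion[OF p sh _ _ kn lt]) (use ord in auto)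
  moreover have "card (inversion_box {1..n} p k n) \<le> card ({k<..<n} - {y})"
    unfolding inversion_box_def by (intro card_mono) (use vals in auto)
  moreover have "card (inversion_box {1..n} p k n) \<le> card ({p n<..<n} - {p x})"
    unfolding inversion_box_def
  proof (rule card_inj_on_le[of p])
    show "p ` {j \<in> {1..n}. k < j \<and> j < n \<and> p n < p j \<and> p j < p k} \<subseteq> {p n<..<n} - {p x}"
      using k ord permutes_inj[OF p] by (auto simp: inj_eq)
  qed (use permutes_inj_on[OF p] in auto)
  moreover have "y \<in> {k<..<n}" "p x \<in> {p n<..<n}"
  proof -
    have "p x \<noteq> n" using k ord permutes_inj[OF p] by (metis inj_eq less_irrefl)
    then show "p x \<in> {p n<..<n}" using vals permutes_in_image[OF p, of x] ord by auto
  qed (use ord in auto)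
  ultimately show False using k by (auto simp: max_def split: if_splits)
qed

text \<open>The half turn of the previous argument, with the inversion formed by the first entry and
  the minimum.\<close>

lemma shallow_around_min:
  assumes p: "p permutes {1..n}" and sh: "shallow n p" and k: "p k = 1"
    and ord: "1 < x" "x < k" "k < y" "y \<le> n" and vals: "p y < p 1" "p 1 < p x"
  shows False
proof -
  have y1: "1 < p y"
  proof -
    have "p y \<noteq> 1" using k ord permutes_inj[OF p] by (metis inj_eq less_irrefl)
    then show ?thesis using permutes_in_image[OF p, of y] ord by auto
  qed
  then have lt: "p k < p 1" using vals k by simp
  have kn: "1 < k" using ord by simp
  have "min k (p 1) \<le> max 1 (p k) + Suc (card (inversion_box {1..n} p 1 k))"
    by (rule shallow_inversion[OF p sh _ _ kn lt]) (use ord in auto)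
  moreover have "card (inversion_box {1..n} p 1 k) \<le> card ({1<..<k} - {x})"
    unfolding inversion_box_def by (intro card_mono) (use vals in auto)
  moreover have "card (inversion_box {1..n} p 1 k) \<le> card ({1<..<p 1} - {p y})"
    unfolding inversion_box_def
  proof (rule card_inj_on_le[of p])
    show "p ` {j \<in> {1..n}. 1 < j \<and> j < k \<and> p k < p j \<and> p j < p 1} \<subseteq> {1<..<p 1} - {p y}"
      using k ord permutes_inj[OF p] by (auto simp: inj_eq)
  qed (use permutes_inj_on[OF p] in auto)
  moreover have "x \<in> {1<..<k}" "p y \<in> {1<..<p 1}" using ord vals y1 by auto
  ultimately show False using k by (auto simp: min_def split: if_splits)
qed

text \<open>Avoidance makes the word decrease before n and after 1, and
  \<open>shallow_around_max\<close> puts the first of these parts below the second. By avoidance an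
  entry between n and 1 is either below the whole first part or above the whole last part;
  \<open>lh\<close> shows that all low ones come first.\<close>

lemma dec_cross_classify:
  assumes p: "p permutes {1..n}" and av: "avoids_123 n p" and sh: "shallow n p"
    and ends: "p 1 \<noteq> n" "p n \<noteq> 1" and PQ: "P < Q" "p P = n" "p Q = 1" and n: "1 \<le> n"
  shows "\<exists>N. 2 \<le> P \<and> P \<le> N \<and> N < Q \<and> Q < n \<and> p = dec_cross n P N Q"
proof -
  have inj: "p x = p y \<longleftrightarrow> x = y" for x y using permutes_inj[OF p] by (simp add: inj_eq)
  have rng: "1 \<le> p x \<and> p x \<le> n" if "1 \<le> x" "x \<le> n" for x
    using permutes_in_image[OF p, of x] that by auto
  have rP: "1 \<le> P" "P \<le> n" using permutes_in_image[OF p, of P] PQ n by auto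
  have rQ: "1 \<le> Q" "Q \<le> n" using permutes_in_image[OF p, of Q] PQ n by auto
  have P2: "2 \<le> P" using rP ends PQ by (cases "P = 1") auto
  have Qn: "Q < n" using rQ ends PQ by (cases "Q = n") auto
  note av3 = avoids_123D[OF p av]
  have ltn: "p x < n" if "1 \<le> x" "x \<le> n" "x \<noteq> P" for x using rng[of x] inj[of x P] that PQ by auto
  have gt1: "1 < p x" if "1 \<le> x" "x \<le> n" "x \<noteq> Q" for x using rng[of x] inj[of x Q] that PQ by auto
  have a: "p y < p x" if "1 \<le> x" "x < y" "y < P" for x y
    using av3[of x y P] that rP ltn[of y] inj[of x y] PQ by (cases "p x" "p y" rule: linorder_cases) auto
  have c: "p y < p x" if "Q < x" "x < y" "y \<le> n" for x y
    using av3[of Q x y] that rQ gt1[of x] PQ by simp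
  have ac: "p x < p n" if "1 \<le> x" "x < P" for x
  proof (rule ccontr)
    assume "\<not> ?thesis"
    then have "p n < p x" using inj[of x n] that rP by auto
    moreover have "p Q < p n" using gt1[of n] PQ Qn n by simp
    ultimately show False using shallow_around_max[OF p sh PQ(2), of x Q] that PQ Qn by auto
  qed
  have 1: "p 1 < p n" using ac[of 1] P2 by simp
  have a1: "p x \<le> p 1" if "1 \<le> x" "x < P" for x using a[of 1 x] that by (cases "x = 1") auto
  have cn: "p n \<le> p x" if "Q < x" "x \<le> n" for x using c[of x n] that by (cases "x = n") auto
  have high: "p j < p x" if "P < x" "x < Q" "p 1 < p x" "Q < j" "j \<le> n" for x j
    using av3[of 1 x j] that P2 by auto
  have low: "p x < p i" if "P < x" "x < Q" "p x < p 1" "1 \<le> i" "i < P" for x i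
  proof (rule ccontr)
    assume "\<not> ?thesis"
    then have "p i < p x" using inj[of i x] that by auto
    then have "p n < p x" using av3[of i x n] that Qn by auto
    then show False using 1 that by simp
  qed
  have ll: "p y < p x" if "P < x" "x < y" "y < Q" "p y < p 1" for x y
  proof (rule ccontr)
    assume "\<not> ?thesis"
    then have "p x < p y" using inj[of x y] that by auto
    then have "p n < p y" using av3[of x y n] that Qn by auto
    then show False using 1 that by simp
  qed
  have hh: "p y < p x" if "P < x" "x < y" "y \<le> n" "p 1 < p x" for x y
    using av3[of 1 x y] that P2 by auto
  \<comment> \<open>If a high entry preceded a low one, the values n - 1 and 2 would also lie
    between n and 1 in this order, and n, n - 1, 2, 1 would be the pattern excluded by
    \<open>defect_pos_of_outer_4321\<close>.\<close>
  have lh: False if xy: "P < x" "x < y" "y < Q" "p 1 < p x" "p y < p 1" for x y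
  proof -
    have n4: "4 \<le> n" using xy P2 Qn by simp
    have r: "1 \<le> n - 1" "n - 1 \<le> n" "1 \<le> (2::nat)" "2 \<le> n" using n4 by auto
    obtain x' where x': "1 \<le> x'" "x' \<le> n" "p x' = n - 1" by (rule permutes_obtain[OF p r(1,2)])
    obtain y' where y': "1 \<le> y'" "y' \<le> n" "p y' = 2" by (rule permutes_obtain[OF p r(3,4)])
    have px: "p x \<le> n - 1" using ltn[of x] xy Qn P2 by auto
    have py: "2 \<le> p y" using gt1[of y] xy Qn P2 by auto
    have "P < x'"
      using a1[of x'] x' px xy PQ(2) n4 by (cases x' P rule: linorder_cases) auto
    moreover have "x' < Q"
      using high[of x x'] x' px xy PQ(3) n4 by (cases x' Q rule: linorder_cases) auto
    moreover have "x' \<le> x"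
      using hh[of x x'] x' px xy by (cases x x' rule: linorder_cases) auto
    moreover have "P < y'"
      using low[of y y'] y' py xy PQ(2) n4 by (cases y' P rule: linorder_cases) auto
    moreover have "y' < Q"
      using cn[of y'] 1 y' py xy PQ(3) n4 by (cases y' Q rule: linorder_cases) auto
    moreover have "y \<le> y'"
      using ll[of y' y] y' py xy calculation by (cases y' y rule: linorder_cases) auto
    ultimately have "0 < defect {1..n} p"
      using defect_pos_of_outer_4321[OF p, of P x' y' Q] x' y' PQ ends n4 xy by auto
    then show False using sh shallow_iff_defect[OF p] by simp
  qed
  \<comment> \<open>The last low position; inserting \<open>P\<close> provides the default when
    there is no low entry.\<close>
  define M where "M = insert P {x. P < x \<and> x < Q \<and> p x < p 1}"
  define N where "N = Max M"
  have M: "finite M" "M \<noteq> {}" unfolding M_def by auto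
  have NM: "N \<in> M" using Max_in[OF M] unfolding N_def .
  have N: "P \<le> N" "N < Q" using NM PQ unfolding M_def by auto
  have Nl: "p x < p 1" if "P < x" "x \<le> N" for x
  proof (rule ccontr)
    assume "\<not> ?thesis"
    then have "p 1 < p x" using inj[of x 1] that P2 by auto
    moreover have "p N < p 1" using NM that unfolding M_def by auto
    ultimately show False using lh[of x N] that N by (cases "x = N") auto
  qed
  have Nh: "p 1 < p x" if "N < x" "x < Q" for x
  proof (rule ccontr)
    assume "\<not> ?thesis"
    then have "p x < p 1" using inj[of x 1] that P2 N by auto
    then have "x \<in> M" using that N unfolding M_def by auto
    then have "x \<le> N" unfolding N_def using M by simp
    then show False using that by simp
  qed
  have "p = dec_cross n P N Q"
  proof (rule permutes_eqI_order[OF p permutes_dec_cross[OF P2 N Qn]])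
    fix i j assume ij: "1 \<le> i" "i < j" "j \<le> n"
    have "p i < p j \<longleftrightarrow> (i \<le> N \<and> N < j \<and> i \<noteq> P \<and> j \<noteq> Q) \<or> j = P \<or> i = Q"
    proof -
      have j: "j < P \<or> j = P \<or> P < j \<and> j \<le> N \<or> N < j \<and> j < Q \<or> j = Q \<or> Q < j" by linarith
      consider "j < P" | "j = P" | "i < P" "P < j" "j \<le> N" | "i < P" "N < j" "j < Q" | "i < P" "j = Q" | "i < P" "Q < j"
        | "i = P" | "P < i" "j \<le> N" | "P < i" "i \<le> N" "N < j" "j < Q" | "P < i" "i \<le> N" "j = Q" | "P < i" "i \<le> N" "Q < j"
        | "N < i" "i < Q" "j < Q" | "N < i" "i < Q" "j = Q" | "N < i" "i < Q" "Q < j" | "i = Q" | "Q < i"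
      proof (cases "i < P")
        case True
        then show thesis using j that(1-6) by blast
      next
        case F: False
        show thesis
        proof (cases "i \<le> N")
          case True
          then show thesis using F j that(7-11) ij(2) by (metis leI le_less_trans less_imp_le_nat linorder_neqE_nat order_less_le_trans)
        next
          case False
          then show thesis using F that(12-16) ij(2) by (metis linorder_neqE_nat not_le)
        qed
      qed
      then show ?thesis
      proof cases
        case 1 then show ?thesis using a[of i j] ij N PQ by auto
      next case 2 then show ?thesis using ltn[of i] ij PQ by auto
      next case 3 then show ?thesis using low[of j i] Nl[of j] ij N PQ by auto
      next case 4 then show ?thesis using a1[of i] Nh[of j] ij N PQ by auto
      next case 5 then show ?thesis using gt1[of i] ij N PQ by auto
      next case 6 then show ?thesis using ac[of i] cn[of j] ij N PQ by auto
      next case 7 then show ?thesis using ltn[of j] ij N PQ by auto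
      next case 8 then show ?thesis using ll[of i j] Nl[of j] ij N PQ by auto
      next case 9 then show ?thesis using Nl[of i] Nh[of j] ij N PQ by auto
      next case 10 then show ?thesis using gt1[of i] ij N PQ by auto
      next case 11 then show ?thesis using Nl[of i] 1 cn[of j] ij N PQ by auto
      next case 12 then show ?thesis using hh[of i j] Nh[of i] ij N PQ by auto
      next case 13 then show ?thesis using gt1[of i] ij N PQ by auto
      next case 14 then show ?thesis using hh[of i j] Nh[of i] ij N PQ by auto
      next case 15 then show ?thesis using gt1[of j] ij N PQ by auto
      next case 16 then show ?thesis using c[of i j] ij N PQ by auto
      qed
    qed
    then show "p i < p j \<longleftrightarrow> dec_cross n P N Q i < dec_cross n P N Q j"
      unfolding dec_cross_less_iff[OF P2 N Qn ij] .
  qed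
  then show ?thesis using P2 N Qn by blast
qed

text \<open>Entries after 1 decrease, so n follows 1 immediately and cuts the word into two
  decreasing blocks. Comparing the smallest entry of the second with the largest of the first,
  \<open>p n\<close> with \<open>p 1\<close>, settles the rest.\<close>

lemma dec_sum_classify:
  assumes p: "p permutes {1..n}" and av: "avoids_123 n p"
    and QP: "Q < P" "p P = n" "p Q = 1" and n: "1 \<le> n" and lt: "p 1 < p n"
  shows "1 \<le> Q \<and> Q < n \<and> p = dec_sum n Q"
proof -
  have inj: "p x = p y \<longleftrightarrow> x = y" for x y using permutes_inj[OF p] by (simp add: inj_eq)
  have rng: "1 \<le> p x \<and> p x \<le> n" if "1 \<le> x" "x \<le> n" for x
    using permutes_in_image[OF p, of x] that by auto
  have rP: "1 \<le> P" "P \<le> n" using permutes_in_image[OF p, of P] QP n by auto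
  have rQ: "1 \<le> Q" "Q < n" using permutes_in_image[OF p, of Q] QP n rP by auto
  note av3 = avoids_123D[OF p av]
  have ltn: "p x < n" if "1 \<le> x" "x \<le> n" "x \<noteq> P" for x using rng[of x] inj[of x P] that QP by auto
  have gt1: "1 < p x" if "1 \<le> x" "x \<le> n" "x \<noteq> Q" for x using rng[of x] inj[of x Q] that QP by auto
  have a: "p y < p x" if "1 \<le> x" "x < y" "y < P" for x y
    using av3[of x y P] that rP ltn[of y] inj[of x y] QP by (cases "p x" "p y" rule: linorder_cases) auto
  have c: "p y < p x" if "Q < x" "x < y" "y \<le> n" for x y
    using av3[of Q x y] that rQ gt1[of x] QP by simp
  have "P = Suc Q"
  proof (rule ccontr)
    assume "P \<noteq> Suc Q"
    then have "p P < p (Suc Q)" using c[of "Suc Q" P] QP rP by simp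
    then show False using QP rng[of "Suc Q"] rQ by simp
  qed
  have a1: "p x \<le> p 1" if "1 \<le> x" "x \<le> Q" for x using a[of 1 x] that QP by (cases "x = 1") auto
  have cn: "p n \<le> p x" if "Q < x" "x \<le> n" for x using c[of x n] that by (cases "x = n") auto
  have "p = dec_sum n Q"
  proof (rule permutes_eqI_order[OF p permutes_dec_sum[OF rQ]])
    fix i j assume ij: "1 \<le> i" "i < j" "j \<le> n"
    consider "j \<le> Q" | "i \<le> Q" "Q < j" | "Q < i" by linarith
    then have "p i < p j \<longleftrightarrow> i \<le> Q \<and> Q < j"
    proof cases
      case 1 then show ?thesis using a[of i j] ij QP by auto
    next case 2 then show ?thesis using a1[of i] cn[of j] ij lt by auto
    next case 3 then show ?thesis using c[of i j] ij by auto
    qed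
    then show "p i < p j \<longleftrightarrow> dec_sum n Q i < dec_sum n Q j" unfolding dec_sum_less_iff[OF rQ ij] .
  qed
  then show ?thesis using rQ by simp
qed

subsection \<open>Permutations with a slot\<close>

text \<open>The inverse carries n, n - 1, 2, 1 at the positions \<open>p n\<close>,
  \<open>p (n - 1)\<close>, \<open>p 2\<close>, \<open>p 1\<close>.\<close>

lemma defect_pos_of_outer_4321_inv:
  assumes p: "p permutes {1..n}" and n: "4 \<le> n"
    and ord: "p n < p (n - 1)" "p (n - 1) < p 2" "p 2 < p 1" and ends: "p n \<noteq> 1" "p 1 \<noteq> n"
  shows "0 < defect {1..n} p"
proof -
  have i: "inv p (p x) = x" for x using permutes_inverses[OF p] by simp
  have "0 < defect {1..n} (inv p)"
    by (rule defect_pos_of_outer_4321[OF permutes_inv[OF p] ord])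
      (use i ends n permutes_inverses(1)[OF p] in metis)+
  then show ?thesis using defect_inv[OF _ p] by simp
qed

text \<open>The hypotheses leave open only how \<open>p k\<close> compares with the first block. As
  that block decreases, the number \<open>e\<close> of its entries above \<open>p k\<close> decides.
  The implication about \<open>1 \<le> e\<close> serves the case in which the maximum stands
  first.\<close>

lemma slot_perm2_determined:
  assumes p: "p permutes {1..n}" and qk: "1 \<le> q" "q < k" "k \<le> n"
    and a: "\<And>i j. 1 \<le> i \<Longrightarrow> i < j \<Longrightarrow> j \<le> q \<Longrightarrow> p j < p i"
    and b: "\<And>i j. 1 \<le> i \<Longrightarrow> i \<le> q \<Longrightarrow> q < j \<Longrightarrow> j \<le> n \<Longrightarrow> j \<noteq> k \<Longrightarrow> p i < p j"
    and c: "\<And>j. k < j \<Longrightarrow> j \<le> n \<Longrightarrow> p k < p j" "\<And>i. q < i \<Longrightarrow> i < k \<Longrightarrow> p k < p i"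
    and d: "\<And>i j. q < i \<Longrightarrow> i < j \<Longrightarrow> j \<le> n \<Longrightarrow> i \<noteq> k \<Longrightarrow> j \<noteq> k \<Longrightarrow> p j < p i"
    and pq: "p q < p k"
  shows "\<exists>e. e < q \<and> (p k < p 1 \<longrightarrow> 1 \<le> e) \<and> p = slot_perm2 n e q k"
proof -
  have inj: "p x = p y \<longleftrightarrow> x = y" for x y using permutes_inj[OF p] by (simp add: inj_eq)
  \<comment> \<open>The inserted 0 is the value of \<open>e\<close> when no entry of the first block
    exceeds \<open>p k\<close>.\<close>
  define M where "M = insert 0 {x. 1 \<le> x \<and> x \<le> q \<and> p k < p x}"
  define e where "e = Max M"
  have M: "finite M" "M \<noteq> {}" unfolding M_def by auto
  have eM: "e \<in> M" using Max_in[OF M] unfolding e_def .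
  have eq: "e < q"
  proof -
    have "e \<le> q" using eM unfolding M_def by auto
    moreover have "e \<noteq> q" using eM pq qk unfolding M_def by auto
    ultimately show ?thesis by simp
  qed
  have hi: "p k < p x" if "1 \<le> x" "x \<le> e" for x
    using eM that a[of x e] eq unfolding M_def by (cases "x = e") auto
  have lo: "p x < p k" if "e < x" "x \<le> q" for x
  proof (rule ccontr)
    assume "\<not> ?thesis"
    then have "x \<in> M" using inj[of x k] that qk unfolding M_def by auto
    then have "x \<le> e" unfolding e_def using M by simp
    then show False using that by simp
  qed
  have "1 \<le> e" if "p k < p 1"
    using lo[of 1] that qk by (cases "e = 0") auto
  moreover have "p = slot_perm2 n e q k"
  proof (rule permutes_eqI_order[OF p permutes_slot_perm2[OF eq qk(2,3)]])
    fix i j assume ij: "1 \<le> i" "i < j" "j \<le> n"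
    consider "j \<le> q" | "i \<le> q" "q < j" "j \<noteq> k" | "i \<le> e" "j = k" | "e < i" "i \<le> q" "j = k" | "q < i" "i = k"
      | "q < i" "i \<noteq> k" "j = k" | "q < i" "i \<noteq> k" "j \<noteq> k" using not_le by blast
    then have "p i < p j \<longleftrightarrow> (i \<le> q \<and> q < j \<and> \<not> (i \<le> e \<and> j = k)) \<or> i = k"
    proof cases
      case 1 then show ?thesis using a[of i j] ij qk by auto
    next case 2 then show ?thesis using b[of i j] ij qk by auto
    next case 3 then show ?thesis using hi[of i] ij qk by auto
    next case 4 then show ?thesis using lo[of i] ij qk by auto
    next case 5 then show ?thesis using c(1)[of j] ij qk by auto
    next case 6 then show ?thesis using c(2)[of i] ij qk by auto
    next case 7 then show ?thesis using d[of i j] ij qk by auto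
    qed
    then show "p i < p j \<longleftrightarrow> slot_perm2 n e q k i < slot_perm2 n e q k j"
      unfolding slot_perm2_less_iff[OF eq qk(2,3) ij] .
  qed
  ultimately show ?thesis using eq by blast
qed

text \<open>Let \<open>p 1 = n\<close> and \<open>p n \<noteq> 1\<close>. Exchanging \<open>n\<close> with the last entry of \<open>p\<close> and then the new first entry
  with \<open>1\<close>, and stripping the two fixed points so created, leaves a permutation \<open>r\<close> of size \<open>m = n - 2\<close> that
  carries the last entry of \<open>p\<close> at the former position \<open>k\<close> of \<open>1\<close>. Then \<open>slot m k r\<close> says that \<open>p\<close> avoids 123; \<open>r\<close>
  itself may contain 123 through position \<open>k\<close>.\<close>

definition slot :: "nat \<Rightarrow> nat \<Rightarrow> (nat \<Rightarrow> nat) \<Rightarrow> bool" where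
  "slot m k p \<longleftrightarrow> (\<forall>i. k < i \<and> i \<le> m \<longrightarrow> p k < p i)
    \<and> (\<forall>i j. k < i \<and> i < j \<and> j \<le> m \<longrightarrow> p j < p i)
    \<and> (\<forall>i j. 1 \<le> i \<and> i < j \<and> j < k \<and> p i < p k \<and> p j < p k \<longrightarrow> p j < p i)
    \<and> (\<forall>i j l. 1 \<le> i \<and> i < j \<and> j < l \<and> l \<le> m \<and> k \<noteq> i \<and> k \<noteq> j \<and> k \<noteq> l \<longrightarrow> \<not> (p i < p j \<and> p j < p l))"

text \<open>All entries smaller than \<open>p k\<close> stand to the left of
  \<open>k\<close>.\<close>

lemma slot_value_le:
  fixes p :: "nat \<Rightarrow> nat"
  assumes p: "p permutes {1..m}" and k: "1 \<le> k" "k \<le> m"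
    and above: "\<And>i. k < i \<Longrightarrow> i \<le> m \<Longrightarrow> p k < p i"
  shows "p k \<le> k"
proof -
  have "{j \<in> {1..m}. p j < p k} \<subseteq> {1..<k}"
  proof
    fix j assume j: "j \<in> {j \<in> {1..m}. p j < p k}"
    then have "\<not> k < j" using above[of j] by auto
    moreover have "j \<noteq> k" using j by auto
    ultimately show "j \<in> {1..<k}" using j by auto
  qed
  then have "card {j \<in> {1..m}. p j < p k} \<le> card {1..<k}" by (rule card_mono[rotated]) simp
  then show ?thesis using permutes_card_less[OF p, of k] k by simp
qed

lemma permutes_up: "p permutes {1..m} \<Longrightarrow> up p permutes {1..Suc m}"
proof -
  assume "p permutes {1..m}"
  then have "up p permutes Suc ` {1..m}" using permutes_up_iff by blast
  then show ?thesis by (rule permutes_subset) auto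
qed

lemma defect_up_Suc:
  assumes "p permutes {1..m}"
  shows "defect {1..Suc m} (up p) = defect {1..m} p"
proof -
  have "up p 1 = 1" using permutes_not_in[OF assms, of 0] by simp
  then have "defect {1..Suc m} (up p) = defect {Suc 1..Suc m} (up p)"
    using defect_drop_bot[OF permutes_up[OF assms]] by simp
  then show ?thesis using defect_up[of "{1..m}" p] by (simp add: image_Suc_atLeastAtMost)
qed

text \<open>The extension puts the raised slot entry first and 1 in its place. All values strictly
  between the two stand between them, so R = \<open>p k - 1\<close>, while
  \<open>p k \<le> k\<close> makes the overlap \<open>p k\<close>.\<close>

lemma defect_extend_left:
  assumes p: "p permutes {1..m}" and k: "1 \<le> k" "k \<le> m"
    and above: "\<And>i. k < i \<Longrightarrow> i \<le> m \<Longrightarrow> p k < p i"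
  shows "up p \<circ> transpose 1 (Suc k) permutes {1..Suc m}"
    and "defect {1..Suc m} (up p \<circ> transpose 1 (Suc k)) = defect {1..m} p"
proof -
  let ?t = "up p \<circ> transpose 1 (Suc k)"
  have u: "up p permutes {1..Suc m}" by (rule permutes_up[OF p])
  show t: "?t permutes {1..Suc m}" by (rule permutes_comp_transpose[OF u]) (use k in auto)
  have p0: "p 0 = 0" using permutes_not_in[OF p, of 0] by simp
  have v: "1 \<le> p k" "p k \<le> m" using permutes_in_image[OF p, of k] k by auto
  have t1: "?t 1 = Suc (p k)" "?t (Suc k) = 1" using p0 by (simp_all add: transpose_def)
  have tx: "?t (Suc x) = Suc (p x)" if "x \<noteq> 0" "x \<noteq> k" for x using that by (simp add: transpose_def)
  have "inversion_box {1..Suc m} ?t 1 (Suc k) = {x \<in> {1..Suc m}. ?t x \<in> {2..p k}}"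
  proof -
    have "1 < x \<and> x < Suc k" if x: "x \<in> {1..Suc m}" "?t x \<in> {2..p k}" for x
    proof -
      obtain y where y: "x = Suc y" using x by (cases x) auto
      have "x \<noteq> 1" "x \<noteq> Suc k" using x t1 by auto
      moreover have "\<not> Suc k < x" using above[of y] tx[of y] x y by auto
      ultimately show ?thesis using x by auto
    qed
    then show ?thesis unfolding inversion_box_def t1 by auto
  qed
  moreover have "{2..p k} \<subseteq> ?t ` {1..Suc m}"
    unfolding permutes_image[OF t] using v by auto
  ultimately have "card (inversion_box {1..Suc m} ?t 1 (Suc k)) = p k - 1"
    using card_values[OF permutes_inj_on[OF t], of "{2..p k}" "{1..Suc m}"] by simp
  then have "defect {1..Suc m} ?t = defect {1..Suc m} (?t \<circ> transpose 1 (Suc k))"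
    by (intro defect_inversion_eq[OF finite_atLeastAtMost t])
      (use t1 k v slot_value_le[OF p k above] in auto)
  also have "\<dots> = defect {1..Suc m} (up p)" unfolding comp_transpose_twice ..
  also have "\<dots> = defect {1..m} p" by (rule defect_up_Suc[OF p])
  finally show "defect {1..Suc m} ?t = defect {1..m} p" .
qed

text \<open>The excluded cases \<open>p k = 1\<close> and \<open>k = m\<close> amount to avoidance
  of 123; here the slot lies strictly inside in both respects.\<close>

locale slotted =
  fixes m k :: nat and p :: "nat \<Rightarrow> nat"
  assumes p: "p permutes {1..m}" and sh: "shallow m p" and slot: "slot m k p"
    and k: "1 \<le> k" "k < m" and v: "1 < p k"
begin

section \<open>Shape of a shallow permutation with an inner slot\<close>

lemma inj: "p x = p y \<longleftrightarrow> x = y" using permutes_inj[OF p] by (simp add: inj_eq)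

lemma rng: "1 \<le> x \<Longrightarrow> x \<le> m \<Longrightarrow> 1 \<le> p x \<and> p x \<le> m" using permutes_in_image[OF p, of x] by auto

lemma above: "k < i \<Longrightarrow> i \<le> m \<Longrightarrow> p k < p i" using slot unfolding slot_def by blast

lemma decr: "k < i \<Longrightarrow> i < j \<Longrightarrow> j \<le> m \<Longrightarrow> p j < p i" using slot unfolding slot_def by blast

lemma small: "1 \<le> i \<Longrightarrow> i < j \<Longrightarrow> j < k \<Longrightarrow> p i < p k \<Longrightarrow> p j < p k \<Longrightarrow> p j < p i"
  using slot unfolding slot_def by blast

lemma av: "1 \<le> i \<Longrightarrow> i < j \<Longrightarrow> j < l \<Longrightarrow> l \<le> m \<Longrightarrow> k \<noteq> i \<Longrightarrow> k \<noteq> j \<Longrightarrow> k \<noteq> l \<Longrightarrow> p i < p j \<Longrightarrow> p l < p j"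
  using slot inj[of j l] unfolding slot_def by (meson less_irrefl linorder_neqE_nat)

lemma le_slot: "p k \<le> k"
  using slot_value_le[OF p _ _ above] k by simp

text \<open>This extension of size \<open>m + 1\<close> is shallow too and brings in the entry 1 at
  the slot, which can complete an outer 4321 pattern that \<open>p\<close> alone does not
  show.\<close>

lemma shallow_left: "up p \<circ> transpose 1 (Suc k) permutes {1..Suc m}" "shallow (Suc m) (up p \<circ> transpose 1 (Suc k))"
proof -
  show t: "up p \<circ> transpose 1 (Suc k) permutes {1..Suc m}"
    by (rule defect_extend_left(1)[OF p _ _ above]) (use k in auto)
  have "defect {1..Suc m} (up p \<circ> transpose 1 (Suc k)) = defect {1..m} p"
    by (rule defect_extend_left(2)[OF p _ _ above]) (use k in auto)
  then show "shallow (Suc m) (up p \<circ> transpose 1 (Suc k))"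
    using sh shallow_iff_defect[OF p] shallow_iff_defect[OF t] by simp
qed

text \<open>The companion extension moves the slot entry to the end and puts a new maximum in its
  place. Everything after \<open>k\<close> exceeds \<open>p k\<close>, so all positions between the
  two belong to the rectangle.\<close>

lemma shallow_right: "p \<circ> transpose k (Suc m) permutes {1..Suc m}" "shallow (Suc m) (p \<circ> transpose k (Suc m))"
proof -
  let ?t = "p \<circ> transpose k (Suc m)"
  have u: "p permutes {1..Suc m}" using p by (rule permutes_subset) auto
  have top: "p (Suc m) = Suc m" using permutes_not_in[OF p, of "Suc m"] by simp
  show t: "?t permutes {1..Suc m}" by (rule permutes_comp_transpose[OF u]) (use k in auto)
  have tk: "?t k = Suc m" "?t (Suc m) = p k" using top by (simp_all add: transpose_def)
  have tx: "?t x = p x" if "x \<noteq> k" "x \<noteq> Suc m" for x using that by simp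
  have "inversion_box {1..Suc m} ?t k (Suc m) = {k<..<Suc m}"
  proof -
    have "p k < ?t x \<and> ?t x < Suc m" if "k < x" "x < Suc m" for x
      using that above[of x] rng[of x] tx[of x] k by auto
    then show ?thesis unfolding inversion_box_def tk using k by auto
  qed
  then have "defect {1..Suc m} ?t = defect {1..Suc m} (?t \<circ> transpose k (Suc m))"
    by (intro defect_inversion_eq[OF finite_atLeastAtMost t]) (use tk k v le_slot rng[of k] in auto)
  also have "\<dots> = defect {1..Suc m} p" unfolding comp_transpose_twice ..
  also have "\<dots> = 0" using sh shallow_iff_defect[OF p] defect_drop_top[OF u top] by simp
  finally show "shallow (Suc m) ?t" using shallow_iff_defect[OF t] by simp
qed

lemma one_before:
  assumes "p q = 1" shows "1 \<le> q" "q < k"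
proof -
  show "1 \<le> q" using permutes_in_image[OF p, of q] assms k by auto
  moreover have "q \<le> m" using permutes_in_image[OF p, of q] assms k by auto
  ultimately have "\<not> k < q" using above[of q] v assms by auto
  moreover have "q \<noteq> k" using assms v by auto
  ultimately show "q < k" by simp
qed

lemma max_pos:
  assumes "p r = m" shows "1 \<le> r" "r \<le> m" "r \<noteq> k"
proof -
  show "1 \<le> r" "r \<le> m" using permutes_in_image[OF p, of r] assms k by auto
  show "r \<noteq> k" using above[of m] rng[of m] k assms by auto
qed

lemma gt_one: "p q = 1 \<Longrightarrow> 1 \<le> x \<Longrightarrow> x \<le> m \<Longrightarrow> x \<noteq> q \<Longrightarrow> 1 < p x"
  using rng[of x] inj[of x q] by auto

lemma lt_max: "p r = m \<Longrightarrow> 1 \<le> x \<Longrightarrow> x \<le> m \<Longrightarrow> x \<noteq> r \<Longrightarrow> p x < m"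
  using rng[of x] inj[of x r] by auto

text \<open>The slot itself is the small entry between the maximum and the end that
  \<open>shallow_around_max\<close> asks for.\<close>

lemma before_max:
  assumes r: "p r = m" "r < k" and x: "1 \<le> x" "x < r"
  shows "p x < p m"
proof (rule ccontr)
  assume "\<not> ?thesis"
  then have "p m < p x" using inj[of x m] x r k by auto
  then show False using shallow_around_max[OF p sh r(1) x r(2) k(2)] above[of m] k by auto
qed

lemma prefix_decr:
  assumes r: "p r = m" and x: "1 \<le> x" "x < y" "y < r" "x \<noteq> k" "y \<noteq> k"
  shows "p y < p x"
proof (rule ccontr)
  assume "\<not> ?thesis"
  then have "p x < p y" using inj[of x y] x by auto
  then have "p r < p y" using av[of x y r] x r max_pos[OF r] by auto
  then show False using lt_max[OF r, of y] max_pos[OF r] x r by auto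
qed

text \<open>If the maximum lies to the right of \<open>k\<close>, the word before \<open>k\<close>
  decreases, so 1 stands at \<open>k - 1\<close> and the block H is empty. Otherwise the maximum
  belongs to H. In both cases 1 ends the first block.\<close>

lemma classify_slot_perm2:
  assumes q: "p q = 1" and r: "p r = m" and "q < r" and p1: "p 1 \<noteq> m" "p 1 < p m"
  shows "\<exists>e x. e < x \<and> x < k \<and> p = slot_perm2 m e x k"
proof (cases "k < r")
  case True
  have a: "p j < p i" if "1 \<le> i" "i < j" "j \<le> k - 1" for i j
    using prefix_decr[OF r, of i j] that True k by auto
  have a1: "p i \<le> p 1" if "1 \<le> i" "i \<le> k - 1" for i
    using a[of 1 i] that by (cases "i = 1") auto
  have cm: "p m \<le> p j" if "k < j" "j \<le> m" for j using decr[of j m] that by (cases "j = m") auto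
  have "q < k - 1 \<or> q = k - 1" using one_before[OF q] by linarith
  then have "p (k - 1) \<le> p q" using a[of q "k - 1"] one_before[OF q] by auto
  then have "p (k - 1) < p k" using q v by simp
  then have "\<exists>e. e < k - 1 \<and> (p k < p 1 \<longrightarrow> 1 \<le> e) \<and> p = slot_perm2 m e (k - 1) k"
    by (intro slot_perm2_determined[OF p])
      (use one_before[OF q] k a above decr le_less_trans[OF a1 less_le_trans[OF p1(2) cm]] in auto)
  then show ?thesis using k one_before[OF q] by (metis diff_less less_numeral_extra(1) order_less_le_trans)
next
  case False
  then have rk: "r < k" using max_pos[OF r] by simp
  note q' = one_before[OF q] and r' = max_pos[OF r]
  have pm: "p m \<le> p j" if "q < j" "j \<le> m" "j \<noteq> k" for j
    using av[of q j m] gt_one[OF q, of j] that q q' k by (cases "j = m") auto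
  have "\<exists>e. e < q \<and> (p k < p 1 \<longrightarrow> 1 \<le> e) \<and> p = slot_perm2 m e q k"
  proof (rule slot_perm2_determined[OF p])
    show "p j < p i" if "1 \<le> i" "i < j" "j \<le> q" for i j
      using prefix_decr[OF r, of i j] that q' assms(3) by auto
    show "p i < p j" if "1 \<le> i" "i \<le> q" "q < j" "j \<le> m" "j \<noteq> k" for i j
      using before_max[OF r rk, of i] pm[of j] that assms(3) by auto
    show "p k < p i" if "q < i" "i < k" for i
      using above[of m] pm[of i] that k by auto
    show "p j < p i" if "q < i" "i < j" "j \<le> m" "i \<noteq> k" "j \<noteq> k" for i j
      using av[of q i j] gt_one[OF q, of i] that q q' by auto
  qed (use q' q v k above in auto)
  then show ?thesis using q' by blast
qed

text \<open>Exchanging the two ends keeps the defect and fixes \<open>m\<close>. What remains starts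
  with \<open>p m\<close>, which exceeds the slot entry, so it has the shape of
  \<open>slot_perm2\<close> with \<open>1 \<le> e\<close>.\<close>

lemma classify_slot_perm4:
  assumes q: "p q = 1" and p1: "p 1 = m"
  shows "\<exists>e x. 1 \<le> e \<and> e < x \<and> x < k \<and> p \<circ> transpose 1 m = slot_perm2 (m - 1) e x k"
proof -
  let ?s = "p \<circ> transpose 1 m"
  obtain m' where m': "m = Suc m'" using k by (cases m) auto
  have s: "?s permutes {1..m}" by (rule permutes_comp_transpose[OF p]) (use k in auto)
  have sm: "?s m = m" "?s 1 = p m" using p1 by simp_all
  have s': "?s permutes {1..m'}" using permutes_drop_top[of ?s 1 m'] s sm m' by simp
  have "defect {1..m} p = defect {1..m} ?s" by (rule defect_swap_ends[OF p]) (use k p1 in auto)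
  then have sh': "shallow m' ?s"
    using sh shallow_iff_defect[OF p] shallow_iff_defect[OF s'] defect_drop_top[of ?s 1 m'] s sm m' by simp
  note q' = one_before[OF q]
  have q1: "1 < q" using q' q p1 k by (cases "q = 1") auto
  have sx: "?s x = p x" if "x \<noteq> 1" "x \<noteq> m" for x using that by simp
  have sq: "?s q = 1" "?s k = p k" using q q1 q' k sx by auto
  have vw: "p k < p m" using above[of m] k by simp
  have A: "p x < p m" if "1 < x" "x \<le> q" for x
  proof (rule ccontr)
    assume n: "\<not> ?thesis"
    then have "p m < p x" using inj[of x m] that q' k by auto
    moreover have "x \<noteq> q" using n v vw q by auto
    ultimately show False
      using shallow_around_min[OF s' sh' sq(1), of x k] that q' k m' vw sx[of x] sx[of k] sm by auto
  qed
  have Bd: "p y < p x" if "1 < x" "x < y" "y \<le> q" for x y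
  proof (rule ccontr)
    assume "\<not> ?thesis"
    then have "p x < p y" using inj[of x y] that by auto
    then have "p m < p y" using av[of x y m] that q' k by auto
    then show False using A[of y] that by simp
  qed
  have C: "p m < p x" if "q < x" "x < m" "x \<noteq> k" for x
    using av[of q x m] gt_one[OF q, of x] that q q' k by auto
  have "\<exists>e. e < q \<and> (?s k < ?s 1 \<longrightarrow> 1 \<le> e) \<and> ?s = slot_perm2 m' e q k"
  proof (rule slot_perm2_determined[OF s'])
    show "?s j < ?s i" if "1 \<le> i" "i < j" "j \<le> q" for i j
      using A[of j] Bd[of i j] that q' k sx[of i] sx[of j] sm by (cases "i = 1") auto
    show "?s i < ?s j" if "1 \<le> i" "i \<le> q" "q < j" "j \<le> m'" "j \<noteq> k" for i j
      using A[of i] C[of j] that q' k m' sx[of i] sx[of j] sm by (cases "i = 1") auto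
    show "?s k < ?s j" if "k < j" "j \<le> m'" for j
      using above[of j] that m' sx[of j] sq k by auto
    show "?s k < ?s i" if "q < i" "i < k" for i
      using C[of i] vw that sx[of i] sq k q1 by auto
    show "?s j < ?s i" if "q < i" "i < j" "j \<le> m'" "i \<noteq> k" "j \<noteq> k" for i j
      using av[of q i j] gt_one[OF q, of i] that q q' q1 m' sx[of i] sx[of j] by auto
  qed (use q' q1 k m' sq v in auto)
  then show ?thesis using sm sq vw m' q' by auto
qed

text \<open>First \<open>p 1 < p k\<close>, by \<open>shallow_around_min\<close> with the maximum
  and the slot on the two sides of 1. Hence an entry before \<open>k\<close> that exceeds
  \<open>p k\<close> also exceeds all later ones; up to the position of 1 only the maximum does so,
  which is where the left extension enters.\<close>

lemma classify_slot_perm3: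
  assumes q: "p q = 1" and r: "p r = m" and "r < q" and p1: "p 1 \<noteq> m"
  shows "2 \<le> r \<and> p = slot_perm3 m r q k"
proof -
  note q' = one_before[OF q] and r' = max_pos[OF r]
  have rk: "r < k" using assms(3) q' by simp
  have r2: "2 \<le> r" using r' p1 r by (cases "r = 1") auto
  have "p 1 < p k"
  proof (rule ccontr)
    assume "\<not> ?thesis"
    then have "p k < p 1" using inj[of 1 k] r2 rk by auto
    moreover have "p 1 < p r" using lt_max[OF r, of 1] r2 r k by auto
    ultimately show False using shallow_around_min[OF p sh q, of r k] r2 assms(3) q' k by auto
  qed
  then have large: "p j < p i" if "p k < p i" "1 \<le> i" "i < k" "i < j" "j \<le> m" for i j
  proof (cases "j = k")
    case False
    have "i \<noteq> 1" using that \<open>p 1 < p k\<close> by auto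
    then show ?thesis using av[of 1 i j] that False \<open>p 1 < p k\<close> by auto
  qed (use that in simp)
  have s1: "p i < p k" if "1 \<le> i" "i < r" for i
  proof (rule ccontr)
    assume "\<not> ?thesis"
    then have "p k < p i" using inj[of i k] that rk by auto
    then have "p r < p i" using large[of i r] that rk r' by auto
    then show False using r rng[of i] that r' by auto
  qed
  have s2: "p i < p k" if i: "r < i" "i \<le> q" for i
  proof (rule ccontr)
    assume "\<not> ?thesis"
    then have pi: "p k < p i" using inj[of i k] that q' by auto
    then have iq: "i < q" using q v that by (cases "i = q") auto
    have im: "p i \<le> m - 1" using lt_max[OF r, of i] i r' q' k by auto
    have b: "1 \<le> m - 1" "m - 1 \<le> m" using k by auto
    obtain x where x: "1 \<le> x" "x \<le> m" "p x = m - 1" by (rule permutes_obtain[OF p b])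
    have xk: "x < k"
    proof (cases x k rule: linorder_cases)
      case equal then show ?thesis using pi im x by simp
    next
      case greater then show ?thesis using large[of i x] pi im x i q' r' by auto
    qed
    have xr: "r < x" using s1[of x] x pi im r by (cases x r rule: linorder_cases) (use k in auto)
    have xq: "x < q" using large[of i x] x pi im i xk r' q' iq by (cases x i rule: linorder_cases) auto
    \<comment> \<open>In the left extension the positions of m, m - 1, 1 and the slot carry the two
      largest values, 2 and 1: an outer 4321 pattern.\<close>
    let ?t = "up p \<circ> transpose 1 (Suc k)"
    have tx: "?t (Suc y) = Suc (p y)" if "y \<noteq> 0" "y \<noteq> k" for y using that by (simp add: transpose_def)
    have p0: "p 0 = 0" using permutes_not_in[OF p, of 0] by simp
    have t1: "?t 1 = Suc (p k)" "?t (Suc k) = 1" using p0 by (simp_all add: transpose_def)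
    have km: "p k < m" using pi im k by simp
    have "0 < defect {1..Suc m} ?t"
    proof (rule defect_pos_of_outer_4321[OF shallow_left(1), of "Suc r" "Suc x" "Suc q" "Suc k"])
      show "?t (Suc r) = Suc m" using tx[of r] r r' rk by simp
      show "?t (Suc x) = Suc m - 1" using tx[of x] x xk k by simp
      show "?t (Suc q) = 2" using tx[of q] q q' by simp
      show "?t (Suc k) = 1" by (rule t1)
      show "?t 1 \<noteq> Suc m" unfolding t1 using km by simp
      show "?t (Suc m) \<noteq> 1" using tx[of m] rng[of m] k by simp
    qed (use xr xq q' r2 k in auto)
    then show False using shallow_left(2) shallow_iff_defect[OF shallow_left(1)] by simp
  qed
  have l: "p k < p i" if "q < i" "i < k" for i
  proof (rule ccontr)
    assume "\<not> ?thesis"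
    then have "p i < p k" using inj[of i k] that by auto
    then have "p i < p q" using small[of q i] q v q' that by auto
    then show False using q rng[of i] that k q' by auto
  qed
  have sd: "p j < p i" if "1 \<le> i" "i < j" "j \<le> q" "i \<noteq> r" "j \<noteq> r" for i j
    using small[of i j] s1[of i] s2[of i] s1[of j] s2[of j] that q' by (cases "i < r"; cases "j < r") auto
  have si: "p i < p k" if "1 \<le> i" "i \<le> q" "i \<noteq> r" for i using s1[of i] s2[of i] that by (cases "i < r") auto
  have "p = slot_perm3 m r q k"
  proof (rule permutes_eqI_order[OF p permutes_slot_perm3[OF r2 assms(3) q'(2) k(2)]])
    fix i j assume ij: "1 \<le> i" "i < j" "j \<le> m"
    consider "j = r" | "i = r" | "i \<noteq> r" "j \<noteq> r" "j \<le> q" | "i \<noteq> r" "i \<le> q" "q < j" "j < k" | "i \<noteq> r" "i \<le> q" "j = k"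
      | "i \<noteq> r" "i \<le> q" "k < j" | "q < i" "i < k" | "i = k" | "k < i" using not_le linorder_neqE_nat by metis
    then have "p i < p j \<longleftrightarrow> (i \<le> q \<and> q < j \<and> i \<noteq> r) \<or> j = r \<or> i = k"
    proof cases
      case 1 then show ?thesis using lt_max[OF r, of i] ij r by auto
    next case 2 then show ?thesis using lt_max[OF r, of j] ij r rk by auto
    next case 3 then show ?thesis using sd[of i j] ij q' by auto
    next case 4 then show ?thesis using si[of i] l[of j] ij by auto
    next case 5 then show ?thesis using si[of i] ij q' by auto
    next case 6 then show ?thesis using si[of i] above[of j] ij q' by auto
    next case 7 then show ?thesis using large[of i j] l[of i] ij assms(3) by auto
    next case 8 then show ?thesis using above[of j] ij by auto
    next case 9 then show ?thesis using decr[of i j] ij rk q' by auto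
    qed
    then show "p i < p j \<longleftrightarrow> slot_perm3 m r q k i < slot_perm3 m r q k j"
      unfolding slot_perm3_less_iff[OF r2 assms(3) q'(2) k(2) ij] .
  qed
  then show ?thesis using r2 by simp
qed

text \<open>By \<open>before_max\<close> the maximum lies to the right of \<open>k\<close>, so the
  word decreases on both sides of \<open>k\<close>. The shape is then fixed by the last entry before
  \<open>k\<close> above \<open>p k\<close>, the last entry after \<open>k\<close> above
  \<open>p 1\<close>, and the fact that before \<open>k\<close> only \<open>p 1\<close> exceeds
  \<open>p m\<close>.\<close>

lemma classify_slot_perm1:
  assumes q: "p q = 1" and r: "p r = m" and p1: "p 1 \<noteq> m" "p m < p 1"
  shows "\<exists>e y. 1 \<le> e \<and> Suc e < k \<and> k < y \<and> y < m \<and> p = slot_perm1 m e k y"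
proof -
  note q' = one_before[OF q] and r' = max_pos[OF r]
  have r1: "1 < r" using r' p1 r by (cases "r = 1") auto
  have rk: "k < r" using before_max[OF r, of 1] r1 p1 r' by (cases r k rule: linorder_cases) auto
  have a: "p j < p i" if "1 \<le> i" "i < j" "j < k" for i j
    using prefix_decr[OF r, of i j] that rk by auto
  have cm: "p m \<le> p j" if "k < j" "j \<le> m" for j using decr[of j m] that by (cases "j = m") auto
  have vw: "p k < p m" using above[of m] k by simp
  define M where "M = {x. 1 \<le> x \<and> x < k \<and> p k < p x}"
  define e where "e = Max M"
  have q1: "1 < q" using q' q p1 vw v by (cases "q = 1") auto
  have M: "finite M" "M \<noteq> {}" unfolding M_def using p1 vw k q1 q' by (auto intro!: exI[of _ 1])
  have eM: "1 \<le> e" "e < k" "p k < p e" using Max_in[OF M] unfolding e_def M_def by auto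
  have hi: "p k < p x" if "1 \<le> x" "x \<le> e" for x
    using eM that a[of x e] by (cases "x = e") auto
  have lo: "p x < p k" if "e < x" "x < k" for x
  proof (rule ccontr)
    assume "\<not> ?thesis"
    then have "x \<in> M" using inj[of x k] that unfolding M_def by auto
    then have "x \<le> e" unfolding e_def using M by simp
    then show False using that by simp
  qed
  have "q < k - 1 \<or> q = k - 1" using q' by linarith
  then have "p (k - 1) \<le> p q" using a[of q "k - 1"] q' by auto
  then have e2: "Suc e < k" using eM v q by (cases "e = k - 1") auto
  define Y where "Y = {x. k < x \<and> x \<le> m \<and> p 1 < p x}"
  define y where "y = Max Y"
  have "r \<in> Y" unfolding Y_def using rk r' lt_max[OF r, of 1] r r1 k by auto
  then have Y: "finite Y" "Y \<noteq> {}" unfolding Y_def by auto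
  have yY: "k < y" "y \<le> m" "p 1 < p y" using Max_in[OF Y] unfolding y_def Y_def by auto
  have ym: "y < m" using yY p1 by (cases "y = m") auto
  have hy: "p 1 < p x" if "k < x" "x \<le> y" for x
    using yY that decr[of x y] by (cases "x = y") auto
  have ly: "p x < p 1" if "y < x" "x \<le> m" for x
  proof (rule ccontr)
    assume "\<not> ?thesis"
    then have "x \<in> Y" using inj[of x 1] that yY unfolding Y_def by auto
    then have "x \<le> y" unfolding y_def using Y by simp
    then show False using that by simp
  qed
  have k2: "2 < k" using e2 eM by simp
  \<comment> \<open>Otherwise the first two and last two entries of the right extension would
    satisfy p 1 > p 2 > p m > p k, which \<open>defect_pos_of_outer_4321_inv\<close>
    excludes.\<close>
  have 2: "p 2 < p m"
  proof (rule ccontr)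
    assume "\<not> ?thesis"
    then have p2: "p m < p 2" using inj[of m 2] k k2 by auto
    let ?t = "p \<circ> transpose k (Suc m)"
    have top: "p (Suc m) = Suc m" using permutes_not_in[OF p, of "Suc m"] by simp
    have t: "?t (Suc m) = p k" "?t m = p m" "?t 2 = p 2" "?t 1 = p 1" using k k2 by (auto simp: transpose_def)
    have "0 < defect {1..Suc m} ?t"
      by (rule defect_pos_of_outer_4321_inv[OF shallow_right(1)])
        (use t p2 vw a[of 1 2] k2 k v rng[of 1] in \<open>auto simp del: comp_apply\<close>)
    then show False using shallow_right(2) shallow_iff_defect[OF shallow_right(1)] by simp
  qed
  have a2: "p i \<le> p 2" if "2 \<le> i" "i < k" for i using a[of 2 i] that by (cases "i = 2") auto
  have "p = slot_perm1 m e k y"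
  proof (rule permutes_eqI_order[OF p permutes_slot_perm1[OF eM(1) e2 yY(1) ym]])
    fix i j assume ij: "1 \<le> i" "i < j" "j \<le> m"
    consider "j < k" | "i \<le> e" "j = k" | "i = 1" "k < j" "j \<le> y" | "i = 1" "y < j" | "2 \<le> i" "i \<le> e" "k < j"
      | "e < i" "i < k" "j = k" | "e < i" "i < k" "k < j" | "i = k" | "k < i"
    proof (cases "i \<le> e")
      case True
      then show thesis using that(1-5) ij by (cases "i = 1"; cases j k rule: linorder_cases; cases "j \<le> y") auto
    next
      case False
      then show thesis using that(1,6-9) ij by (cases i k rule: linorder_cases; cases j k rule: linorder_cases) auto
    qed
    then have "p i < p j \<longleftrightarrow> (if i = 1 then k < j \<and> j \<le> y else if i \<le> e then k < j else if i \<le> k then k \<le> j else False)"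
    proof cases
      case 1 then show ?thesis using a[of i j] ij by auto
    next case 2 then show ?thesis using hi[of i] ij eM by auto
    next case 3 then show ?thesis using hy[of j] ij by auto
    next case 4 then show ?thesis using ly[of j] ij yY by auto
    next case 5 then show ?thesis using a2[of i] 2 cm[of j] ij eM by auto
    next case 6 then show ?thesis using lo[of i] ij eM by auto
    next case 7 then show ?thesis using lo[of i] above[of j] ij eM by auto
    next case 8 then show ?thesis using above[of j] ij k2 eM by auto
    next case 9 then show ?thesis using decr[of i j] ij k2 eM by auto
    qed
    then show "p i < p j \<longleftrightarrow> slot_perm1 m e k y i < slot_perm1 m e k y j"
      unfolding slot_perm1_less_iff[OF eM(1) e2 yY(1) ym ij] .
  qed
  then show ?thesis using eM e2 yY ym by blast
qed

end

subsection \<open>Counting\<close>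

definition shallow_avoiders :: "nat \<Rightarrow> (nat \<Rightarrow> nat) set" where
  "shallow_avoiders n = {p. p permutes {1..n} \<and> avoids_123 n p \<and> shallow n p}"

lemma t123_eq: "t123 n = card (shallow_avoiders n)"
  unfolding t123_def shallow_avoiders_def ..

lemma finite_shallow_avoiders: "finite (shallow_avoiders n)"
  by (rule finite_subset[OF _ finite_permutations[of "{1..n}"]]) (auto simp: shallow_avoiders_def)

text \<open>The parameter ranges of all three-parameter families are shifted into this form, so that
  each size is a single binomial coefficient.\<close>

definition triples :: "nat \<Rightarrow> (nat \<times> nat \<times> nat) set" where
  "triples M = {(a, b, c). a < b \<and> b < c \<and> c < M}"

lemma finite_triples: "finite (triples M)"
  by (rule finite_subset[of _ "{..<M} \<times> {..<M} \<times> {..<M}"]) (auto simp: triples_def)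

lemma card_triples: "card (triples M) = M choose 3"
proof -
  have pairs: "card {(a, b). a < b \<and> b < c} = c choose 2" for c :: nat
  proof (induction c)
    case (Suc c)
    have "{(a, b). a < b \<and> b < Suc c} = {(a, b). a < b \<and> b < c} \<union> (\<lambda>a. (a, c)) ` {..<c}" by auto
    moreover have "card ((\<lambda>a. (a, c)) ` {..<c}) = c" by (simp add: card_image inj_on_def)
    moreover have "finite {(a, b). a < b \<and> b < c}"
      by (rule finite_subset[of _ "{..<c} \<times> {..<c}"]) auto
    ultimately have "card {(a, b). a < b \<and> b < Suc c} = card {(a, b). a < b \<and> b < c} + c"
      by (simp, subst card_Un_disjoint) auto
    then show ?case using Suc by (simp add: numeral_2_eq_2)
  qed simp
  show ?thesis
  proof (induction M)
    case (Suc M)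
    have "triples (Suc M) = triples M \<union> (\<lambda>(a, b). (a, b, M)) ` {(a, b). a < b \<and> b < M}"
      unfolding triples_def by (auto simp: image_iff)
    moreover have "card ((\<lambda>(a, b). (a, b, M)) ` {(a, b). a < b \<and> b < M}) = M choose 2"
      using pairs[of M] by (subst card_image) (auto simp: inj_on_def)
    moreover have "finite {(a, b). a < b \<and> b < M}"
      by (rule finite_subset[of _ "{..<M} \<times> {..<M}"]) auto
    moreover have "triples M \<inter> (\<lambda>(a, b). (a, b, M)) ` {(a, b). a < b \<and> b < M} = {}"
      unfolding triples_def by auto
    ultimately have "card (triples (Suc M)) = card (triples M) + (M choose 2)"
      using finite_triples[of M] by (simp add: card_Un_disjoint)
    then show ?case using Suc by (simp add: numeral_3_eq_3 numeral_2_eq_2)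
  next
    case 0
    have "triples 0 = {}" unfolding triples_def by auto
    then show ?case by simp
  qed
qed

subsection \<open>Inverses\<close>

lemma avoids_123_inv:
  assumes p: "p permutes {1..n}" and av: "avoids_123 n p"
  shows "avoids_123 n (inv p)"
proof (unfold avoids_123_def, rule notI, elim exE conjE)
  fix i j k assume *: "1 \<le> i" "i < j" "j < k" "k \<le> n" "inv p i < inv p j" "inv p j < inv p k"
  have "inv p i \<in> {1..n}" "inv p k \<in> {1..n}"
    using permutes_in_image[OF permutes_inv[OF p], of i] permutes_in_image[OF permutes_inv[OF p], of k] *(1-4)
    by simp_all
  moreover have "p (inv p x) = x" for x using permutes_inverses[OF p] by simp
  ultimately have "1 \<le> inv p i \<and> inv p i < inv p j \<and> inv p j < inv p k \<and> inv p k \<le> n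
      \<and> p (inv p i) < p (inv p j) \<and> p (inv p j) < p (inv p k)" using * by simp
  then show False using av unfolding avoids_123_def by blast
qed

lemma inv_in_shallow_avoiders: "p \<in> shallow_avoiders n \<Longrightarrow> inv p \<in> shallow_avoiders n"
  unfolding shallow_avoiders_def
  using avoids_123_inv permutes_inv shallow_iff_defect defect_inv[of "{1..n}" p] by auto

lemma inv_inv_shallow_avoiders: "p \<in> shallow_avoiders n \<Longrightarrow> inv (inv p) = p"
  unfolding shallow_avoiders_def using permutes_inv_inv by blast

lemma card_inv_image:
  assumes "A \<subseteq> shallow_avoiders n" shows "card (inv ` A) = card A"
proof (rule card_image)
  show "inj_on inv A"
    by (rule inj_on_inverseI[of _ inv]) (use assms inv_inv_shallow_avoiders in auto)
qed

lemma shallow_avoiders_inv_eq_iff: "p \<in> shallow_avoiders n \<Longrightarrow> inv p y = x \<longleftrightarrow> p x = y"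
  unfolding shallow_avoiders_def using permutes_inv_eq by fastforce

subsection \<open>Neither \<open>p 1 = n\<close> nor \<open>p n = 1\<close>\<close>

definition max_before_min :: "nat \<Rightarrow> (nat \<Rightarrow> nat) set" where
  "max_before_min n = {p \<in> shallow_avoiders n. p 1 \<noteq> n \<and> p n \<noteq> 1 \<and> inv p n < inv p 1}"

lemma dec_cross_in_max_before_min:
  assumes h: "2 \<le> P" "P \<le> N" "N < Q" "Q < n"
  shows "dec_cross n P N Q \<in> max_before_min n"
proof -
  have v: "dec_cross n P N Q P = n" "dec_cross n P N Q Q = 1" "dec_cross n P N Q 1 = N" "dec_cross n P N Q n = Suc N"
    using h by (auto simp: dec_cross_def)
  note p = permutes_dec_cross[OF h]
  have "avoids_123 n (dec_cross n P N Q)"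
    unfolding avoids_123_def
  proof
    assume "\<exists>i j k. 1 \<le> i \<and> i < j \<and> j < k \<and> k \<le> n \<and> dec_cross n P N Q i < dec_cross n P N Q j \<and> dec_cross n P N Q j < dec_cross n P N Q k"
    then obtain i j k where *: "1 \<le> i" "i < j" "j < k" "k \<le> n"
      "dec_cross n P N Q i < dec_cross n P N Q j" "dec_cross n P N Q j < dec_cross n P N Q k" by blast
    then show False
      using dec_cross_less_iff[OF h, of i j] dec_cross_less_iff[OF h, of j k] h by auto
  qed
  moreover have "inv (dec_cross n P N Q) n = P" "inv (dec_cross n P N Q) 1 = Q" using v permutes_inv_eq[OF p] by auto
  ultimately show ?thesis
    unfolding max_before_min_def shallow_avoiders_def using p shallow_dec_cross[OF h] v h by auto
qed

lemma max_before_min_cases: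
  assumes "p \<in> max_before_min n" and n: "1 \<le> n"
  obtains P N Q where "2 \<le> P" "P \<le> N" "N < Q" "Q < n" "p = dec_cross n P N Q"
proof -
  have p: "p permutes {1..n}" "avoids_123 n p" "shallow n p" "p 1 \<noteq> n" "p n \<noteq> 1" "inv p n < inv p 1"
    using assms unfolding max_before_min_def shallow_avoiders_def by auto
  from dec_cross_classify[OF p(1-6) _ _ n] permutes_inverses[OF p(1)] that show thesis by blast
qed

text \<open>The shifts by 2, 1, 1 turn the chain \<open>2 \<le> P \<le> N < Q < n\<close> into a
  strictly increasing triple below \<open>n - 1\<close>.\<close>

lemma max_before_min_eq:
  assumes n: "1 \<le> n"
  shows "max_before_min n = (\<lambda>(a, b, c). dec_cross n (a + 2) (b + 1) (c + 1)) ` triples (n - 1)"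
proof
  show "max_before_min n \<subseteq> (\<lambda>(a, b, c). dec_cross n (a + 2) (b + 1) (c + 1)) ` triples (n - 1)"
  proof
    fix p assume "p \<in> max_before_min n"
    from this n obtain P N Q where h: "2 \<le> P" "P \<le> N" "N < Q" "Q < n" "p = dec_cross n P N Q" by (rule max_before_min_cases)
    then have "(P - 2, N - 1, Q - 1) \<in> triples (n - 1)" unfolding triples_def by auto
    moreover have "P - 2 + 2 = P" "N - 1 + 1 = N" "Q - 1 + 1 = Q" using h by auto
    then have "p = dec_cross n (P - 2 + 2) (N - 1 + 1) (Q - 1 + 1)" using h(5) by (simp only:)
    ultimately show "p \<in> (\<lambda>(a, b, c). dec_cross n (a + 2) (b + 1) (c + 1)) ` triples (n - 1)"
      by (intro image_eqI[of _ _ "(P - 2, N - 1, Q - 1)"]) (simp only: prod.case)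
  qed
next
  show "(\<lambda>(a, b, c). dec_cross n (a + 2) (b + 1) (c + 1)) ` triples (n - 1) \<subseteq> max_before_min n"
    by (auto simp: triples_def intro!: dec_cross_in_max_before_min)
qed

lemma card_max_before_min: "1 \<le> n \<Longrightarrow> card (max_before_min n) = (n - 1) choose 3"
proof -
  have "inj_on (\<lambda>(a, b, c). dec_cross n (a + 2) (b + 1) (c + 1)) (triples (n - 1))"
  proof (rule inj_onI)
    fix s s'
    assume t': "s \<in> triples (n - 1)" "s' \<in> triples (n - 1)"
      and e': "(\<lambda>(a, b, c). dec_cross n (a + 2) (b + 1) (c + 1)) s = (\<lambda>(a, b, c). dec_cross n (a + 2) (b + 1) (c + 1)) s'"
    obtain a b c a' b' c' where s: "s = (a, b, c)" "s' = (a', b', c')" by (cases s; cases s') auto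
    note t = t'[unfolded s]
    have e: "dec_cross n (a + 2) (b + 1) (c + 1) = dec_cross n (a' + 2) (b' + 1) (c' + 1)"
      using e' unfolding s by (simp only: prod.case)
    have h: "2 \<le> a + 2" "a + 2 \<le> b + 1" "b + 1 < c + 1" "c + 1 < n"
      and h': "2 \<le> a' + 2" "a' + 2 \<le> b' + 1" "b' + 1 < c' + 1" "c' + 1 < n" using t unfolding triples_def by auto
    have v: "dec_cross n (a + 2) (b + 1) (c + 1) (a + 2) = n" "dec_cross n (a + 2) (b + 1) (c + 1) (c + 1) = 1"
        "dec_cross n (a + 2) (b + 1) (c + 1) 1 = b + 1" using h by (auto simp: dec_cross_def)
    have v': "dec_cross n (a' + 2) (b' + 1) (c' + 1) (a' + 2) = n" "dec_cross n (a' + 2) (b' + 1) (c' + 1) (c' + 1) = 1"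
        "dec_cross n (a' + 2) (b' + 1) (c' + 1) 1 = b' + 1" using h' by (auto simp: dec_cross_def)
    have "a + 2 = a' + 2" "c + 1 = c' + 1"
      using permutes_inj[OF permutes_dec_cross[OF h]] v v' e by (metis inj_eq)+
    moreover have "b + 1 = b' + 1" using v(3) v'(3) unfolding e by (rule trans[OF sym])
    ultimately show "s = s'" unfolding s by simp
  qed
  then show "1 \<le> n \<Longrightarrow> card (max_before_min n) = (n - 1) choose 3" by (simp add: max_before_min_eq card_image card_triples)
qed

text \<open>Inversion turns "n before 1" into "last entry below first entry". The other condition, 1
  before n, comes from the classification: a \<open>dec_cross\<close> word has first entry N and
  last entry N + 1.\<close>

lemma min_before_max_desc_eq: "1 \<le> n \<Longrightarrow> {p \<in> shallow_avoiders n. p 1 \<noteq> n \<and> p n \<noteq> 1 \<and> inv p 1 < inv p n \<and> p n < p 1} = inv ` max_before_min n"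
proof (intro equalityI subsetI)
  fix p assume p: "p \<in> {p \<in> shallow_avoiders n. p 1 \<noteq> n \<and> p n \<noteq> 1 \<and> inv p 1 < inv p n \<and> p n < p 1}"
  then have "inv p \<in> max_before_min n"
    unfolding max_before_min_def using inv_in_shallow_avoiders inv_inv_shallow_avoiders shallow_avoiders_inv_eq_iff[of p n] by auto
  then show "p \<in> inv ` max_before_min n" using p inv_inv_shallow_avoiders by (intro image_eqI[of _ _ "inv p"]) auto
next
  fix p assume n: "1 \<le> n" and "p \<in> inv ` max_before_min n"
  then obtain q where q: "q \<in> max_before_min n" "p = inv q" by auto
  have qT: "q \<in> shallow_avoiders n" using q unfolding max_before_min_def by auto
  obtain P N Q where h: "2 \<le> P" "P \<le> N" "N < Q" "Q < n" "q = dec_cross n P N Q" using q(1) n by (rule max_before_min_cases)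
  have "q 1 < q n" using h by (auto simp: dec_cross_def)
  then show "p \<in> {p \<in> shallow_avoiders n. p 1 \<noteq> n \<and> p n \<noteq> 1 \<and> inv p 1 < inv p n \<and> p n < p 1}"
    using q inv_in_shallow_avoiders[OF qT] inv_inv_shallow_avoiders[OF qT] shallow_avoiders_inv_eq_iff[OF qT] unfolding max_before_min_def by auto
qed

lemma min_before_max_asc_eq: "1 \<le> n \<Longrightarrow> {p \<in> shallow_avoiders n. p 1 \<noteq> n \<and> p n \<noteq> 1 \<and> inv p 1 < inv p n \<and> p 1 < p n} = dec_sum n ` {1..<n}"
proof (intro equalityI subsetI)
  fix p assume n: "1 \<le> n" and "p \<in> {p \<in> shallow_avoiders n. p 1 \<noteq> n \<and> p n \<noteq> 1 \<and> inv p 1 < inv p n \<and> p 1 < p n}"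
  then have p: "p permutes {1..n}" "avoids_123 n p" "inv p 1 < inv p n" "p 1 < p n" unfolding shallow_avoiders_def by auto
  have "p (inv p n) = n" "p (inv p 1) = 1" using permutes_inverses[OF p(1)] by auto
  note d = dec_sum_classify[OF p(1-3) this n p(4)]
  from d have r: "1 \<le> inv p 1" "inv p 1 < n" by (blast, blast)
  then have "inv p 1 \<in> {1..<n}" by simp
  moreover from d have "p = dec_sum n (inv p 1)" by blast
  ultimately show "p \<in> dec_sum n ` {1..<n}" by (rule image_eqI[rotated])
next
  fix p assume "p \<in> dec_sum n ` {1..<n}"
  then obtain r where r: "1 \<le> r" "r < n" "p = dec_sum n r" by auto
  note P = permutes_dec_sum[OF r(1,2)]
  have "avoids_123 n p"
    unfolding avoids_123_def r(3)
  proof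
    assume "\<exists>i j k. 1 \<le> i \<and> i < j \<and> j < k \<and> k \<le> n \<and> dec_sum n r i < dec_sum n r j \<and> dec_sum n r j < dec_sum n r k"
    then obtain i j k where *: "1 \<le> i" "i < j" "j < k" "k \<le> n" "dec_sum n r i < dec_sum n r j" "dec_sum n r j < dec_sum n r k" by blast
    then show False using dec_sum_less_iff[OF r(1,2), of i j] dec_sum_less_iff[OF r(1,2), of j k] by auto
  qed
  moreover have "dec_sum n r r = 1" "dec_sum n r (Suc r) = n" "dec_sum n r 1 = r" "dec_sum n r n = Suc r"
    using r by (auto simp: dec_sum_def)
  moreover from this have "inv (dec_sum n r) 1 = r" "inv (dec_sum n r) n = Suc r" using permutes_inv_eq[OF P] by auto
  ultimately show "p \<in> {p \<in> shallow_avoiders n. p 1 \<noteq> n \<and> p n \<noteq> 1 \<and> inv p 1 < inv p n \<and> p 1 < p n}"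
    unfolding shallow_avoiders_def using r P shallow_dec_sum[OF r(1,2)] by auto
qed

lemma card_dec_sum: "card (dec_sum n ` {1..<n}) = n - 1"
proof -
  have "inj_on (dec_sum n) {1..<n}"
  proof (rule inj_onI)
    fix r r' assume "r \<in> {1..<n}" "r' \<in> {1..<n}" "dec_sum n r = dec_sum n r'"
    moreover have "dec_sum n s 1 = s" if "s \<in> {1..<n}" for s using that by (auto simp: dec_sum_def)
    ultimately show "r = r'" by metis
  qed
  then show ?thesis by (simp add: card_image)
qed

text \<open>If n precedes 1 the words are those of \<open>dec_cross\<close>; if 1 precedes n and the
  word starts higher than it ends, they are their inverses; the remaining ones are the sums of two
  decreasing blocks.\<close>

lemma card_interior:
  assumes n: "2 \<le> n"
  shows "card {p \<in> shallow_avoiders n. p 1 \<noteq> n \<and> p n \<noteq> 1} = (n - 1) + 2 * ((n - 1) choose 3)"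
proof -
  let ?A = "{p \<in> shallow_avoiders n. p 1 \<noteq> n \<and> p n \<noteq> 1 \<and> inv p 1 < inv p n \<and> p n < p 1}"
  let ?D = "{p \<in> shallow_avoiders n. p 1 \<noteq> n \<and> p n \<noteq> 1 \<and> inv p 1 < inv p n \<and> p 1 < p n}"
  have "inv p 1 \<noteq> inv p n \<and> p 1 \<noteq> p n" if "p \<in> shallow_avoiders n" for p
  proof -
    have p: "p permutes {1..n}" using that unfolding shallow_avoiders_def by auto
    show ?thesis using permutes_inj[OF p] permutes_inj[OF permutes_inv[OF p]] n
      by (metis inj_eq not_less_eq_eq numeral_2_eq_2 order_refl One_nat_def)
  qed
  then have "{p \<in> shallow_avoiders n. p 1 \<noteq> n \<and> p n \<noteq> 1} = max_before_min n \<union> (?A \<union> ?D)"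
    unfolding max_before_min_def by (auto simp: not_less order.order_iff_strict) (metis linorder_neqE_nat)+
  moreover have "card (max_before_min n \<union> (?A \<union> ?D)) = card (max_before_min n) + (card ?A + card ?D)"
  proof -
    have f: "finite (max_before_min n)" "finite ?A" "finite ?D" using finite_shallow_avoiders[of n] unfolding max_before_min_def by auto
    have "?A \<inter> ?D = {}" "max_before_min n \<inter> (?A \<union> ?D) = {}" unfolding max_before_min_def by auto
    then show ?thesis using f by (simp add: card_Un_disjoint)
  qed
  moreover have "card ?A = card (max_before_min n)"
    using n by (subst min_before_max_desc_eq) (auto intro!: card_inv_image[of _ n] simp: max_before_min_def)
  moreover have "card ?D = n - 1" using min_before_max_asc_eq[of n] card_dec_sum[of n] n by simp
  ultimately show ?thesis using card_max_before_min[of n] n by (simp, linarith)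
qed

subsection \<open>Removing the extreme entries\<close>

lemma up_inject: "up p = up q \<Longrightarrow> p = q"
proof
  fix x assume "up p = up q"
  then have "up p (Suc x) = up q (Suc x)" by (rule fun_cong)
  then show "p x = q x" by simp
qed

lemma up_surj:
  assumes s: "s permutes {1..Suc (Suc m)}" and "s 1 = 1" "s (Suc (Suc m)) = Suc (Suc m)"
  obtains p where "p permutes {1..m}" "up p = s"
proof -
  define p where "p x = s (Suc x) - 1" for x
  have s0: "s 0 = 0" using permutes_not_in[OF s, of 0] by simp
  have "up p x = s x" for x
  proof (cases x)
    case (Suc y)
    have "s (Suc y) \<noteq> 0" using s0 permutes_inj[OF s] by (metis inj_eq nat.simps(3))
    then show ?thesis unfolding Suc p_def up.simps by simp
  qed (simp add: s0)
  then have up: "up p = s" by (rule ext)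
  have "s permutes {Suc 1..Suc m}"
    by (rule permutes_drop_bot[OF permutes_drop_top[OF s assms(3)] assms(2)])
  then have "up p permutes Suc ` {1..m}" unfolding up by (simp add: image_Suc_atLeastAtMost)
  then show thesis using that up permutes_up_iff by blast
qed

lemma permutes_up2:
  assumes "p permutes {1..m}"
  shows "up p permutes {1..Suc (Suc m)}" "up p 1 = 1" "up p (Suc (Suc m)) = Suc (Suc m)"
proof -
  show "up p permutes {1..Suc (Suc m)}" by (rule permutes_subset[OF permutes_up[OF assms]]) auto
  show "up p 1 = 1" using permutes_not_in[OF assms, of 0] by simp
  show "up p (Suc (Suc m)) = Suc (Suc m)" using permutes_not_in[OF assms, of "Suc m"] by simp
qed

text \<open>The skew sum of a point, \<open>p\<close> and a point.\<close>

definition outer :: "nat \<Rightarrow> (nat \<Rightarrow> nat) \<Rightarrow> nat \<Rightarrow> nat" where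
  "outer m p = up p \<circ> transpose 1 (Suc (Suc m))"

lemma outer_apply:
  assumes "p permutes {1..m}"
  shows "outer m p 1 = Suc (Suc m)" "outer m p (Suc (Suc m)) = 1"
    "1 \<le> x \<Longrightarrow> x \<le> m \<Longrightarrow> outer m p (Suc x) = Suc (p x)"
  unfolding outer_def using permutes_up2(2,3)[OF assms] by (auto simp: transpose_def)

lemma permutes_outer: "p permutes {1..m} \<Longrightarrow> outer m p permutes {1..Suc (Suc m)}"
  unfolding outer_def by (rule permutes_comp_transpose[OF permutes_up2(1)]) auto

lemma shallow_outer:
  assumes p: "p permutes {1..m}"
  shows "shallow (Suc (Suc m)) (outer m p) \<longleftrightarrow> shallow m p"
proof -
  note o = permutes_outer[OF p]
  have "defect {1..Suc (Suc m)} (outer m p) = defect {1..Suc (Suc m)} (outer m p \<circ> transpose 1 (Suc (Suc m)))"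
    by (rule defect_swap_ends[OF o]) (use outer_apply[OF p] in auto)
  also have "outer m p \<circ> transpose 1 (Suc (Suc m)) = up p"
    unfolding outer_def by (rule comp_transpose_twice)
  also have "defect {1..Suc (Suc m)} (up p) = defect {1..Suc m} (up p)"
    by (rule defect_drop_top[OF permutes_up2(1,3)[OF p]])
  also have "\<dots> = defect {1..m} p" by (rule defect_up_Suc[OF p])
  finally show ?thesis using shallow_iff_defect[OF p] shallow_iff_defect[OF o] by simp
qed

lemma avoids_outer:
  assumes p: "p permutes {1..m}"
  shows "avoids_123 (Suc (Suc m)) (outer m p) \<longleftrightarrow> avoids_123 m p"
proof -
  let ?o = "outer m p"
  note v = outer_apply[OF p]
  have rng: "1 \<le> ?o x \<and> ?o x \<le> Suc (Suc m)" if "1 \<le> x" "x \<le> Suc (Suc m)" for x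
    using permutes_in_image[OF permutes_outer[OF p], of x] that by auto
  have "(\<exists>i j k. 1 \<le> i \<and> i < j \<and> j < k \<and> k \<le> Suc (Suc m) \<and> ?o i < ?o j \<and> ?o j < ?o k)
    \<longleftrightarrow> (\<exists>i j k. 1 \<le> i \<and> i < j \<and> j < k \<and> k \<le> m \<and> p i < p j \<and> p j < p k)"
  proof (intro iffI; elim exE conjE)
    fix i j k assume *: "1 \<le> i" "i < j" "j < k" "k \<le> m" "p i < p j" "p j < p k"
    then show "\<exists>i j k. 1 \<le> i \<and> i < j \<and> j < k \<and> k \<le> Suc (Suc m) \<and> ?o i < ?o j \<and> ?o j < ?o k"
      using v(3)[of i] v(3)[of j] v(3)[of k]
      by (intro exI[of _ "Suc i"] exI[of _ "Suc j"] exI[of _ "Suc k"]) auto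
  next
    fix i j k assume *: "1 \<le> i" "i < j" "j < k" "k \<le> Suc (Suc m)" "?o i < ?o j" "?o j < ?o k"
    have "i \<noteq> 1" using * v(1) rng[of j] by auto
    moreover have "k \<noteq> Suc (Suc m)" using * v(2) by auto
    ultimately have "Suc (i - 1) = i" "Suc (j - 1) = j" "Suc (k - 1) = k" "1 \<le> i - 1" "k - 1 \<le> m" using * by auto
    then show "\<exists>i j k. 1 \<le> i \<and> i < j \<and> j < k \<and> k \<le> m \<and> p i < p j \<and> p j < p k"
      using v(3)[of "i - 1"] v(3)[of "j - 1"] v(3)[of "k - 1"] *
      by (intro exI[of _ "i - 1"] exI[of _ "j - 1"] exI[of _ "k - 1"]) auto
  qed
  then show ?thesis unfolding avoids_123_def by blast
qed

lemma card_both_ends: "card {p \<in> shallow_avoiders (Suc (Suc m)). p 1 = Suc (Suc m) \<and> p (Suc (Suc m)) = 1} = card (shallow_avoiders m)"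
proof -
  have "{p \<in> shallow_avoiders (Suc (Suc m)). p 1 = Suc (Suc m) \<and> p (Suc (Suc m)) = 1} = outer m ` shallow_avoiders m"
  proof (intro equalityI subsetI)
    fix p assume "p \<in> {p \<in> shallow_avoiders (Suc (Suc m)). p 1 = Suc (Suc m) \<and> p (Suc (Suc m)) = 1}"
    then have p: "p permutes {1..Suc (Suc m)}" "p 1 = Suc (Suc m)" "p (Suc (Suc m)) = 1" "p \<in> shallow_avoiders (Suc (Suc m))"
      unfolding shallow_avoiders_def by auto
    let ?s = "p \<circ> transpose 1 (Suc (Suc m))"
    have "?s permutes {1..Suc (Suc m)}" by (rule permutes_comp_transpose[OF p(1)]) auto
    then obtain q where q: "q permutes {1..m}" "up q = ?s"
      by (rule up_surj) (use p in simp_all)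
    have "p = outer m q" unfolding outer_def q(2) comp_transpose_twice ..
    then show "p \<in> outer m ` shallow_avoiders m"
      using p(4) shallow_outer[OF q(1)] avoids_outer[OF q(1)] q(1) unfolding shallow_avoiders_def by blast
  next
    fix p assume "p \<in> outer m ` shallow_avoiders m"
    then obtain q where q: "q permutes {1..m}" "q \<in> shallow_avoiders m" "p = outer m q" unfolding shallow_avoiders_def by blast
    then show "p \<in> {p \<in> shallow_avoiders (Suc (Suc m)). p 1 = Suc (Suc m) \<and> p (Suc (Suc m)) = 1}"
      using shallow_outer[OF q(1)] avoids_outer[OF q(1)] outer_apply(1,2)[OF q(1)] permutes_outer[OF q(1)]
      unfolding shallow_avoiders_def by blast
  qed
  moreover have "inj_on (outer m) (shallow_avoiders m)"
  proof (rule inj_onI)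
    fix p q assume "outer m p = outer m q"
    then have "up p = up q" unfolding outer_def by (metis comp_transpose_twice)
    then show "p = q" by (rule up_inject)
  qed
  ultimately show ?thesis by (simp add: card_image)
qed

text \<open>The word of \<open>p\<close> raised by one, with its \<open>k\<close>-th entry moved to
  the end and replaced by 1, and with \<open>m + 2\<close> put in front; this undoes the stripping
  that motivates \<open>slot\<close>.\<close>

definition insert_slot :: "nat \<Rightarrow> nat \<Rightarrow> (nat \<Rightarrow> nat) \<Rightarrow> nat \<Rightarrow> nat" where
  "insert_slot m k p = up p \<circ> transpose 1 (Suc k) \<circ> transpose 1 (Suc (Suc m))"

definition slots :: "nat \<Rightarrow> (nat \<times> (nat \<Rightarrow> nat)) set" where
  "slots m = {(k, p). 1 \<le> k \<and> k \<le> m \<and> p permutes {1..m} \<and> shallow m p \<and> slot m k p}"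

lemma insert_slot_apply:
  assumes p: "p permutes {1..m}" and k: "1 \<le> k" "k \<le> m"
  shows "insert_slot m k p 1 = Suc (Suc m)" "insert_slot m k p (Suc k) = 1"
    "insert_slot m k p (Suc (Suc m)) = Suc (p k)"
    "1 \<le> x \<Longrightarrow> x \<le> m \<Longrightarrow> x \<noteq> k \<Longrightarrow> insert_slot m k p (Suc x) = Suc (p x)"
  unfolding insert_slot_def using permutes_up2(2,3)[OF p] k by (auto simp: transpose_def)

lemma permutes_insert_slot:
  assumes p: "p permutes {1..m}" and k: "1 \<le> k" "k \<le> m"
  shows "insert_slot m k p permutes {1..Suc (Suc m)}"
  unfolding insert_slot_def
  by (intro permutes_comp_transpose permutes_up2(1)[OF p]) (use k in auto)

lemma shallow_insert_slot:
  assumes p: "p permutes {1..m}" and k: "1 \<le> k" "k \<le> m" and s: "slot m k p"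
  shows "shallow (Suc (Suc m)) (insert_slot m k p) \<longleftrightarrow> shallow m p"
proof -
  note o = permutes_insert_slot[OF p k]
  let ?t = "up p \<circ> transpose 1 (Suc k)"
  have above: "k < i \<Longrightarrow> i \<le> m \<Longrightarrow> p k < p i" for i using s unfolding slot_def by blast
  have t: "?t permutes {1..Suc (Suc m)}" "?t (Suc (Suc m)) = Suc (Suc m)"
    using permutes_comp_transpose[OF permutes_up2(1)[OF p], of 1 "Suc k"] permutes_up2(3)[OF p] k
    by (auto simp: transpose_def)
  have "defect {1..Suc (Suc m)} (insert_slot m k p)
      = defect {1..Suc (Suc m)} (insert_slot m k p \<circ> transpose 1 (Suc (Suc m)))"
    by (rule defect_swap_ends[OF o]) (use insert_slot_apply[OF p k] in auto)
  also have "insert_slot m k p \<circ> transpose 1 (Suc (Suc m)) = ?t"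
    unfolding insert_slot_def by (rule comp_transpose_twice)
  also have "defect {1..Suc (Suc m)} ?t = defect {1..Suc m} ?t" by (rule defect_drop_top[OF t])
  also have "\<dots> = defect {1..m} p" by (rule defect_extend_left(2)[OF p k above])
  finally show ?thesis using shallow_iff_defect[OF p] shallow_iff_defect[OF o] by simp
qed

text \<open>The four clauses of \<open>slot\<close> forbid the four kinds of 123: using 1 and the
  last entry, only 1, only the last entry, or neither. The leading maximum cannot take part.\<close>

lemma slotI_of_avoids:
  assumes p: "p permutes {1..m}" and k: "1 \<le> k" "k \<le> m"
    and av: "avoids_123 (Suc (Suc m)) (insert_slot m k p)"
  shows "slot m k p"
proof -
  note v = insert_slot_apply[OF p k]
  have pos: "1 \<le> p x" if "1 \<le> x" "x \<le> m" for x using permutes_in_image[OF p, of x] that by auto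
  have inj: "p x = p y \<longleftrightarrow> x = y" for x y using permutes_inj[OF p] by (simp add: inj_eq)
  have no: False if "1 \<le> i" "i < j" "j < l" "l \<le> Suc (Suc m)"
      "insert_slot m k p i < insert_slot m k p j" "insert_slot m k p j < insert_slot m k p l" for i j l
    using av that unfolding avoids_123_def by blast
  show ?thesis
    unfolding slot_def
  proof (intro conjI allI impI; (elim conjE)?)
    fix i assume i: "k < i" "i \<le> m"
    show "p k < p i"
    proof (rule ccontr)
      assume "\<not> ?thesis"
      then have "p i < p k" using inj[of i k] i by auto
      then show False using no[of "Suc k" "Suc i" "Suc (Suc m)"] i k v(2,3) v(4)[of i] pos[of i] by auto
    qed
  next
    fix i j assume i: "k < i" "i < j" "j \<le> m"
    show "p j < p i"
    proof (rule ccontr)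
      assume "\<not> ?thesis"
      then have "p i < p j" using inj[of i j] i by auto
      then show False using no[of "Suc k" "Suc i" "Suc j"] i k v(2) v(4)[of i] v(4)[of j] pos[of i] by auto
    qed
  next
    fix i j assume i: "1 \<le> i" "i < j" "j < k" "p i < p k" "p j < p k"
    show "p j < p i"
    proof (rule ccontr)
      assume "\<not> ?thesis"
      then have "p i < p j" using inj[of i j] i by auto
      then show False using no[of "Suc i" "Suc j" "Suc (Suc m)"] i k v(3) v(4)[of i] v(4)[of j] by auto
    qed
  next
    fix i j l assume i: "1 \<le> i" "i < j" "j < l" "l \<le> m" "k \<noteq> i" "k \<noteq> j" "k \<noteq> l"
    show "\<not> (p i < p j \<and> p j < p l)"
      using no[of "Suc i" "Suc j" "Suc l"] i v(4)[of i] v(4)[of j] v(4)[of l] by auto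
  qed
qed

lemma avoids_insert_slot:
  assumes p: "p permutes {1..m}" and k: "1 \<le> k" "k \<le> m" and s: "slot m k p"
  shows "avoids_123 (Suc (Suc m)) (insert_slot m k p)"
proof (unfold avoids_123_def, rule notI, elim exE conjE)
  let ?o = "insert_slot m k p"
  note v = insert_slot_apply[OF p k]
  have rng: "1 \<le> ?o x \<and> ?o x \<le> Suc (Suc m)" if "1 \<le> x" "x \<le> Suc (Suc m)" for x
    using permutes_in_image[OF permutes_insert_slot[OF p k], of x] that by auto
  fix i j l assume *: "1 \<le> i" "i < j" "j < l" "l \<le> Suc (Suc m)" "?o i < ?o j" "?o j < ?o l"
  have above: "k < i \<Longrightarrow> i \<le> m \<Longrightarrow> p k < p i" for i using s unfolding slot_def by blast
  have decr: "k < i \<Longrightarrow> i < j \<Longrightarrow> j \<le> m \<Longrightarrow> p j < p i" for i j using s unfolding slot_def by blast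
  have small: "1 \<le> i \<Longrightarrow> i < j \<Longrightarrow> j < k \<Longrightarrow> p i < p k \<Longrightarrow> p j < p k \<Longrightarrow> p j < p i" for i j
    using s unfolding slot_def by blast
  have no: "1 \<le> i \<Longrightarrow> i < j \<Longrightarrow> j < l \<Longrightarrow> l \<le> m \<Longrightarrow> k \<noteq> i \<Longrightarrow> k \<noteq> j \<Longrightarrow> k \<noteq> l \<Longrightarrow> \<not> (p i < p j \<and> p j < p l)" for i j l
    using s unfolding slot_def by blast
  have "i \<noteq> 1" using * v(1) rng[of j] by auto
  then obtain i' j' l' where e: "i = Suc i'" "j = Suc j'" "l = Suc l'" "1 \<le> i'" "i' < j'" "j' < l'" "l' \<le> Suc m"
    using * by (cases i; cases j; cases l) auto
  have jk: "j' \<noteq> k" using * v(2) rng[of i] e by auto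
  have lk: "l' \<noteq> k" using * v(2) rng[of j] e by auto
  have oj: "?o j = Suc (p j')" using v(4)[of j'] jk e by auto
  show False
  proof (cases "l' = Suc m")
    case True
    then have jp: "p j' < p k" using * v(3) oj e by auto
    then have j'k: "j' < k" using above[of j'] jk e True by (cases j' k rule: linorder_cases) auto
    have "?o i = Suc (p i')" using v(4)[of i'] j'k e True by auto
    then have "p i' < p j'" using * oj by simp
    then show False using small[of i' j'] jp j'k e by auto
  next
    case False
    then have l: "l' \<le> m" using e by simp
    have "?o l = Suc (p l')" using v(4)[of l'] lk e l by auto
    then have jl: "p j' < p l'" using * oj by simp
    show False
    proof (cases "i' = k")
      case True
      then show False using decr[of j' l'] jl e l by auto
    next
      case False
      have "?o i = Suc (p i')" using v(4)[of i'] False e l by auto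
      then have "p i' < p j'" using * oj by simp
      then show False using no[of i' j' l'] jl False jk lk e l by auto
    qed
  qed
qed

lemma card_first_end:
  "card {p \<in> shallow_avoiders (Suc (Suc m)). p 1 = Suc (Suc m) \<and> p (Suc (Suc m)) \<noteq> 1} = card (slots m)"
proof -
  let ?n = "Suc (Suc m)"
  have "{p \<in> shallow_avoiders ?n. p 1 = ?n \<and> p ?n \<noteq> 1} = (\<lambda>(k, p). insert_slot m k p) ` slots m"
  proof (intro equalityI subsetI)
    fix p assume "p \<in> {p \<in> shallow_avoiders ?n. p 1 = ?n \<and> p ?n \<noteq> 1}"
    then have p: "p permutes {1..?n}" "p 1 = ?n" "p ?n \<noteq> 1" "p \<in> shallow_avoiders ?n" unfolding shallow_avoiders_def by auto
    define q where "q = inv p 1"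
    have pq: "p q = 1" unfolding q_def using permutes_inverses[OF p(1)] by simp
    have "q \<in> {1..?n}" using permutes_in_image[OF p(1), of q] pq by simp
    then have q: "2 \<le> q" "q \<le> Suc m" using pq p(2,3) by (cases "q = 1"; cases "q = ?n"; auto)+
    let ?s = "p \<circ> transpose 1 ?n \<circ> transpose 1 q"
    have "?s permutes {1..?n}"
      by (intro permutes_comp_transpose p(1)) (use q in auto)
    moreover have "?s 1 = 1" "?s ?n = ?n" using q pq p(2) by (auto simp: transpose_def)
    ultimately obtain r where r: "r permutes {1..m}" "up r = ?s" by (rule up_surj)
    have k: "1 \<le> q - 1" "q - 1 \<le> m" "Suc (q - 1) = q" using q by auto
    have e: "p = insert_slot m (q - 1) r"
      unfolding insert_slot_def r(2) k(3) comp_transpose_twice ..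
    have av: "avoids_123 ?n p" "shallow ?n p" using p(4) unfolding shallow_avoiders_def by auto
    have s: "slot m (q - 1) r" by (rule slotI_of_avoids[OF r(1) k(1,2)]) (use av(1) in \<open>simp only: e[symmetric]\<close>)
    have "shallow m r" using shallow_insert_slot[OF r(1) k(1,2) s] av(2) unfolding e[symmetric] by simp
    then have "(q - 1, r) \<in> slots m" unfolding slots_def using k r s by simp
    then show "p \<in> (\<lambda>(k, p). insert_slot m k p) ` slots m"
      by (rule image_eqI[rotated]) (simp only: prod.case e[symmetric])
  next
    fix p assume "p \<in> (\<lambda>(k, p). insert_slot m k p) ` slots m"
    then obtain k r where r: "p = insert_slot m k r" "1 \<le> k" "k \<le> m" "r permutes {1..m}" "shallow m r" "slot m k r"
      unfolding slots_def by auto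
    note v = insert_slot_apply[OF r(4,2,3)]
    have "p ?n \<noteq> 1" using v(3) r permutes_in_image[OF r(4), of k] by auto
    then show "p \<in> {p \<in> shallow_avoiders ?n. p 1 = ?n \<and> p ?n \<noteq> 1}"
      unfolding shallow_avoiders_def
      using r v(1) permutes_insert_slot[OF r(4,2,3)] shallow_insert_slot[OF r(4,2,3,6)]
        avoids_insert_slot[OF r(4,2,3,6)] by simp
  qed
  moreover have "inj_on (\<lambda>(k, p). insert_slot m k p) (slots m)"
  proof (rule inj_onI)
    fix x y assume xy: "x \<in> slots m" "y \<in> slots m"
      and e: "(\<lambda>(k, p). insert_slot m k p) x = (\<lambda>(k, p). insert_slot m k p) y"
    obtain k p where x: "x = (k, p)" by (cases x)
    obtain k' p' where y: "y = (k', p')" by (cases y)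
    have h: "1 \<le> k" "k \<le> m" "p permutes {1..m}" "1 \<le> k'" "k' \<le> m" "p' permutes {1..m}"
      using xy unfolding x y slots_def by auto
    have e': "insert_slot m k p = insert_slot m k' p'" using e unfolding x y by (simp only: prod.case)
    have "insert_slot m k p (Suc k) = insert_slot m k p (Suc k')"
      using insert_slot_apply(2)[OF h(3,1,2)] insert_slot_apply(2)[OF h(6,4,5)] unfolding e' by simp
    then have kk: "k = k'" using permutes_inj[OF permutes_insert_slot[OF h(3,1,2)]] by (simp add: inj_eq)
    have "up p = up p'" using e' unfolding insert_slot_def kk by (metis comp_transpose_twice)
    then show "x = y" unfolding x y kk by (simp add: up_inject)
  qed
  ultimately show ?thesis by (simp add: card_image)
qed

subsection \<open>Counting slots\<close>

lemma finite_slots: "finite (slots m)"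
  by (rule finite_subset[OF _ finite_cartesian_product[of "{..m}" "{p. p permutes {1..m}}"]])
    (auto simp: slots_def finite_permutations)

text \<open>A 123 through the position of 1 must start there, and this is what the second clause of
  \<open>slot\<close> forbids.\<close>

lemma slot_one_iff:
  assumes p: "p permutes {1..m}" and k: "1 \<le> k" "k \<le> m" "p k = 1"
  shows "slot m k p \<longleftrightarrow> avoids_123 m p"
proof
  have inj: "p x = p y \<longleftrightarrow> x = y" for x y using permutes_inj[OF p] by (simp add: inj_eq)
  have pos: "1 \<le> p x" if "1 \<le> x" "x \<le> m" for x using permutes_in_image[OF p, of x] that by auto
  assume s: "slot m k p"
  show "avoids_123 m p"
  proof (unfold avoids_123_def, rule notI, elim exE conjE)
    fix i j l assume *: "1 \<le> i" "i < j" "j < l" "l \<le> m" "p i < p j" "p j < p l"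
    have "k \<noteq> j" "k \<noteq> l" using * pos[of i] k(3) by auto
    moreover have "k \<noteq> i"
    proof
      assume "k = i"
      then have "p l < p j" using s * unfolding slot_def by blast
      then show False using * by simp
    qed
    ultimately show False using s * unfolding slot_def by blast
  qed
next
  have pos: "1 \<le> p x" if "1 \<le> x" "x \<le> m" for x using permutes_in_image[OF p, of x] that by auto
  have inj: "p x = p y \<longleftrightarrow> x = y" for x y using permutes_inj[OF p] by (simp add: inj_eq)
  assume av: "avoids_123 m p"
  have a: "p k < p i" if "k < i" "i \<le> m" for i using pos[of i] inj[of i k] that k by auto
  show "slot m k p"
    unfolding slot_def
  proof (intro conjI allI impI; (elim conjE)?)
    fix i j assume "k < i" "i < j" "j \<le> m"
    then show "p j < p i" using avoids_123D[OF p av, of k i j] a[of i] k by simp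
  next
    fix i j assume "1 \<le> i" "i < j" "j < k" "p i < p k"
    then show "p j < p i" using pos[of i] k by simp
  next
    fix i j l assume "1 \<le> i" "i < j" "j < l" "l \<le> m"
    then show "\<not> (p i < p j \<and> p j < p l)" using av unfolding avoids_123_def by blast
  qed (use a in auto)
qed

text \<open>A 123 through the last position must end there, and this is what the third clause of
  \<open>slot\<close> forbids.\<close>

lemma slot_last_iff:
  assumes p: "p permutes {1..m}"
  shows "slot m m p \<longleftrightarrow> avoids_123 m p"
proof
  assume s: "slot m m p"
  show "avoids_123 m p"
  proof (unfold avoids_123_def, rule notI, elim exE conjE)
    fix i j l assume *: "1 \<le> i" "i < j" "j < l" "l \<le> m" "p i < p j" "p j < p l"
    have "l = m"
    proof (rule ccontr)
      assume "l \<noteq> m"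
      then have "m \<noteq> i" "m \<noteq> j" "m \<noteq> l" using * by auto
      then show False using s * unfolding slot_def by blast
    qed
    moreover have "1 \<le> i \<and> i < j \<and> j < m \<and> p i < p m \<and> p j < p m \<Longrightarrow> p j < p i"
      using s unfolding slot_def by blast
    ultimately show False using * by simp
  qed
next
  assume av: "avoids_123 m p"
  show "slot m m p"
    unfolding slot_def
  proof (intro conjI allI impI; (elim conjE)?)
    fix i j assume *: "1 \<le> i" "i < j" "j < m" "p i < p m" "p j < p m"
    have "p i \<noteq> p j" using permutes_inj[OF p] *(2) by (metis inj_eq less_irrefl)
    moreover have "\<not> p i < p j" using av * unfolding avoids_123_def by blast
    ultimately show "p j < p i" by simp
  next
    fix i j l assume "1 \<le> i" "i < j" "j < l" "l \<le> m"
    then show "\<not> (p i < p j \<and> p j < p l)" using av unfolding avoids_123_def by blast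
  qed auto
qed

lemma card_slots_one:
  assumes m: "1 \<le> m"
  shows "card {(k, p) \<in> slots m. p k = 1} = card (shallow_avoiders m)"
proof -
  have im: "snd ` {(k, p) \<in> slots m. p k = 1} = shallow_avoiders m"
  proof (intro equalityI subsetI)
    fix p assume "p \<in> snd ` {(k, p) \<in> slots m. p k = 1}"
    then obtain k where k: "1 \<le> k" "k \<le> m" "p permutes {1..m}" "shallow m p" "slot m k p" "p k = 1"
      unfolding slots_def by auto
    then show "p \<in> shallow_avoiders m" unfolding shallow_avoiders_def using slot_one_iff[OF k(3,1,2,6)] by simp
  next
    fix p assume "p \<in> shallow_avoiders m"
    then have p: "p permutes {1..m}" "avoids_123 m p" "shallow m p" unfolding shallow_avoiders_def by auto
    obtain k where k: "1 \<le> k" "k \<le> m" "p k = 1" by (rule permutes_obtain[OF p(1) _ m]) auto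
    then have "(k, p) \<in> {(k, p) \<in> slots m. p k = 1}"
      unfolding slots_def using p slot_one_iff[OF p(1) k] by simp
    then show "p \<in> snd ` {(k, p) \<in> slots m. p k = 1}" by (rule image_eqI[rotated]) simp
  qed
  have inj: "inj_on snd {(k, p) \<in> slots m. p k = 1}"
  proof (rule inj_onI)
    fix x y assume xy: "x \<in> {(k, p) \<in> slots m. p k = 1}" "y \<in> {(k, p) \<in> slots m. p k = 1}" "snd x = snd y"
    obtain k p where x: "x = (k, p)" by (cases x)
    obtain k' where y: "y = (k', p)" using xy x by (cases y) auto
    have "p permutes {1..m}" "p k = p k'" using xy unfolding x y slots_def by auto
    then have "k = k'" using permutes_inj by (metis inj_eq)
    then show "x = y" unfolding x y by simp
  qed
  show ?thesis using card_image[OF inj] unfolding im by (rule sym)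
qed

lemma card_slots_last:
  assumes m: "1 \<le> m"
  shows "card {(k, p) \<in> slots m. p k \<noteq> 1 \<and> k = m} = card {p \<in> shallow_avoiders m. p m \<noteq> 1}"
proof -
  have "{(k, p) \<in> slots m. p k \<noteq> 1 \<and> k = m} = Pair m ` {p \<in> shallow_avoiders m. p m \<noteq> 1}"
    unfolding slots_def shallow_avoiders_def using slot_last_iff m by auto
  then show ?thesis by (simp add: card_image inj_on_def)
qed

text \<open>With an explicit ascent relation \<open>R\<close> the slot conditions of a family become
  linear arithmetic on positions.\<close>

lemma slot_of_less_iff:
  assumes p: "p permutes {1..m}" and k: "1 \<le> k" "k \<le> m"
    and R: "\<And>i j. 1 \<le> i \<Longrightarrow> i < j \<Longrightarrow> j \<le> m \<Longrightarrow> p i < p j \<longleftrightarrow> R i j"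
    and s: "\<And>i. k < i \<Longrightarrow> i \<le> m \<Longrightarrow> R k i"
      "\<And>i j. k < i \<Longrightarrow> i < j \<Longrightarrow> j \<le> m \<Longrightarrow> \<not> R i j"
      "\<And>i j. 1 \<le> i \<Longrightarrow> i < j \<Longrightarrow> j < k \<Longrightarrow> R i k \<Longrightarrow> R j k \<Longrightarrow> \<not> R i j"
      "\<And>i j l. 1 \<le> i \<Longrightarrow> i < j \<Longrightarrow> j < l \<Longrightarrow> l \<le> m \<Longrightarrow> k \<noteq> i \<Longrightarrow> k \<noteq> j \<Longrightarrow> k \<noteq> l \<Longrightarrow> \<not> (R i j \<and> R j l)"
  shows "slot m k p"
proof -
  have lt: "p j < p i" if "\<not> R i j" "1 \<le> i" "i < j" "j \<le> m" for i j
  proof -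
    have "p i \<noteq> p j" using permutes_inj[OF p] that(3) by (metis inj_eq less_irrefl)
    then show ?thesis using R[OF that(2-4)] that(1) by simp
  qed
  show ?thesis
    unfolding slot_def
  proof (intro conjI allI impI; (elim conjE)?)
    fix i assume "k < i" "i \<le> m"
    then show "p k < p i" using R[of k i] s(1)[of i] k by simp
  next
    fix i j assume "k < i" "i < j" "j \<le> m"
    then show "p j < p i" using lt[of i j] s(2)[of i j] k by simp
  next
    fix i j assume "1 \<le> i" "i < j" "j < k" "p i < p k" "p j < p k"
    then show "p j < p i" using lt[of i j] s(3)[of i j] R[of i k] R[of j k] k by simp
  next
    fix i j l assume "1 \<le> i" "i < j" "j < l" "l \<le> m" "k \<noteq> i" "k \<noteq> j" "k \<noteq> l"
    then show "\<not> (p i < p j \<and> p j < p l)" using s(4)[of i j l] R[of i j] R[of j l] by simp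
  qed
qed

lemma slot_slot_perm2:
  assumes h: "e < x" "x < k" "k \<le> m"
  shows "slot m k (slot_perm2 m e x k)"
  by (rule slot_of_less_iff[OF permutes_slot_perm2[OF h] _ _ slot_perm2_less_iff[OF h]]) (use h in auto)

lemma slot_slot_perm3:
  assumes h: "2 \<le> r" "r < q" "q < k" "k < m"
  shows "slot m k (slot_perm3 m r q k)"
  by (rule slot_of_less_iff[OF permutes_slot_perm3[OF h] _ _ slot_perm3_less_iff[OF h]]) (use h in auto)

lemma slot_slot_perm1:
  assumes h: "1 \<le> e" "Suc e < k" "k < y" "y < m"
  shows "slot m k (slot_perm1 m e k y)"
  by (rule slot_of_less_iff[OF permutes_slot_perm1[OF h] _ _ slot_perm1_less_iff[OF h]])
    (use h in \<open>auto split: if_splits\<close>)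

text \<open>The word \<open>m G S H v C\<close>, which becomes a word of \<open>slot_perm2\<close> on exchanging \<open>m\<close> with the last entry.\<close>

definition slot_perm4 :: "nat \<Rightarrow> nat \<Rightarrow> nat \<Rightarrow> nat \<Rightarrow> nat \<Rightarrow> nat" where
  "slot_perm4 m e x k = slot_perm2 (m - 1) e x k \<circ> transpose 1 m"

lemma slot_perm4_apply:
  assumes h: "1 \<le> e" "e < x" "x < k" "k < m"
  shows "slot_perm4 m e x k 1 = m" "slot_perm4 m e x k m = Suc x" "slot_perm4 m e x k k = x - e + 1"
  using h by (auto simp: slot_perm4_def slot_perm2_def transpose_def)

lemma slot_perm4_less_iff:
  assumes h: "1 \<le> e" "e < x" "x < k" "k < m" "1 \<le> i" "i < j" "j \<le> m"
  shows "slot_perm4 m e x k i < slot_perm4 m e x k j \<longleftrightarrow> i \<noteq> 1 \<and> ((i \<le> x \<and> x < j \<and> \<not> (i \<le> e \<and> j = k)) \<or> i = k)"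
  using h by (auto simp: slot_perm4_def slot_perm2_def transpose_def)

lemma permutes_slot_perm4:
  assumes h: "1 \<le> e" "e < x" "x < k" "k < m"
  shows "slot_perm4 m e x k permutes {1..m}"
proof -
  have h': "e < x" "x < k" "k \<le> m - 1" using h by auto
  have "slot_perm2 (m - 1) e x k permutes {1..m}" by (rule permutes_subset[OF permutes_slot_perm2[OF h']]) auto
  then show ?thesis unfolding slot_perm4_def by (rule permutes_comp_transpose) (use h in auto)
qed

lemma shallow_slot_perm4:
  assumes h: "1 \<le> e" "e < x" "x < k" "k < m"
  shows "shallow m (slot_perm4 m e x k)"
proof -
  have h': "e < x" "x < k" "k \<le> m - 1" using h by auto
  obtain m' where m': "m = Suc m'" using h by (cases m) auto
  note p' = permutes_slot_perm2[OF h']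
  have p: "slot_perm2 (m - 1) e x k permutes {1..Suc m'}" by (rule permutes_subset[OF p']) (use m' in auto)
  have top: "slot_perm2 (m - 1) e x k (Suc m') = Suc m'" using m' by (simp add: slot_perm2_def)
  have "defect {1..m} (slot_perm4 m e x k) = defect {1..m} (slot_perm4 m e x k \<circ> transpose 1 m)"
    by (rule defect_swap_ends[OF permutes_slot_perm4[OF h]]) (use h slot_perm4_apply[OF h] in auto)
  also have "slot_perm4 m e x k \<circ> transpose 1 m = slot_perm2 (m - 1) e x k" unfolding slot_perm4_def by (rule comp_transpose_twice)
  also have "defect {1..m} (slot_perm2 (m - 1) e x k) = defect {1..m - 1} (slot_perm2 (m - 1) e x k)"
    using defect_drop_top[OF p top] unfolding m' by simp
  also have "\<dots> = 0" using shallow_slot_perm2[OF h'] shallow_iff_defect[OF p'] by simp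
  finally show ?thesis using shallow_iff_defect[OF permutes_slot_perm4[OF h]] by simp
qed

lemma slot_slot_perm4:
  assumes h: "1 \<le> e" "e < x" "x < k" "k < m"
  shows "slot m k (slot_perm4 m e x k)"
  by (rule slot_of_less_iff[OF permutes_slot_perm4[OF h] _ _ slot_perm4_less_iff[OF h]]) (use h in auto)

section \<open>Inner slots: the four families and their sizes\<close>

definition inner_slots :: "nat \<Rightarrow> (nat \<times> (nat \<Rightarrow> nat)) set" where
  "inner_slots m = {(k, p) \<in> slots m. p k \<noteq> 1 \<and> k < m}"

lemma inner_slots_iff:
  "(k, p) \<in> inner_slots m \<longleftrightarrow> 1 \<le> k \<and> k < m \<and> p permutes {1..m} \<and> shallow m p \<and> slot m k p \<and> p k \<noteq> 1"
  unfolding inner_slots_def slots_def by auto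

lemma slotted_of_inner_slots:
  assumes "(k, p) \<in> inner_slots m"
  shows "slotted m k p" "p (inv p 1) = 1" "p (inv p m) = m"
proof -
  have h: "1 \<le> k" "k < m" "p permutes {1..m}" "shallow m p" "slot m k p" "p k \<noteq> 1"
    using assms unfolding inner_slots_iff by auto
  have "1 \<le> p k" using permutes_in_image[OF h(3), of k] h by simp
  then show "slotted m k p" using h by unfold_locales auto
  show "p (inv p 1) = 1" "p (inv p m) = m" using permutes_inverses[OF h(3)] by auto
qed

lemma inner_slots_slot_perm2:
  "{(k, p) \<in> inner_slots m. p 1 \<noteq> m \<and> p 1 < p m \<and> inv p 1 < inv p m} = (\<lambda>(a, b, c). (c, slot_perm2 m a b c)) ` triples m"
proof (intro equalityI subsetI)
  fix z assume "z \<in> {(k, p) \<in> inner_slots m. p 1 \<noteq> m \<and> p 1 < p m \<and> inv p 1 < inv p m}"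
  then obtain k p where z: "z = (k, p)" "(k, p) \<in> inner_slots m" "p 1 \<noteq> m" "p 1 < p m" "inv p 1 < inv p m" by auto
  note s = slotted_of_inner_slots[OF z(2)]
  obtain e x where h: "e < x" "x < k" "p = slot_perm2 m e x k"
    using slotted.classify_slot_perm2[OF s z(5,3,4)] by blast
  then have "(e, x, k) \<in> triples m" using z(2) unfolding triples_def inner_slots_iff by auto
  then show "z \<in> (\<lambda>(a, b, c). (c, slot_perm2 m a b c)) ` triples m"
    by (rule image_eqI[rotated]) (simp only: prod.case z(1) h(3))
next
  fix z assume "z \<in> (\<lambda>(a, b, c). (c, slot_perm2 m a b c)) ` triples m"
  then obtain e x k where z: "z = (k, slot_perm2 m e x k)" "e < x" "x < k" "k < m" unfolding triples_def by auto
  have h: "e < x" "x < k" "k \<le> m" using z by auto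
  let ?p = "slot_perm2 m e x k"
  note p = permutes_slot_perm2[OF h]
  have v: "?p k = x - e + 1" "?p x = 1" "?p 1 \<le> Suc x" "?p m = x + 2" using z by (auto simp: slot_perm2_def)
  have "inv ?p 1 = x" using v permutes_inv_eq[OF p] by auto
  \<comment> \<open>The entries of the first block are at most \<open>Suc x\<close>, which is at
    most \<open>k\<close> and thus below \<open>m\<close>.\<close>
  moreover have "x < inv ?p m"
  proof (rule ccontr)
    assume "\<not> ?thesis"
    then have "?p (inv ?p m) \<noteq> m" using z by (auto simp: slot_perm2_def)
    then show False using permutes_inverses[OF p] by simp
  qed
  ultimately show "z \<in> {(k, p) \<in> inner_slots m. p 1 \<noteq> m \<and> p 1 < p m \<and> inv p 1 < inv p m}"
    unfolding z(1) using inner_slots_iff p shallow_slot_perm2[OF h] slot_slot_perm2[OF h] v z(2-4) by auto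
qed

lemma inner_slots_slot_perm4:
  "{(k, p) \<in> inner_slots m. p 1 = m} = (\<lambda>(a, b, c). (Suc c, slot_perm4 m (Suc a) (Suc b) (Suc c))) ` triples (m - 1)"
proof (intro equalityI subsetI)
  fix z assume "z \<in> {(k, p) \<in> inner_slots m. p 1 = m}"
  then obtain k p where z: "z = (k, p)" "(k, p) \<in> inner_slots m" "p 1 = m" by auto
  note s = slotted_of_inner_slots[OF z(2)]
  obtain e x where h: "1 \<le> e" "e < x" "x < k" "p \<circ> transpose 1 m = slot_perm2 (m - 1) e x k"
    using slotted.classify_slot_perm4[OF s(1,2) z(3)] by blast
  have p: "p = slot_perm4 m e x k" unfolding slot_perm4_def h(4)[symmetric] comp_transpose_twice ..
  have "(e - 1, x - 1, k - 1) \<in> triples (m - 1)" using h(1-3) z(2) unfolding triples_def inner_slots_iff by auto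
  moreover have "Suc (e - 1) = e" "Suc (x - 1) = x" "Suc (k - 1) = k" using h by auto
  ultimately show "z \<in> (\<lambda>(a, b, c). (Suc c, slot_perm4 m (Suc a) (Suc b) (Suc c))) ` triples (m - 1)"
    by (intro image_eqI[of _ _ "(e - 1, x - 1, k - 1)"]) (simp only: prod.case z(1) p)
next
  fix z assume "z \<in> (\<lambda>(a, b, c). (Suc c, slot_perm4 m (Suc a) (Suc b) (Suc c))) ` triples (m - 1)"
  then obtain a b c where z: "z = (Suc c, slot_perm4 m (Suc a) (Suc b) (Suc c))" "a < b" "b < c" "c < m - 1"
    unfolding triples_def by auto
  have h: "1 \<le> Suc a" "Suc a < Suc b" "Suc b < Suc c" "Suc c < m" using z by auto
  show "z \<in> {(k, p) \<in> inner_slots m. p 1 = m}"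
    unfolding z(1) using inner_slots_iff permutes_slot_perm4[OF h] shallow_slot_perm4[OF h] slot_slot_perm4[OF h] slot_perm4_apply[OF h] h by auto
qed

lemma inner_slots_slot_perm3:
  "{(k, p) \<in> inner_slots m. p 1 \<noteq> m \<and> p 1 < p m \<and> inv p m < inv p 1}
    = (\<lambda>(a, b, c). (c + 2, slot_perm3 m (a + 2) (b + 2) (c + 2))) ` triples (m - 2)"
proof (intro equalityI subsetI)
  fix z assume "z \<in> {(k, p) \<in> inner_slots m. p 1 \<noteq> m \<and> p 1 < p m \<and> inv p m < inv p 1}"
  then obtain k p where z: "z = (k, p)" "(k, p) \<in> inner_slots m" "p 1 \<noteq> m" "inv p m < inv p 1" by auto
  note s = slotted_of_inner_slots[OF z(2)]
  define r where "r = inv p m"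
  define q where "q = inv p 1"
  have h: "2 \<le> r" "p = slot_perm3 m r q k" "r < q"
    using slotted.classify_slot_perm3[OF s z(4,3)] z(4) unfolding r_def q_def by blast+
  have qk: "q < k" unfolding q_def by (rule slotted.one_before(2)[OF s(1,2)])
  have "(r - 2, q - 2, k - 2) \<in> triples (m - 2)" using h(1,3) qk z(2) unfolding triples_def inner_slots_iff by auto
  moreover have "r - 2 + 2 = r" "q - 2 + 2 = q" "k - 2 + 2 = k" using h(1,3) qk by auto
  ultimately show "z \<in> (\<lambda>(a, b, c). (c + 2, slot_perm3 m (a + 2) (b + 2) (c + 2))) ` triples (m - 2)"
    by (intro image_eqI[of _ _ "(r - 2, q - 2, k - 2)"]) (use z(1) h(2) in \<open>simp only: prod.case\<close>)
next
  fix z assume "z \<in> (\<lambda>(a, b, c). (c + 2, slot_perm3 m (a + 2) (b + 2) (c + 2))) ` triples (m - 2)"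
  then obtain a b c where z: "z = (c + 2, slot_perm3 m (a + 2) (b + 2) (c + 2))" "a < b" "b < c" "c < m - 2"
    unfolding triples_def by auto
  have h: "2 \<le> a + 2" "a + 2 < b + 2" "b + 2 < c + 2" "c + 2 < m" using z by auto
  let ?p = "slot_perm3 m (a + 2) (b + 2) (c + 2)"
  note p = permutes_slot_perm3[OF h]
  have v: "?p (a + 2) = m" "?p (b + 2) = 1" "?p 1 = b + 1" "?p m = b + 3" "?p (c + 2) = b + 2"
    using h by (auto simp: slot_perm3_def)
  have "inv ?p m = a + 2" "inv ?p 1 = b + 2" using v(1,2) permutes_inv_eq[OF p] by auto
  then show "z \<in> {(k, p) \<in> inner_slots m. p 1 \<noteq> m \<and> p 1 < p m \<and> inv p m < inv p 1}"
    unfolding z(1) using inner_slots_iff p shallow_slot_perm3[OF h] slot_slot_perm3[OF h] v h by auto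
qed

lemma inner_slots_slot_perm1:
  "{(k, p) \<in> inner_slots m. p 1 \<noteq> m \<and> p m < p 1}
    = (\<lambda>(a, b, c). (b + 2, slot_perm1 m (a + 1) (b + 2) (c + 2))) ` triples (m - 2)"
proof (intro equalityI subsetI)
  fix z assume "z \<in> {(k, p) \<in> inner_slots m. p 1 \<noteq> m \<and> p m < p 1}"
  then obtain k p where z: "z = (k, p)" "(k, p) \<in> inner_slots m" "p 1 \<noteq> m" "p m < p 1" by auto
  note s = slotted_of_inner_slots[OF z(2)]
  obtain e y where h: "1 \<le> e" "Suc e < k" "k < y" "y < m" "p = slot_perm1 m e k y"
    using slotted.classify_slot_perm1[OF s z(3,4)] by blast
  have "(e - 1, k - 2, y - 2) \<in> triples (m - 2)" using h(1-4) unfolding triples_def by auto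
  moreover have "e - 1 + 1 = e" "k - 2 + 2 = k" "y - 2 + 2 = y" using h by auto
  ultimately show "z \<in> (\<lambda>(a, b, c). (b + 2, slot_perm1 m (a + 1) (b + 2) (c + 2))) ` triples (m - 2)"
    by (intro image_eqI[of _ _ "(e - 1, k - 2, y - 2)"]) (use z(1) h(5) in \<open>simp only: prod.case\<close>)
next
  fix z assume "z \<in> (\<lambda>(a, b, c). (b + 2, slot_perm1 m (a + 1) (b + 2) (c + 2))) ` triples (m - 2)"
  then obtain a b c where z: "z = (b + 2, slot_perm1 m (a + 1) (b + 2) (c + 2))" "a < b" "b < c" "c < m - 2"
    unfolding triples_def by auto
  have h: "1 \<le> a + 1" "Suc (a + 1) < b + 2" "b + 2 < c + 2" "c + 2 < m" using z by auto
  have v: "slot_perm1 m (a + 1) (b + 2) (c + 2) 1 = b + 2 + m - (c + 2)" "slot_perm1 m (a + 1) (b + 2) (c + 2) m = b + 2"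
      "slot_perm1 m (a + 1) (b + 2) (c + 2) (b + 2) = b + 2 - (a + 1)"
    using h by (auto simp: slot_perm1_def)
  then show "z \<in> {(k, p) \<in> inner_slots m. p 1 \<noteq> m \<and> p m < p 1}"
    unfolding z(1) using inner_slots_iff permutes_slot_perm1[OF h] shallow_slot_perm1[OF h] slot_slot_perm1[OF h] h by auto
qed

lemma card_triples_image:
  assumes "\<And>a b c a' b' c'. (a, b, c) \<in> triples M \<Longrightarrow> (a', b', c') \<in> triples M \<Longrightarrow> f a b c = f a' b' c'
    \<Longrightarrow> a = a' \<and> b = b' \<and> c = c'"
  shows "card ((\<lambda>(a, b, c). f a b c) ` triples M) = M choose 3"
proof -
  have "inj_on (\<lambda>(a, b, c). f a b c) (triples M)"
  proof (rule inj_onI)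
    fix s t assume st: "s \<in> triples M" "t \<in> triples M" "(\<lambda>(a, b, c). f a b c) s = (\<lambda>(a, b, c). f a b c) t"
    obtain a b c where s: "s = (a, b, c)" by (cases s)
    obtain a' b' c' where t: "t = (a', b', c')" by (cases t)
    have "f a b c = f a' b' c'" using st(3) unfolding s t by (simp only: prod.case)
    then show "s = t" using assms[OF st(1)[unfolded s] st(2)[unfolded t]] unfolding s t by blast
  qed
  then show ?thesis by (simp add: card_image card_triples)
qed

text \<open>The parameters can be read off: \<open>c\<close> is the slot position, the last entry
  \<open>b + 2\<close> gives \<open>b\<close>, and the slot value \<open>b - a + 1\<close> gives
  \<open>a\<close>.\<close>

lemma card_slot_perm2: "card ((\<lambda>(a, b, c). (c, slot_perm2 m a b c)) ` triples m) = m choose 3"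
proof (rule card_triples_image)
  fix a b c a' b' c' assume t: "(a, b, c) \<in> triples m" "(a', b', c') \<in> triples m"
    and e: "(c, slot_perm2 m a b c) = (c', slot_perm2 m a' b' c')"
  have h: "a < b" "b < c" "c < m" "a' < b'" "b' < c'" "c' < m" using t unfolding triples_def by auto
  have c: "c = c'" and f: "slot_perm2 m a b c x = slot_perm2 m a' b' c' x" for x using e by (blast, metis prod.inject)
  have "b = b'" using f[of m] h by (simp add: slot_perm2_def)
  moreover have "a = a'" using f[of c] h c calculation by (simp add: slot_perm2_def)
  ultimately show "a = a' \<and> b = b' \<and> c = c'" using c by blast
qed

lemma card_slot_perm4: "card ((\<lambda>(a, b, c). (Suc c, slot_perm4 m (Suc a) (Suc b) (Suc c))) ` triples (m - 1)) = (m - 1) choose 3"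
proof (rule card_triples_image)
  fix a b c a' b' c' assume t: "(a, b, c) \<in> triples (m - 1)" "(a', b', c') \<in> triples (m - 1)"
    and e: "(Suc c, slot_perm4 m (Suc a) (Suc b) (Suc c)) = (Suc c', slot_perm4 m (Suc a') (Suc b') (Suc c'))"
  have h: "1 \<le> Suc a" "Suc a < Suc b" "Suc b < Suc c" "Suc c < m"
    and h': "1 \<le> Suc a'" "Suc a' < Suc b'" "Suc b' < Suc c'" "Suc c' < m" using t unfolding triples_def by auto
  have c: "c = c'" and f: "slot_perm4 m (Suc a) (Suc b) (Suc c) x = slot_perm4 m (Suc a') (Suc b') (Suc c') x" for x
    using e by (blast, metis prod.inject)
  have b: "b = b'" using f[of m] slot_perm4_apply(2)[OF h] slot_perm4_apply(2)[OF h'] by simp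
  have "a = a'" using f[of "Suc c"] slot_perm4_apply(3)[OF h] slot_perm4_apply(3)[OF h'] h h' unfolding b c by simp
  then show "a = a' \<and> b = b' \<and> c = c'" using b c by blast
qed

lemma card_slot_perm3: "card ((\<lambda>(a, b, c). (c + 2, slot_perm3 m (a + 2) (b + 2) (c + 2))) ` triples (m - 2)) = (m - 2) choose 3"
proof (rule card_triples_image)
  fix a b c a' b' c' assume t: "(a, b, c) \<in> triples (m - 2)" "(a', b', c') \<in> triples (m - 2)"
    and e: "(c + 2, slot_perm3 m (a + 2) (b + 2) (c + 2)) = (c' + 2, slot_perm3 m (a' + 2) (b' + 2) (c' + 2))"
  have h: "2 \<le> a + 2" "a + 2 < b + 2" "b + 2 < c + 2" "c + 2 < m"
    and h': "2 \<le> a' + 2" "a' + 2 < b' + 2" "b' + 2 < c' + 2" "c' + 2 < m" using t unfolding triples_def by auto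
  have c: "c = c'" and f: "slot_perm3 m (a + 2) (b + 2) (c + 2) x = slot_perm3 m (a' + 2) (b' + 2) (c' + 2) x" for x
    using e by (auto dest: fun_cong)
  have b: "b = b'" using f[of m] h h' by (simp add: slot_perm3_def)
  \<comment> \<open>The parameter \<open>a\<close> is recovered from the position
    \<open>a + 2\<close> of the maximum.\<close>
  have "slot_perm3 m (a' + 2) (b' + 2) (c' + 2) (a + 2) = slot_perm3 m (a' + 2) (b' + 2) (c' + 2) (a' + 2)"
    using f[of "a + 2"] h h' by (simp add: slot_perm3_def)
  then have "a = a'" using permutes_inj[OF permutes_slot_perm3[OF h']] by (simp add: inj_eq)
  then show "a = a' \<and> b = b' \<and> c = c'" using b c by blast
qed

lemma card_slot_perm1: "card ((\<lambda>(a, b, c). (b + 2, slot_perm1 m (a + 1) (b + 2) (c + 2))) ` triples (m - 2)) = (m - 2) choose 3"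
proof (rule card_triples_image)
  fix a b c a' b' c' assume t: "(a, b, c) \<in> triples (m - 2)" "(a', b', c') \<in> triples (m - 2)"
    and e: "(b + 2, slot_perm1 m (a + 1) (b + 2) (c + 2)) = (b' + 2, slot_perm1 m (a' + 1) (b' + 2) (c' + 2))"
  have h: "1 \<le> a + 1" "Suc (a + 1) < b + 2" "b + 2 < c + 2" "c + 2 < m"
    and h': "1 \<le> a' + 1" "Suc (a' + 1) < b' + 2" "b' + 2 < c' + 2" "c' + 2 < m" using t unfolding triples_def by auto
  have b: "b = b'" and f: "slot_perm1 m (a + 1) (b + 2) (c + 2) x = slot_perm1 m (a' + 1) (b' + 2) (c' + 2) x" for x
    using e by (auto dest: fun_cong)
  have "c = c'" using f[of 1] b h h' by (simp add: slot_perm1_def)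
  moreover have "a = a'" using f[of "b + 2"] b h h' by (simp add: slot_perm1_def)
  ultimately show "a = a' \<and> b = b' \<and> c = c'" using b by blast
qed

lemma card_inner_slots:
  "card (inner_slots m) = (m choose 3) + ((m - 1) choose 3) + 2 * ((m - 2) choose 3)"
proof -
  let ?A1 = "{(k, p) \<in> inner_slots m. p 1 \<noteq> m \<and> p m < p 1}"
  let ?A2 = "{(k, p) \<in> inner_slots m. p 1 \<noteq> m \<and> p 1 < p m \<and> inv p 1 < inv p m}"
  let ?A3 = "{(k, p) \<in> inner_slots m. p 1 \<noteq> m \<and> p 1 < p m \<and> inv p m < inv p 1}"
  let ?A4 = "{(k, p) \<in> inner_slots m. p 1 = m}"
  have "inv p 1 \<noteq> inv p m \<and> p 1 \<noteq> p m" if "(k, p) \<in> inner_slots m" for k p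
  proof -
    have h: "p permutes {1..m}" "1 < m" using that unfolding inner_slots_iff by auto
    show ?thesis using permutes_inj[OF h(1)] permutes_inj[OF permutes_inv[OF h(1)]] h(2)
      by (metis inj_eq less_irrefl)
  qed
  then have "inner_slots m = (?A1 \<union> ?A2) \<union> (?A3 \<union> ?A4)" by (auto simp: not_less order.order_iff_strict)
  moreover have "finite (inner_slots m)"
    by (rule finite_subset[OF _ finite_slots[of m]]) (auto simp: inner_slots_def)
  then have f: "finite ?A1" "finite ?A2" "finite ?A3" "finite ?A4"
    by (auto elim: finite_subset[rotated])
  have "?A1 \<inter> ?A2 = {}" "?A3 \<inter> ?A4 = {}" "(?A1 \<union> ?A2) \<inter> (?A3 \<union> ?A4) = {}" by auto
  then have "card ((?A1 \<union> ?A2) \<union> (?A3 \<union> ?A4)) = (card ?A1 + card ?A2) + (card ?A3 + card ?A4)"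
    using f by (subst card_Un_disjoint; simp)+
  ultimately show ?thesis
    using inner_slots_slot_perm1[of m] inner_slots_slot_perm2[of m] inner_slots_slot_perm3[of m] inner_slots_slot_perm4[of m]
      card_slot_perm1[of m] card_slot_perm2[of m] card_slot_perm3[of m] card_slot_perm4[of m] by presburger
qed

text \<open>If the slot entry is 1, the slot position is determined by the permutation; if the slot
  is last, it is fixed outright. Both cases count avoiders of size \<open>m\<close>, the second only
  those not ending in 1.\<close>

lemma card_slots:
  assumes m: "1 \<le> m"
  shows "card (slots m) = card (shallow_avoiders m) + card {p \<in> shallow_avoiders m. p m \<noteq> 1} + card (inner_slots m)"
proof -
  let ?A = "{(k, p) \<in> slots m. p k = 1}" and ?B = "{(k, p) \<in> slots m. p k \<noteq> 1 \<and> k = m}"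
  have "slots m = ?A \<union> (?B \<union> inner_slots m)" unfolding inner_slots_def by (auto simp: slots_def)
  moreover have "finite ?A" "finite ?B" "finite (inner_slots m)"
    using finite_slots[of m] unfolding inner_slots_def by (auto elim: finite_subset[rotated])
  then have "card (?A \<union> (?B \<union> inner_slots m)) = card ?A + (card ?B + card (inner_slots m))"
    by (subst card_Un_disjoint; (auto simp: inner_slots_def)?)+
  ultimately show ?thesis using card_slots_one[OF m] card_slots_last[OF m] by presburger
qed

subsection \<open>Recurrence and generating function\<close>

lemma card_shallow_avoiders_small: "card (shallow_avoiders 0) = 1" "card (shallow_avoiders 1) = 1" "{p \<in> shallow_avoiders 1. p 1 \<noteq> 1} = {}"
proof -
  have s: "shallow n id" if "n \<le> 1" for n
  proof -
    have "{1..n} = {} \<or> {1..n} = {1}" using that by (cases n) auto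
    then have "defect {1..n} id = 0" using defect_singleton[of id 1] by auto
    then show ?thesis using shallow_iff_defect[OF permutes_id, of n] by simp
  qed
  have a: "avoids_123 n id" if "n \<le> 1" for n using that unfolding avoids_123_def by auto
  have "p = id" if "p permutes {1..n}" "n \<le> 1" for p :: "nat \<Rightarrow> nat" and n
    using that by (cases n) auto
  then have "shallow_avoiders n = {id}" if "n \<le> 1" for n
    unfolding shallow_avoiders_def using s[OF that] a[OF that] that permutes_id by blast
  then show "card (shallow_avoiders 0) = 1" "card (shallow_avoiders 1) = 1" "{p \<in> shallow_avoiders 1. p 1 \<noteq> 1} = {}" by auto
qed

lemma slots_0: "slots 0 = {}"
  unfolding slots_def by auto

lemma card_second_end:
  "card {p \<in> shallow_avoiders (Suc (Suc m)). p 1 \<noteq> Suc (Suc m) \<and> p (Suc (Suc m)) = 1} = card (slots m)"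
proof -
  let ?n = "Suc (Suc m)"
  let ?S = "{p \<in> shallow_avoiders ?n. p 1 = ?n \<and> p ?n \<noteq> 1}"
  have "{p \<in> shallow_avoiders ?n. p 1 \<noteq> ?n \<and> p ?n = 1} = inv ` ?S"
  proof (intro equalityI subsetI)
    fix p assume p: "p \<in> {p \<in> shallow_avoiders ?n. p 1 \<noteq> ?n \<and> p ?n = 1}"
    then have "inv p \<in> ?S" using inv_in_shallow_avoiders shallow_avoiders_inv_eq_iff[of p ?n] by auto
    then show "p \<in> inv ` ?S" using p inv_inv_shallow_avoiders by (intro image_eqI[of _ _ "inv p"]) auto
  next
    fix p assume "p \<in> inv ` ?S"
    then obtain q where q: "q \<in> shallow_avoiders ?n" "q 1 = ?n" "q ?n \<noteq> 1" "p = inv q" by auto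
    then show "p \<in> {p \<in> shallow_avoiders ?n. p 1 \<noteq> ?n \<and> p ?n = 1}"
      using inv_in_shallow_avoiders[OF q(1)] shallow_avoiders_inv_eq_iff[OF q(1)] by auto
  qed
  moreover have "card (inv ` ?S) = card ?S" by (rule card_inv_image[of _ ?n]) auto
  ultimately show ?thesis using card_first_end[of m] by simp
qed

text \<open>Four classes, according to whether \<open>p 1 = n\<close> and whether
  \<open>p n = 1\<close>. The two mixed classes are exchanged by inversion, hence the factor
  2.\<close>

lemma card_shallow_avoiders_rec:
  "card (shallow_avoiders (m + 2)) = card (shallow_avoiders m) + 2 * card (slots m) + ((m + 1) + 2 * ((m + 1) choose 3))"
proof -
  let ?n = "Suc (Suc m)"
  let ?A = "{p \<in> shallow_avoiders ?n. p 1 = ?n \<and> p ?n = 1}" and ?B = "{p \<in> shallow_avoiders ?n. p 1 = ?n \<and> p ?n \<noteq> 1}"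
    and ?C = "{p \<in> shallow_avoiders ?n. p 1 \<noteq> ?n \<and> p ?n = 1}" and ?D = "{p \<in> shallow_avoiders ?n. p 1 \<noteq> ?n \<and> p ?n \<noteq> 1}"
  have f: "finite ?A" "finite ?B" "finite ?C" "finite ?D" using finite_shallow_avoiders[of ?n] by auto
  have "?A \<inter> ?B = {}" "?C \<inter> ?D = {}" "(?A \<union> ?B) \<inter> (?C \<union> ?D) = {}" by auto
  then have "card ((?A \<union> ?B) \<union> (?C \<union> ?D)) = (card ?A + card ?B) + (card ?C + card ?D)"
    using f by (subst card_Un_disjoint; simp)+
  note c = this
  have eq: "shallow_avoiders ?n = (?A \<union> ?B) \<union> (?C \<union> ?D)" by blast
  have "card (shallow_avoiders ?n) = (card ?A + card ?B) + (card ?C + card ?D)"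
    by (rule trans[OF arg_cong[OF eq, of card] c])
  moreover have "card ?D = (m + 1) + 2 * ((m + 1) choose 3)" using card_interior[of ?n] by simp
  ultimately show ?thesis
    using card_both_ends[of m] card_first_end[of m] card_second_end[of m] by simp
qed

text \<open>The avoiders of size \<open>m + 2\<close> ending in 1 number t_m + s_m, which resolves
  the middle term of \<open>card_slots\<close>. All terms are kept positive to avoid truncated
  subtraction.\<close>

lemma card_slots_rec:
  "card (slots (m + 2)) + card (slots m) + card (shallow_avoiders m) = 2 * card (shallow_avoiders (m + 2)) + card (inner_slots (m + 2))"
proof -
  let ?n = "Suc (Suc m)"
  have f: "finite (shallow_avoiders ?n)" by (rule finite_shallow_avoiders)
  have "card {p \<in> shallow_avoiders ?n. p ?n = 1} = card {p \<in> shallow_avoiders ?n. p 1 = ?n \<and> p ?n = 1} + card {p \<in> shallow_avoiders ?n. p 1 \<noteq> ?n \<and> p ?n = 1}"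
    using f by (subst card_Un_disjoint[symmetric]) (auto intro: arg_cong[where f = card])
  then have "card {p \<in> shallow_avoiders ?n. p ?n = 1} = card (shallow_avoiders m) + card (slots m)"
    using card_both_ends[of m] card_second_end[of m] by simp
  moreover have "card (shallow_avoiders ?n) = card {p \<in> shallow_avoiders ?n. p ?n = 1} + card {p \<in> shallow_avoiders ?n. p ?n \<noteq> 1}"
    using f by (subst card_Un_disjoint[symmetric]) (auto intro: arg_cong[where f = card])
  ultimately show ?thesis using card_slots[of ?n] by simp
qed

lemma real_choose_3: "real (k choose 3) = real k * (real k - 1) * (real k - 2) / 6"
proof -
  have 2: "real (k choose 2) = real k * (real k - 1) / 2" for k
  proof (induction k)
    case (Suc k)
    have "Suc k choose 2 = k + (k choose 2)" by (simp add: numeral_2_eq_2)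
    then show ?case using Suc by (simp add: field_simps)
  qed simp
  show ?thesis
  proof (induction k)
    case (Suc k)
    have "Suc k choose 3 = (k choose 2) + (k choose 3)" by (simp add: numeral_3_eq_3 numeral_2_eq_2)
    then show ?case using Suc 2[of k] by (simp add: field_simps)
  qed simp
qed

lemma t123_rec:
  "real (t123 (m + 4)) = 4 * real (t123 (m + 2)) - real (t123 m) + 2 * real m ^ 3 + real m ^ 2 + 7 * real m + 6"
proof -
  have e: "m + 2 + 2 = m + 4" "m + 2 + 1 = m + 3" "m + 2 - 1 = m + 1" "m + 2 - 2 = m" by simp_all
  note r = card_shallow_avoiders_rec[of m] card_shallow_avoiders_rec[of "m + 2"] card_slots_rec[of m] card_inner_slots[of "m + 2"]
  \<comment> \<open>Adding the two instances of the first recurrence brings the slots into the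
    combination s_{m+2} + s_m, which \<open>card_slots_rec\<close> eliminates.\<close>
  have "t123 (m + 4) + t123 m = 4 * t123 (m + 2) + 2 * m + 4 + 4 * ((m + 1) choose 3)
      + 2 * ((m + 3) choose 3) + 2 * ((m + 2) choose 3) + 4 * (m choose 3)"
    using r unfolding e t123_eq by linarith
  then have "real (t123 (m + 4)) = 4 * real (t123 (m + 2)) - real (t123 m) + 2 * real m + 4 + 4 * real ((m + 1) choose 3)
      + 2 * real ((m + 3) choose 3) + 2 * real ((m + 2) choose 3) + 4 * real (m choose 3)"
    by linarith
  also have "\<dots> = 4 * real (t123 (m + 2)) - real (t123 m) + 2 * real m ^ 3 + real m ^ 2 + 7 * real m + 6"
    unfolding real_choose_3 by (simp add: field_simps power3_eq_cube power2_eq_square)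
  finally show ?thesis .
qed

text \<open>The recurrence of step four needs four initial values. Sizes 2 and 3 follow from sizes 0
  and 1 through the recurrence with slots.\<close>

lemma t123_small: "t123 0 = 1" "t123 1 = 1" "t123 2 = 2" "t123 3 = 5"
proof -
  show 0: "t123 0 = 1" "t123 1 = 1" using card_shallow_avoiders_small unfolding t123_eq by simp_all
  show "t123 2 = 2" using card_shallow_avoiders_rec[of 0] 0 slots_0 unfolding t123_eq by (simp add: numeral_2_eq_2)
  have "card (slots 1) = 1"
  proof -
    have "card {p \<in> shallow_avoiders 1. p 1 \<noteq> 1} = 0" unfolding card_shallow_avoiders_small by (rule card.empty)
    then show ?thesis
      using card_slots[of 1] card_shallow_avoiders_small(2) card_inner_slots[of 1] by (simp add: binomial_eq_0)
  qed
  then show "t123 3 = 5" using card_shallow_avoiders_rec[of 1] 0 unfolding t123_eq by (simp add: binomial_eq_0 numeral_3_eq_3)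
qed

text \<open>The coefficients of \<open>T\<^sub>1\<^sub>2\<^sub>3 \<cdot> (1 - 4 x\<^sup>2 + x\<^sup>4)\<close>; from \<open>n = 4\<close> on they are the cubic part of the recurrence.\<close>

definition forcing :: "nat \<Rightarrow> real" where
  "forcing n = (if n = 0 then 1 else if n = 1 then 1 else if n = 2 then -2 else if n = 3 then 1
    else 2 * (real n - 4) ^ 3 + (real n - 4) ^ 2 + 7 * (real n - 4) + 6)"

text \<open>The exceptional values -2 and 1 of \<open>forcing\<close> are t_2 - 4 t_0 and t_3 - 4
  t_1, where the x^4 term does not yet contribute.\<close>

lemma fps_t123_times:
  "(Abs_fps (\<lambda>n. of_nat (t123 n)) :: real fps) * (1 - 4 * fps_X ^ 2 + fps_X ^ 4) = Abs_fps forcing"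
proof (rule fps_ext)
  fix n
  let ?T = "Abs_fps (\<lambda>n. of_nat (t123 n)) :: real fps"
  have "?T * (1 - 4 * fps_X ^ 2 + fps_X ^ 4) = ?T - fps_const 4 * (?T * fps_X ^ 2) + ?T * fps_X ^ 4"
    by (simp add: algebra_simps flip: numeral_fps_const)
  then have e: "fps_nth (?T * (1 - 4 * fps_X ^ 2 + fps_X ^ 4)) n
    = real (t123 n) - 4 * (if n < 2 then 0 else real (t123 (n - 2))) + (if n < 4 then 0 else real (t123 (n - 4)))"
    by (simp add: fps_X_power_mult_right_nth)
  consider "n = 0" | "n = 1" | "n = 2" | "n = 3" | "4 \<le> n" by linarith
  then show "fps_nth (?T * (1 - 4 * fps_X ^ 2 + fps_X ^ 4)) n = fps_nth (Abs_fps forcing) n"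
  proof cases
    case 5
    then obtain m where m: "n = m + 4" by (metis add.commute le_Suc_ex)
    have "forcing n = 2 * real m ^ 3 + real m ^ 2 + 7 * real m + 6" unfolding forcing_def m by simp
    moreover have "n - 2 = m + 2" "n - 4 = m" "\<not> n < 2" "\<not> n < 4" using m by auto
    ultimately show ?thesis unfolding e using t123_rec[of m] by (simp add: m)
  next
    case 1
    then show ?thesis unfolding e using t123_small by (simp add: forcing_def)
  next
    case 2
    then show ?thesis unfolding e using t123_small by (simp add: forcing_def)
  next
    case 3
    then show ?thesis unfolding e using t123_small by (simp add: forcing_def)
  next
    case 4
    then show ?thesis unfolding e using t123_small by (simp add: forcing_def)
  qed
qed

text \<open>Multiplication by (1 - x)^4 takes fourth differences, which annihilate cubic
  polynomials. From \<open>n = 8\<close> on all five arguments of \<open>forcing\<close> are at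
  least 4, so only coefficients up to x^7 survive.\<close>

lemma fps_forcing_times:
  "(Abs_fps forcing :: real fps) * (1 - fps_X) ^ 4 =
    1 - 3 * fps_X + 11 * fps_X ^ 3 - 13 * fps_X ^ 4 + 7 * fps_X ^ 5 + 6 * fps_X ^ 6 + 3 * fps_X ^ 7"
    (is "_ = ?N")
proof (rule fps_ext)
  fix n
  let ?G = "Abs_fps forcing"
  have x: "(1 - fps_X) ^ 4 = 1 - 4 * fps_X + 6 * fps_X ^ 2 - 4 * fps_X ^ 3 + (fps_X ^ 4 :: real fps)"
    by (simp add: eval_nat_numeral algebra_simps)
  have "?G * (1 - fps_X) ^ 4 = ?G - fps_const 4 * (?G * fps_X ^ 1) + fps_const 6 * (?G * fps_X ^ 2)
      - fps_const 4 * (?G * fps_X ^ 3) + ?G * fps_X ^ 4"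
    unfolding x by (simp add: algebra_simps flip: numeral_fps_const)
  then have e: "fps_nth (?G * (1 - fps_X) ^ 4) n = forcing n - 4 * (if n < 1 then 0 else forcing (n - 1))
      + 6 * (if n < 2 then 0 else forcing (n - 2)) - 4 * (if n < 3 then 0 else forcing (n - 3))
      + (if n < 4 then 0 else forcing (n - 4))"
    by (simp only: fps_add_nth fps_sub_nth fps_mult_left_const_nth fps_X_power_mult_right_nth fps_nth_Abs_fps)
  have "?N = 1 - fps_const 3 * fps_X ^ 1 + fps_const 11 * fps_X ^ 3 - fps_const 13 * fps_X ^ 4 + fps_const 7 * fps_X ^ 5
      + fps_const 6 * fps_X ^ 6 + fps_const 3 * fps_X ^ 7"
    by (simp flip: numeral_fps_const)
  then have N: "fps_nth ?N n = (if n = 0 then 1 else 0) - 3 * (if n = 1 then 1 else 0) + 11 * (if n = 3 then 1 else 0)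
      - 13 * (if n = 4 then 1 else 0) + 7 * (if n = 5 then 1 else 0) + 6 * (if n = 6 then 1 else 0) + 3 * (if n = 7 then 1 else 0)"
    by (simp only: fps_add_nth fps_sub_nth fps_mult_left_const_nth fps_X_power_nth fps_one_nth)
  consider "n = 0" | "n = 1" | "n = 2" | "n = 3" | "n = 4" | "n = 5" | "n = 6" | "n = 7" | "8 \<le> n" by linarith
  then show "fps_nth (?G * (1 - fps_X) ^ 4) n = fps_nth ?N n"
  proof cases
    case 9
    then obtain m where m: "n = m + 8" by (metis add.commute le_Suc_ex)
    have f: "forcing (m + 4 + j) = 2 * (real m + real j) ^ 3 + (real m + real j) ^ 2 + 7 * (real m + real j) + 6" for j
      unfolding forcing_def by (simp add: algebra_simps)
    have i: "n = m + 4 + 4" "n - 1 = m + 4 + 3" "n - 2 = m + 4 + 2" "n - 3 = m + 4 + 1" "n - 4 = m + 4 + 0" using m by auto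
    have "fps_nth (?G * (1 - fps_X) ^ 4) n = forcing (m + 4 + 4) - 4 * forcing (m + 4 + 3) + 6 * forcing (m + 4 + 2)
        - 4 * forcing (m + 4 + 1) + forcing (m + 4 + 0)"
      unfolding e i(2-5) using m by (simp add: i(1))
    also have "\<dots> = 0" unfolding f by (simp add: algebra_simps power3_eq_cube power2_eq_square)
    finally show ?thesis unfolding N using 9 by simp
  next
    case 1
    then show ?thesis unfolding e N by (simp add: forcing_def)
  next
    case 2
    then show ?thesis unfolding e N by (simp add: forcing_def)
  next
    case 3
    then show ?thesis unfolding e N by (simp add: forcing_def)
  next
    case 4
    then show ?thesis unfolding e N by (simp add: forcing_def)
  next
    case 5
    then show ?thesis unfolding e N by (simp add: forcing_def)
  next
    case 6
    then show ?thesis unfolding e N by (simp add: forcing_def)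
  next
    case 7
    then show ?thesis unfolding e N by (simp add: forcing_def)
  next
    case 8
    then show ?thesis unfolding e N by (simp add: forcing_def)
  qed
qed

theorem theorem5p1:
  shows "(Abs_fps (\<lambda>n. of_nat (t123 n)) :: real fps) =
    (1 - 3 * fps_X + 11 * fps_X ^ 3 - 13 * fps_X ^ 4 + 7 * fps_X ^ 5 + 6 * fps_X ^ 6
       + 3 * fps_X ^ 7)
    / ((1 - fps_X) ^ 4 * (1 - 4 * fps_X ^ 2 + fps_X ^ 4))"
proof -
  let ?T = "Abs_fps (\<lambda>n. of_nat (t123 n)) :: real fps"
  let ?D = "(1 - fps_X) ^ 4 * (1 - 4 * fps_X ^ 2 + fps_X ^ 4) :: real fps"
  \<comment> \<open>The denominator has constant coefficient 1; being nonzero, it can be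
    cancelled.\<close>
  have "fps_nth ?D 0 \<noteq> 0" by simp
  then have D: "?D \<noteq> 0" by (metis fps_zero_nth)
  have "?T * ?D = ?T * (1 - 4 * fps_X ^ 2 + fps_X ^ 4) * (1 - fps_X) ^ 4" by (simp only: mult_ac)
  also have "\<dots> = 1 - 3 * fps_X + 11 * fps_X ^ 3 - 13 * fps_X ^ 4 + 7 * fps_X ^ 5 + 6 * fps_X ^ 6 + 3 * fps_X ^ 7"
    unfolding fps_t123_times by (rule fps_forcing_times)
  finally show ?thesis using nonzero_mult_div_cancel_right[OF D, of ?T] by simp
qed

end
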